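(* Let $k\in\{1,2,3\}$ and let $G$ be a simple graph with $n$ vertices and $2(n-1)-k$ edges. Let $c:E(G)\to[n-1]$ be a colouring in which every colour class has at most two edges, such that $G$ contains no rainbow cycle, and let $A=\{a_1,\dots,a_k\}$ be the set of colour-singular edges of $(G,c)$. Let $G'$ be the graph obtained from $G$ by adding three new edges $e_1,e_2,e_3$ forming a triangle $T$ (on three vertices of $G$), and extend $c$ to a colouring $c'$ of $G'$ with $c'(e_i)=n$ for $i=1,2,3$. Suppose the edges of $T\cup A$ do not induce a subgraph of $G'$ isomorphic to $K_4$. Then $G'$ contains two edge-disjoint rainbow cycles $C_1,C_2$ (rainbow with respect to $c'$) with $|C_1|+|C_2|\le n+2$ and $|E(C_i)\cap E(T)|=1$ for $i=1,2$.
   Context: A cycle (subgraph) is rainbow if its edges have pairwise distinct colours. An edge is colour-singular if no other edge has its colour. $[m]=\{1,\dots,m\}$; $|C|$ denotes the number of edges of $C$. *)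

theory Defs
  imports "HOL-Library.FuncSet"
begin

text \<open>
  Undirected graphs with named edges, so that parallel edges are possible.  Edges added to a
  simple graph may be parallel to existing ones, hence the simple graphs are singled out by a
  predicate.
\<close>

record ('v, 'e) graph =
  verts :: "'v set"
  edges :: "'e set"
  ends :: "'e \<Rightarrow> 'v set"

text \<open>The values of \<^const>\<open>ends\<close> outside \<^const>\<open>edges\<close> are irrelevant.\<close>

definition simple_graph :: "('v, 'e) graph \<Rightarrow> bool" where
  "simple_graph G \<longleftrightarrow> finite (verts G) \<and> finite (edges G) \<and>
     (\<forall>e \<in> edges G. ends G e \<subseteq> verts G \<and> card (ends G e) = 2) \<and>
     inj_on (ends G) (edges G)"

text \<open>
  A cycle is identified with its edge set.  Two parallel edges form a cycle of length two.
\<close>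

definition cycle :: "('v, 'e) graph \<Rightarrow> 'e set \<Rightarrow> bool" where
  "cycle G C \<longleftrightarrow> (\<exists>vs es. vs \<noteq> [] \<and> length es = length vs \<and> distinct vs \<and> distinct es \<and>
     set vs \<subseteq> verts G \<and> set es \<subseteq> edges G \<and>
     (\<forall>i < length vs. ends G (es ! i) = {vs ! i, vs ! (Suc i mod length vs)}) \<and>
     C = set es)"

definition rainbow_cycle :: "('v, 'e) graph \<Rightarrow> ('e \<Rightarrow> 'c) \<Rightarrow> 'e set \<Rightarrow> bool" where
  "rainbow_cycle G c C \<longleftrightarrow> cycle G C \<and> inj_on c C"

definition singular_edges :: "('v, 'e) graph \<Rightarrow> ('e \<Rightarrow> 'c) \<Rightarrow> 'e set" where
  "singular_edges G c = {e \<in> edges G. \<forall>f \<in> edges G. c f = c e \<longrightarrow> f = e}"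

definition edge_induced :: "('v, 'e) graph \<Rightarrow> 'e set \<Rightarrow> ('v, 'e) graph" where
  "edge_induced G F = \<lparr>verts = (\<Union>e \<in> F. ends G e), edges = F, ends = ends G\<rparr>"

definition complete_graph :: "nat \<Rightarrow> (nat, nat set) graph" where
  "complete_graph m = \<lparr>verts = {..<m}, edges = {e. e \<subseteq> {..<m} \<and> card e = 2}, ends = id\<rparr>"

definition graph_isomorphic :: "('v, 'e) graph \<Rightarrow> ('w, 'f) graph \<Rightarrow> bool" where
  "graph_isomorphic G H \<longleftrightarrow> (\<exists>\<phi> \<psi>. bij_betw \<phi> (verts G) (verts H) \<and>
     bij_betw \<psi> (edges G) (edges H) \<and> (\<forall>e \<in> edges G. ends H (\<psi> e) = \<phi> ` ends G e))"

end

theory Submission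
  imports Defs
begin

text \<open>
  All \<open>n - 1\<close> colours occur, and since there is no rainbow cycle every choice of one edge per colour
  is a spanning tree.  Such a graph splits recursively: its vertex set is a disjoint union of
  two smaller sets such that the crossing edges form exactly one colour class and the two
  sides have disjoint sets of colours (this is \<open>built V E A\<close>, where \<open>A\<close> is the set of
  singular edges).  By contracting colour classes of parallel edges this reduces to showing that
  a simple graph cannot have all classes of size two.  In a simple graph every side with
  more than one vertex contains a singular edge, so with at most three of them nearly all splittings
  split off a single vertex \<open>v\<close> joined by two edges of one colour.  A terminal at \<open>v\<close> is then
  replaced by the pair of its two neighbours, and the two required paths in the smaller graph
  extend along these edges.  Generalising the terminals to sets of one or two vertices, the
  induction runs through; the few splittings into larger sides are treated directly, and
  the only failure for three singular edges is a star at the three terminals, which is the excluded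
  \<open>K\<^sub>4\<close>.
\<close>

section \<open>Rainbow paths and forks\<close>

text \<open>Each of the two paths must be rainbow on its own, so they may share vertices and
  colours; only edges must differ, and the two edges of a cut class can serve one path each. The
  obstacle is a singular edge: without rainbow cycles it is the only rainbow path between its ends.
  So the statement carried through the recursion weakens as singular edges accumulate. With one,
  every terminal is a possible root of a fork and \<open>card V\<close> suffices for distinct
  targets. With two, the bound grows by one and only one of two prescribed terminals is a root, up
  to one configuration. With three, one of all three terminals is a root, up to the star. The bounds
  fit the recursion: splitting off a vertex lowers \<open>card V\<close> by one, and moving a
  terminal costs one. In all other splits both sides have fewer singular edges, so the stronger
  statements apply there. The map \<open>\<epsilon>\<close> is a parameter because contraction keeps
  the edges and colours and changes only the ends.\<close>

locale edge_coloured =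
  fixes \<epsilon> :: "'e \<Rightarrow> 'v set" and c :: "'e \<Rightarrow> 'c"
begin

section \<open>Rainbow paths and their closure to cycles\<close>

inductive rainbow_path :: "'v \<Rightarrow> 'v \<Rightarrow> 'e set \<Rightarrow> 'v set \<Rightarrow> bool" where
  nil: "rainbow_path s s {} {s}"
| cons: "rainbow_path s' t P W \<Longrightarrow> \<epsilon> e = {s, s'} \<Longrightarrow> s \<notin> W \<Longrightarrow> c e \<notin> c ` P \<Longrightarrow>
    rainbow_path s t (insert e P) (insert s W)"

lemma rainbow_path_basic:
  assumes "rainbow_path s t P W"
  shows "finite P" "finite W" "s \<in> W" "t \<in> W" "card W = Suc (card P)" "inj_on c P"
    "\<And>e. e \<in> P \<Longrightarrow> \<epsilon> e \<subseteq> W"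
  using assms
proof (induction)
  case (cons s' t P W e s)
  { case 5 then show ?case using cons by (auto simp: card_insert_if) next
    case 6 then show ?case using cons by auto next
    case (7 f) then show ?case using cons by auto }
qed auto

lemma rainbow_path_trans:
  assumes "rainbow_path s u P W" "rainbow_path v t Q W'" "\<epsilon> e = {u, v}" "W \<inter> W' = {}"
    "c ` P \<inter> c ` Q = {}" "c e \<notin> c ` P" "c e \<notin> c ` Q"
  shows "rainbow_path s t (insert e (P \<union> Q)) (W \<union> W')"
  using assms
proof (induction)
  case (nil s)
  then show ?case using cons[of v t Q W' e s] by auto
next
  case (cons s' u P W f s)
  then have *: "rainbow_path s' t (insert e (P \<union> Q)) (W \<union> W')" by auto
  have "rainbow_path s t (insert f (insert e (P \<union> Q))) (insert s (W \<union> W'))"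
    using cons by (intro rainbow_path.cons[OF *]) auto
  then show ?case by (simp add: insert_commute)
qed

lemma rainbow_path_sym:
  assumes "rainbow_path s t P W"
  shows "rainbow_path t s P W"
  using assms
proof (induction)
  case (cons s' t P W e s)
  then show ?case
    using rainbow_path_trans[OF cons.IH nil[of s], of e] by (auto simp: insert_commute)
qed (rule nil)

lemma rainbow_path_first_hit:
  assumes "rainbow_path s t P W" "W \<inter> H \<noteq> {}"
  obtains h P' W' where "rainbow_path s h P' W'" "W' \<inter> H = {h}" "P' \<subseteq> P" "W' \<subseteq> W"
proof -
  have "\<exists>h P' W'. rainbow_path s h P' W' \<and> W' \<inter> H = {h} \<and> P' \<subseteq> P \<and> W' \<subseteq> W"
    using assms
  proof (induction)
    case (nil s)
    then show ?case using rainbow_path.nil[of s] by blast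
  next
    case (cons s' t P W e s)
    show ?case
    proof (cases "s \<in> H")
      case True
      then show ?thesis using rainbow_path.nil[of s] by blast
    next
      case False
      then obtain h P' W' where *: "rainbow_path s' h P' W'" "W' \<inter> H = {h}" "P' \<subseteq> P" "W' \<subseteq> W"
        using cons by auto
      then have "rainbow_path s h (insert e P') (insert s W')"
        using cons by (intro rainbow_path.cons[OF *(1)]) auto
      then show ?thesis using * False by (metis Int_insert_left_if0 insert_mono)
    qed
  qed
  then show ?thesis using that by blast
qed

text \<open>Inner vertices have degree two and the ends degree one; the exclusive or also covers the
  trivial path, where \<open>s = t\<close> and no degree is odd.\<close>

lemma rainbow_path_degree_parity:
  assumes "rainbow_path s t P W"
  shows "odd (card {e \<in> P. w \<in> \<epsilon> e}) \<longleftrightarrow> (w = s) \<noteq> (w = t)"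
  using assms
proof (induction)
  case (cons s' t P W e s)
  have fin: "finite P" and "e \<notin> P" using cons rainbow_path_basic(1,3,7)[OF cons(1)] by auto
  have eq: "{f \<in> insert e P. w \<in> \<epsilon> f} =
      (if w \<in> \<epsilon> e then insert e {f \<in> P. w \<in> \<epsilon> f} else {f \<in> P. w \<in> \<epsilon> f})" by auto
  have "s \<noteq> s'" "s \<noteq> t" using cons rainbow_path_basic(3,4)[OF cons(1)] by auto
  then show ?case unfolding eq using cons fin \<open>e \<notin> P\<close> by auto
qed auto

lemma rainbow_path_lists:
  assumes "rainbow_path s t P W"
  shows "\<exists>vs es. vs \<noteq> [] \<and> hd vs = s \<and> last vs = t \<and> length vs = Suc (length es) \<and>
     distinct vs \<and> distinct es \<and> set vs = W \<and> set es = P \<and>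
     (\<forall>i < length es. \<epsilon> (es ! i) = {vs ! i, vs ! Suc i})"
  using assms
proof (induction)
  case (nil s)
  show ?case by (rule exI[of _ "[s]"], rule exI[of _ "[]"]) auto
next
  case (cons s' t P W e s)
  then obtain vs es where *: "vs \<noteq> []" "hd vs = s'" "last vs = t" "length vs = Suc (length es)"
     "distinct vs" "distinct es" "set vs = W" "set es = P"
     "\<forall>i < length es. \<epsilon> (es ! i) = {vs ! i, vs ! Suc i}" by auto
  have "\<epsilon> ((e # es) ! i) = {(s # vs) ! i, (s # vs) ! Suc i}" if "i < length (e # es)" for i
    using that * cons by (cases i) (auto simp: hd_conv_nth)
  moreover have "e \<notin> P" using cons by auto
  ultimately show ?case using * cons
    by (intro exI[of _ "s # vs"] exI[of _ "e # es"]) auto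
qed

text \<open>The ends in \<open>G\<close> and \<open>\<epsilon>\<close> are compared on
  \<open>P\<close> only, so the lemma closes paths by an edge of the coloured graph as well as by an
  edge of the added triangle.\<close>

lemma rainbow_path_cycle:
  assumes path: "rainbow_path s t P W" and e: "ends G e = {t, s}" "e \<notin> P" "e \<in> edges G"
    and G: "P \<subseteq> edges G" "W \<subseteq> verts G" "\<And>f. f \<in> P \<Longrightarrow> ends G f = \<epsilon> f"
  shows "cycle G (insert e P)"
proof -
  obtain vs es where *: "vs \<noteq> []" "hd vs = s" "last vs = t" "length vs = Suc (length es)"
     "distinct vs" "distinct es" "set vs = W" "set es = P"
     "\<forall>i < length es. \<epsilon> (es ! i) = {vs ! i, vs ! Suc i}"
    using rainbow_path_lists[OF path] by blast
  have "ends G ((es @ [e]) ! i) = {vs ! i, vs ! (Suc i mod length vs)}" if "i < length vs" for i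
  proof (cases "i < length es")
    case True
    then have "es ! i \<in> P" using *(8) nth_mem by blast
    then show ?thesis using True * G(3) by (simp add: nth_append)
  next
    case False
    then have i: "i = length es" using that * by auto
    have "vs ! length es = t" using * by (metis diff_Suc_1 last_conv_nth)
    moreover have "vs ! 0 = s" using * by (metis hd_conv_nth)
    ultimately show ?thesis using i * e G(3) by simp
  qed
  then show ?thesis unfolding cycle_def
    using * e G by (intro exI[of _ vs] exI[of _ "es @ [e]"]) auto
qed

text \<open>Confining the vertices to \<open>V\<close> gives the length bound
  \<open>linked_card\<close> and makes paths of the two sides of a split vertex-disjoint, so that
  they can be concatenated.\<close>

definition linked :: "'v set \<Rightarrow> 'e set \<Rightarrow> 'v \<Rightarrow> 'v \<Rightarrow> 'e set \<Rightarrow> bool" where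
  "linked V E s t P \<longleftrightarrow> (\<exists>W \<subseteq> V. rainbow_path s t P W \<and> P \<subseteq> E)"

lemma linked_refl: "v \<in> V \<Longrightarrow> linked V E v v {}"
  unfolding linked_def using nil[of v] by (intro exI[of _ "{v}"]) simp

lemma linked_mono: "linked V E s t P \<Longrightarrow> V \<subseteq> V' \<Longrightarrow> E \<subseteq> E' \<Longrightarrow> linked V' E' s t P"
  unfolding linked_def by blast

lemma linked_sym: "linked V E s t P \<Longrightarrow> linked V E t s P"
  unfolding linked_def using rainbow_path_sym by blast

lemma linked_in:
  assumes "linked V E s t P"
  shows "finite P" "P \<subseteq> E" "s \<in> V" "t \<in> V"
proof -
  obtain W where W: "W \<subseteq> V" "rainbow_path s t P W" "P \<subseteq> E" using assms by (auto simp: linked_def)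
  show "finite P" "P \<subseteq> E" "s \<in> V" "t \<in> V" using W(1,3) rainbow_path_basic(1,3,4)[OF W(2)] by auto
qed

lemma linked_card:
  assumes "linked V E s t P" "finite V"
  shows "Suc (card P) \<le> card V"
proof -
  obtain W where W: "W \<subseteq> V" "rainbow_path s t P W" using assms(1) by (auto simp: linked_def)
  show ?thesis using card_mono[OF assms(2) W(1)] rainbow_path_basic(5)[OF W(2)] by simp
qed

lemma linked_edge:
  assumes "\<epsilon> e = {s, t}" "s \<noteq> t" "e \<in> E" "s \<in> V" "t \<in> V"
  shows "linked V E s t {e}"
  unfolding linked_def using cons[OF nil[of t], of e s] assms by auto

text \<open>
  \<open>X\<close> and \<open>Z\<close> are reached from \<open>Y\<close> by edge-disjoint rainbow paths.  If \<open>Y\<close> is a pair,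
  each of its elements starts one path; it then stands for the two neighbours of a deleted
  vertex, whose two edges are accounted for by the summand \<open>card Y\<close>.
\<close>

definition fork :: "'v set \<Rightarrow> 'e set \<Rightarrow> nat \<Rightarrow> 'v set \<Rightarrow> 'v set \<Rightarrow> 'v set \<Rightarrow> bool" where
  "fork V E b Y X Z \<longleftrightarrow> (\<exists>y y' x z P Q. Y = {y, y'} \<and> x \<in> X \<and> z \<in> Z \<and>
     linked V E y x P \<and> linked V E y' z Q \<and> P \<inter> Q = {} \<and> card P + card Q + card Y \<le> b)"

lemma forkI:
  "Y = {y, y'} \<Longrightarrow> x \<in> X \<Longrightarrow> z \<in> Z \<Longrightarrow> linked V E y x P \<Longrightarrow> linked V E y' z Q \<Longrightarrow> P \<inter> Q = {} \<Longrightarrow>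
    card P + card Q + card Y \<le> b \<Longrightarrow> fork V E b Y X Z"
  unfolding fork_def by blast

lemma forkE:
  assumes "fork V E b Y X Z"
  obtains y y' x z P Q where "Y = {y, y'}" "x \<in> X" "z \<in> Z" "linked V E y x P" "linked V E y' z Q"
    "P \<inter> Q = {}" "card P + card Q + card Y \<le> b"
  using assms unfolding fork_def by blast

lemma fork_swap:
  assumes "fork V E b Y X Z"
  shows "fork V E b Y Z X"
proof -
  obtain y y' x z P Q where *: "Y = {y, y'}" "x \<in> X" "z \<in> Z" "linked V E y x P" "linked V E y' z Q"
    "P \<inter> Q = {}" "card P + card Q + card Y \<le> b" using assms by (rule forkE)
  show ?thesis by (rule forkI[OF _ *(3,2,5,4)]) (use *(1,6,7) in auto)
qed

lemma fork_mono:
  assumes "fork V E b Y X Z" "V \<subseteq> V'" "E \<subseteq> E'" "X \<subseteq> X'" "Z \<subseteq> Z'" "b \<le> b'"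
  shows "fork V' E' b' Y X' Z'"
proof -
  obtain y y' x z P Q where *: "Y = {y, y'}" "x \<in> X" "z \<in> Z" "linked V E y x P" "linked V E y' z Q"
    "P \<inter> Q = {}" "card P + card Q + card Y \<le> b" using assms(1) by (rule forkE)
  then show ?thesis
    using assms(2-) linked_mono[OF *(4)] linked_mono[OF *(5)] by (intro forkI[of _ y y' x _ z]) auto
qed

lemma fork_pick:
  assumes "fork V E b Y X Z"
  obtains x where "x \<in> X" "fork V E b Y {x} Z"
proof -
  obtain y y' x z P Q where *: "Y = {y, y'}" "x \<in> X" "z \<in> Z" "linked V E y x P" "linked V E y' z Q"
    "P \<inter> Q = {}" "card P + card Q + card Y \<le> b" using assms by (rule forkE)
  show thesis by (rule that[OF *(2) forkI[OF *(1) singletonI *(3-7)]])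
qed

section \<open>Splits along one colour class\<close>

definition joined ::
  "'v set \<Rightarrow> 'e set \<Rightarrow> 'v set \<Rightarrow> 'e set \<Rightarrow> 'v set \<Rightarrow> 'e set \<Rightarrow> 'e set \<Rightarrow> bool" where
  "joined V E V\<^sub>1 E\<^sub>1 V\<^sub>2 E\<^sub>2 F \<longleftrightarrow> V = V\<^sub>1 \<union> V\<^sub>2 \<and> E = E\<^sub>1 \<union> E\<^sub>2 \<union> F \<and> V\<^sub>1 \<inter> V\<^sub>2 = {} \<and>
     c ` E\<^sub>1 \<inter> c ` E\<^sub>2 = {} \<and> F \<noteq> {} \<and> finite F \<and> card F \<le> 2 \<and>
     (\<exists>i. (\<forall>e \<in> F. c e = i) \<and> i \<notin> c ` E\<^sub>1 \<union> c ` E\<^sub>2) \<and>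
     (\<forall>e \<in> F. \<exists>u \<in> V\<^sub>1. \<exists>v \<in> V\<^sub>2. \<epsilon> e = {u, v})"

lemma joined_sym:
  assumes "joined V E V\<^sub>1 E\<^sub>1 V\<^sub>2 E\<^sub>2 F"
  shows "joined V E V\<^sub>2 E\<^sub>2 V\<^sub>1 E\<^sub>1 F"
proof -
  have "\<forall>e \<in> F. \<exists>u \<in> V\<^sub>2. \<exists>v \<in> V\<^sub>1. \<epsilon> e = {u, v}"
  proof
    fix e assume "e \<in> F"
    then obtain u v where "u \<in> V\<^sub>1" "v \<in> V\<^sub>2" "\<epsilon> e = {u, v}"
      using assms unfolding joined_def by blast
    then show "\<exists>u \<in> V\<^sub>2. \<exists>v \<in> V\<^sub>1. \<epsilon> e = {u, v}"
      by (intro bexI[of _ v] bexI[of _ u]) auto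
  qed
  then show ?thesis using assms unfolding joined_def
    by (simp add: Int_commute Un_commute)
qed

lemma joinedD:
  assumes "joined V E V\<^sub>1 E\<^sub>1 V\<^sub>2 E\<^sub>2 F"
  shows "V\<^sub>1 \<subseteq> V" "V\<^sub>2 \<subseteq> V" "E\<^sub>1 \<subseteq> E" "E\<^sub>2 \<subseteq> E" "F \<subseteq> E" "V\<^sub>1 \<inter> V\<^sub>2 = {}" "V = V\<^sub>1 \<union> V\<^sub>2" "E = E\<^sub>1 \<union> E\<^sub>2 \<union> F"
    "E\<^sub>1 \<inter> E\<^sub>2 = {}" "E\<^sub>1 \<inter> F = {}" "E\<^sub>2 \<inter> F = {}" "finite F" "c ` E\<^sub>1 \<inter> c ` E\<^sub>2 = {}"
    "e \<in> F \<Longrightarrow> c e \<notin> c ` E\<^sub>1" "e \<in> F \<Longrightarrow> c e \<notin> c ` E\<^sub>2"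
    "e \<in> F \<Longrightarrow> f \<in> F \<Longrightarrow> c e = c f" "card F = 1 \<or> card F = 2"
proof -
  obtain i where i: "\<forall>e \<in> F. c e = i" "i \<notin> c ` E\<^sub>1 \<union> c ` E\<^sub>2" using assms unfolding joined_def by blast
  show E: "V\<^sub>1 \<inter> V\<^sub>2 = {}" "V = V\<^sub>1 \<union> V\<^sub>2" "E = E\<^sub>1 \<union> E\<^sub>2 \<union> F" "finite F" "c ` E\<^sub>1 \<inter> c ` E\<^sub>2 = {}"
    using assms unfolding joined_def by simp_all
  show "V\<^sub>1 \<subseteq> V" "V\<^sub>2 \<subseteq> V" "E\<^sub>1 \<subseteq> E" "E\<^sub>2 \<subseteq> E" "F \<subseteq> E" unfolding E(2,3) by auto
  show "E\<^sub>1 \<inter> E\<^sub>2 = {}" using E(5) by auto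
  show "E\<^sub>1 \<inter> F = {}" "E\<^sub>2 \<inter> F = {}" "e \<in> F \<Longrightarrow> c e \<notin> c ` E\<^sub>1" "e \<in> F \<Longrightarrow> c e \<notin> c ` E\<^sub>2"
    "e \<in> F \<Longrightarrow> f \<in> F \<Longrightarrow> c e = c f" using i by auto
  have "card F \<noteq> 0" "card F \<le> 2" using assms unfolding joined_def by simp_all
  then show "card F = 1 \<or> card F = 2" by linarith
qed

lemma joined_crossE:
  assumes "joined V E V\<^sub>1 E\<^sub>1 V\<^sub>2 E\<^sub>2 F" "e \<in> F"
  obtains u v where "u \<in> V\<^sub>1" "v \<in> V\<^sub>2" "\<epsilon> e = {u, v}"
  using assms unfolding joined_def by blast

text \<open>Paths on opposite sides have no colour in common and avoid the colour of the cut, so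
  passing through a single cut edge keeps the result rainbow.\<close>

lemma joined_linked:
  assumes j: "joined V E V\<^sub>1 E\<^sub>1 V\<^sub>2 E\<^sub>2 F" and e: "e \<in> F" "\<epsilon> e = {u, v}"
    and P: "linked V\<^sub>1 E\<^sub>1 s u P" and Q: "linked V\<^sub>2 E\<^sub>2 v t Q"
  shows "linked V E s t (insert e (P \<union> Q))" "card (insert e (P \<union> Q)) = Suc (card P + card Q)"
proof -
  obtain W where W: "W \<subseteq> V\<^sub>1" "rainbow_path s u P W" "P \<subseteq> E\<^sub>1" using P by (auto simp: linked_def)
  obtain W' where W': "W' \<subseteq> V\<^sub>2" "rainbow_path v t Q W'" "Q \<subseteq> E\<^sub>2" using Q by (auto simp: linked_def)
  have "rainbow_path s t (insert e (P \<union> Q)) (W \<union> W')"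
  proof (rule rainbow_path_trans[OF W(2) W'(2) e(2)])
    show "W \<inter> W' = {}" using joinedD(6)[OF j] W W' by blast
    show "c ` P \<inter> c ` Q = {}" using joinedD(13)[OF j] W W' by blast
    show "c e \<notin> c ` P" using joinedD(14)[OF j e(1)] W by blast
    show "c e \<notin> c ` Q" using joinedD(15)[OF j e(1)] W' by blast
  qed
  then show "linked V E s t (insert e (P \<union> Q))" unfolding linked_def
    using joinedD(1-5)[OF j] W(1,3) W'(1,3) e(1) by (intro exI[of _ "W \<union> W'"]) blast
  have "e \<notin> P \<union> Q" "P \<inter> Q = {}" using joinedD(9-11)[OF j] W(3) W'(3) e(1) by blast+
  then show "card (insert e (P \<union> Q)) = Suc (card P + card Q)"
    using linked_in(1)[OF P] linked_in(1)[OF Q] by (simp add: card_Un_disjoint)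
qed

lemma joined_fork:
  assumes j: "joined V E V\<^sub>1 E\<^sub>1 V\<^sub>2 E\<^sub>2 F" and e: "e \<in> F" "\<epsilon> e = {u, v}"
    and f: "fork V\<^sub>1 E\<^sub>1 b Y {u} Z" and Q: "linked V\<^sub>2 E\<^sub>2 v x Q" and x: "x \<in> X"
  shows "fork V E (Suc (b + card Q)) Y X Z"
proof -
  obtain y y' z P R where *: "Y = {y, y'}" "z \<in> Z" "linked V\<^sub>1 E\<^sub>1 y u P" "linked V\<^sub>1 E\<^sub>1 y' z R"
    "P \<inter> R = {}" "card P + card R + card Y \<le> b" using f by (auto elim!: forkE)
  have "linked V E y' z R" using linked_mono[OF *(4)] joinedD(1,3)[OF j] by blast
  moreover have "insert e (P \<union> Q) \<inter> R = {}"
    using joinedD(9-11)[OF j] *(5) e linked_in(2)[OF *(4)] linked_in(2)[OF Q] by blast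
  ultimately show ?thesis
    using * x joined_linked[OF j e *(3) Q] by (intro forkI[of _ y y' x _ z _ _ _ "insert e (P \<union> Q)" R]) auto
qed

text \<open>Both branches cross, over different cut edges. That these have the same colour is
  harmless, since each branch contains only one of them.\<close>

lemma joined_fork2:
  assumes j: "joined V E V\<^sub>1 E\<^sub>1 V\<^sub>2 E\<^sub>2 F" and e: "e \<in> F" "\<epsilon> e = {u, v}" and e': "e' \<in> F" "\<epsilon> e' = {u', v'}"
    and ne: "e \<noteq> e'" and f: "fork V\<^sub>1 E\<^sub>1 b Y {u} {u'}"
    and Q: "linked V\<^sub>2 E\<^sub>2 v x Q" "linked V\<^sub>2 E\<^sub>2 v' x' Q'" "Q \<inter> Q' = {}" and x: "x \<in> X" "x' \<in> X'"
  shows "fork V E (Suc (Suc (b + card Q + card Q'))) Y X X'"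
proof -
  obtain y y' P R where *: "Y = {y, y'}" "linked V\<^sub>1 E\<^sub>1 y u P" "linked V\<^sub>1 E\<^sub>1 y' u' R"
    "P \<inter> R = {}" "card P + card R + card Y \<le> b" using f by (auto elim!: forkE)
  have "insert e (P \<union> Q) \<inter> insert e' (R \<union> Q') = {}"
    using joinedD(9-11)[OF j] *(4) e e' ne Q(3) linked_in(2)[OF *(2)] linked_in(2)[OF *(3)]
      linked_in(2)[OF Q(1)] linked_in(2)[OF Q(2)] by blast
  then show ?thesis
    using * x joined_linked[OF j e *(2) Q(1)] joined_linked[OF j e' *(3) Q(2)]
    by (intro forkI[of _ y y' x _ x' _ _ _ "insert e (P \<union> Q)" "insert e' (R \<union> Q')"]) auto
qed

text \<open>No colour recurs outside its side, so an edge singular in a part stays singular, and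
  \<open>A\<close> can be accumulated along the recursion. Cut edges may be parallel, as happens in
  contractions; simplicity enters separately as \<open>inj_on \<epsilon> E\<close>.\<close>

inductive built :: "'v set \<Rightarrow> 'e set \<Rightarrow> 'e set \<Rightarrow> bool" where
  single: "built {v} {} {}"
| join: "built V\<^sub>1 E\<^sub>1 A\<^sub>1 \<Longrightarrow> built V\<^sub>2 E\<^sub>2 A\<^sub>2 \<Longrightarrow> joined V E V\<^sub>1 E\<^sub>1 V\<^sub>2 E\<^sub>2 F \<Longrightarrow>
    built V E (A\<^sub>1 \<union> A\<^sub>2 \<union> (if card F = 1 then F else {}))"

lemma built_basic:
  assumes "built V E A"
  shows "finite V" "V \<noteq> {}" "finite E" "A = {e \<in> E. \<forall>f \<in> E. c f = c e \<longrightarrow> f = e}"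
    "\<And>e. e \<in> E \<Longrightarrow> \<epsilon> e \<subseteq> V \<and> card (\<epsilon> e) = 2"
  using assms
proof (induction)
  case (single v)
  { case 1 show ?case by simp }
  { case 2 show ?case by simp }
  { case 3 show ?case by simp }
  { case 4 show ?case by simp }
  { case 5 then show ?case by simp }
next
  case (join V\<^sub>1 E\<^sub>1 A\<^sub>1 V\<^sub>2 E\<^sub>2 A\<^sub>2 V E F)
  note D = joinedD[OF join(3)]
  { case 1 show ?case using join.IH(1,6) D(7) by simp }
  { case 2 show ?case using join.IH(2) D(7) by simp }
  { case 3 show ?case using join.IH(3,8) D(8,12) by simp }
  { case 4
    have "(\<forall>f \<in> E. c f = c e \<longrightarrow> f = e) \<longleftrightarrow> (\<forall>f \<in> E\<^sub>1. c f = c e \<longrightarrow> f = e)" if "e \<in> E\<^sub>1" for e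
      unfolding D(8) using D(13-15) that by (metis IntI Un_iff emptyE image_eqI)
    moreover have "(\<forall>f \<in> E. c f = c e \<longrightarrow> f = e) \<longleftrightarrow> (\<forall>f \<in> E\<^sub>2. c f = c e \<longrightarrow> f = e)" if "e \<in> E\<^sub>2" for e
      unfolding D(8) using D(13-15) that by (metis IntI Un_iff emptyE image_eqI)
    moreover have "(\<forall>f \<in> E. c f = c e \<longrightarrow> f = e) \<longleftrightarrow> card F = 1" if "e \<in> F" for e
    proof -
      have "(\<forall>f \<in> E. c f = c e \<longrightarrow> f = e) \<longleftrightarrow> (\<forall>f \<in> F. f = e)"
        unfolding D(8) using D(14-16) that by (metis Un_iff image_eqI)
      also have "\<dots> \<longleftrightarrow> F = {e}" using that by auto
      also have "\<dots> \<longleftrightarrow> card F = 1" using that by (auto simp: card_1_singleton_iff)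
      finally show ?thesis .
    qed
    ultimately have "{e \<in> E. \<forall>f \<in> E. c f = c e \<longrightarrow> f = e} =
        {e \<in> E\<^sub>1. \<forall>f \<in> E\<^sub>1. c f = c e \<longrightarrow> f = e} \<union> {e \<in> E\<^sub>2. \<forall>f \<in> E\<^sub>2. c f = c e \<longrightarrow> f = e} \<union>
        {e \<in> F. card F = 1}"
      unfolding D(8) by (simp only: Collect_disj_eq Un_iff conj_disj_distribR) (simp cong: conj_cong)
    then show ?case unfolding join.IH(4)[symmetric] join.IH(9)[symmetric] by simp }
  { case (5 e)
    then consider "e \<in> E\<^sub>1" | "e \<in> E\<^sub>2" | "e \<in> F" using D(8) by auto
    then show ?case
    proof cases
      case 3
      then obtain u v where "u \<in> V\<^sub>1" "v \<in> V\<^sub>2" "\<epsilon> e = {u, v}" by (rule joined_crossE[OF join(3)])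
      moreover have "u \<noteq> v" using calculation D(6) by auto
      ultimately show ?thesis using D(7) by auto
    next
      case 1 then show ?thesis using join.IH(5)[of e] D(1) by auto
    next
      case 2 then show ?thesis using join.IH(10)[of e] D(2) by auto
    qed }
qed

text \<open>Any single edge of the cut gives a passage between the two sides, which are rainbow
  connected by induction.\<close>

lemma built_linked:
  assumes "built V E A" "s \<in> V" "t \<in> V"
  shows "\<exists>P. linked V E s t P"
  using assms
proof (induction arbitrary: s t)
  case (single v)
  then show ?case using linked_refl by auto
next
  case (join V\<^sub>1 E\<^sub>1 A\<^sub>1 V\<^sub>2 E\<^sub>2 A\<^sub>2 V E F)
  note D = joinedD[OF join(3)]
  obtain e where e: "e \<in> F" using join(3) by (auto simp: joined_def)
  obtain u v where uv: "u \<in> V\<^sub>1" "v \<in> V\<^sub>2" "\<epsilon> e = {u, v}" by (rule joined_crossE[OF join(3) e])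
  have cross: "\<exists>P. linked V E s t P" if "s \<in> V\<^sub>1" "t \<in> V\<^sub>2" for s t
    using joined_linked(1)[OF join(3) e uv(3)] join.IH(1)[of s u] join.IH(2)[of v t] that uv by blast
  consider "s \<in> V\<^sub>1" "t \<in> V\<^sub>1" | "s \<in> V\<^sub>2" "t \<in> V\<^sub>2" | "s \<in> V\<^sub>1" "t \<in> V\<^sub>2" | "s \<in> V\<^sub>2" "t \<in> V\<^sub>1"
    using join.prems D(7) by auto
  then show ?case
  proof cases
    case 1 then show ?thesis using join.IH(1) linked_mono[OF _ D(1,3)] by blast
  next
    case 2 then show ?thesis using join.IH(2) linked_mono[OF _ D(2,4)] by blast
  next
    case 3 then show ?thesis using cross by blast
  next
    case 4 then show ?thesis using cross linked_sym by blast
  qed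
qed

lemma built_linkedE:
  assumes "built V E A" "s \<in> V" "t \<in> V"
  obtains P where "linked V E s t P" "Suc (card P) \<le> card V"
proof -
  obtain P where P: "linked V E s t P" using built_linked[OF assms] by blast
  show thesis by (rule that[OF P linked_card[OF P built_basic(1)[OF assms(1)]]])
qed

lemma joined_card:
  assumes "built V\<^sub>1 E\<^sub>1 A\<^sub>1" "built V\<^sub>2 E\<^sub>2 A\<^sub>2" "joined V E V\<^sub>1 E\<^sub>1 V\<^sub>2 E\<^sub>2 F"
  shows "card V = card V\<^sub>1 + card V\<^sub>2"
  using joinedD(6,7)[OF assms(3)] built_basic(1)[OF assms(1)] built_basic(1)[OF assms(2)]
  by (simp add: card_Un_disjoint)

section \<open>One singular edge\<close>

text \<open>By induction both sides of the outermost split would be single vertices, and the two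
  edges of its class would then be parallel.\<close>

lemma built_no_singular:
  assumes "built V E {}" "inj_on \<epsilon> E"
  obtains v where "V = {v}" "E = {}"
proof -
  have "built V E A \<Longrightarrow> inj_on \<epsilon> E \<Longrightarrow> A = {} \<Longrightarrow> \<exists>v. V = {v} \<and> E = {}" for A
  proof (induction rule: built.induct)
    case (join V\<^sub>1 E\<^sub>1 A\<^sub>1 V\<^sub>2 E\<^sub>2 A\<^sub>2 V E F)
    note D = joinedD[OF join(3)]
    have A: "A\<^sub>1 = {}" "A\<^sub>2 = {}" "card F \<noteq> 1"
      using join.prems(2) by (auto split: if_splits)
    then obtain e f where F: "F = {e, f}" "e \<noteq> f" using D(17) by (auto simp: card_2_iff)
    have inj: "inj_on \<epsilon> E\<^sub>1" "inj_on \<epsilon> E\<^sub>2" using join.prems(1) D(3,4) inj_on_subset by blast+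
    obtain v\<^sub>1 v\<^sub>2 where v: "V\<^sub>1 = {v\<^sub>1}" "V\<^sub>2 = {v\<^sub>2}" using join.IH inj A by blast
    have "\<epsilon> e = {v\<^sub>1, v\<^sub>2}" "\<epsilon> f = {v\<^sub>1, v\<^sub>2}"
      using joined_crossE[OF join(3), of e] joined_crossE[OF join(3), of f] v F by auto
    then have "e = f" using inj_onD[OF join.prems(1), of e f] D(5) F by simp
    then show ?case using F by simp
  qed simp
  then show ?thesis using that assms by blast
qed

section \<open>Attached vertices and the remaining splits\<close>

definition attached ::
  "'v set \<Rightarrow> 'e set \<Rightarrow> 'v set \<Rightarrow> 'e set \<Rightarrow> 'v \<Rightarrow> 'e \<Rightarrow> 'v \<Rightarrow> 'e \<Rightarrow> 'v \<Rightarrow> bool" where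
  "attached V E V\<^sub>1 E\<^sub>1 v e r f s \<longleftrightarrow> joined V E V\<^sub>1 E\<^sub>1 {v} {} {e, f} \<and> e \<noteq> f \<and>
     \<epsilon> e = {r, v} \<and> \<epsilon> f = {s, v} \<and> r \<noteq> s \<and> r \<in> V\<^sub>1 \<and> s \<in> V\<^sub>1"

lemma attachedD:
  assumes "attached V E V\<^sub>1 E\<^sub>1 v e r f s"
  shows "joined V E V\<^sub>1 E\<^sub>1 {v} {} {e, f}" "e \<noteq> f" "\<epsilon> e = {r, v}" "\<epsilon> f = {s, v}" "r \<noteq> s" "r \<in> V\<^sub>1" "s \<in> V\<^sub>1"
    "v \<notin> V\<^sub>1" "V = insert v V\<^sub>1" "E = E\<^sub>1 \<union> {e, f}" "e \<notin> E\<^sub>1" "f \<notin> E\<^sub>1"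
proof -
  show *: "joined V E V\<^sub>1 E\<^sub>1 {v} {} {e, f}" "e \<noteq> f" "\<epsilon> e = {r, v}" "\<epsilon> f = {s, v}" "r \<noteq> s" "r \<in> V\<^sub>1" "s \<in> V\<^sub>1"
    using assms unfolding attached_def by simp_all
  show "v \<notin> V\<^sub>1" "V = insert v V\<^sub>1" "E = E\<^sub>1 \<union> {e, f}" "e \<notin> E\<^sub>1" "f \<notin> E\<^sub>1"
    using joinedD(6-8,10)[OF *(1)] by auto
qed

lemma joined_attached:
  assumes j: "joined V E V\<^sub>1 E\<^sub>1 {v} {} F" and "card F \<noteq> 1" "inj_on \<epsilon> E"
  obtains e r f s where "attached V E V\<^sub>1 E\<^sub>1 v e r f s"
proof -
  obtain e f where F: "F = {e, f}" "e \<noteq> f" using joinedD(17)[OF j] assms(2) by (auto simp: card_2_iff)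
  obtain r where r: "r \<in> V\<^sub>1" "\<epsilon> e = {r, v}" using joined_crossE[OF j, of e] F by auto
  obtain s where s: "s \<in> V\<^sub>1" "\<epsilon> f = {s, v}" using joined_crossE[OF j, of f] F by auto
  have "r \<noteq> s" using r s F joinedD(5)[OF j] inj_onD[OF assms(3), of e f] by auto
  then show ?thesis using that j F r s unfolding attached_def by blast
qed

text \<open>If the cut has two edges and one side has no singular edge, that side is a vertex by
  \<open>built_no_singular\<close>. In every other split both sides have fewer singular edges than
  the whole. Hence only attachments need an induction on \<open>card V\<close>; the merges reduce to
  the results for fewer singular edges.\<close>

lemma built_decomp [consumes 3, case_names attach merge]:
  assumes b: "built V E A" and inj: "inj_on \<epsilon> E" and A: "A \<noteq> {}"
  obtains
    (attach) V\<^sub>1 E\<^sub>1 v e r f s where "built V\<^sub>1 E\<^sub>1 A" "inj_on \<epsilon> E\<^sub>1" "attached V E V\<^sub>1 E\<^sub>1 v e r f s"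
      "card V = Suc (card V\<^sub>1)"
  | (merge) V\<^sub>1 E\<^sub>1 A\<^sub>1 V\<^sub>2 E\<^sub>2 A\<^sub>2 F where "built V\<^sub>1 E\<^sub>1 A\<^sub>1" "built V\<^sub>2 E\<^sub>2 A\<^sub>2" "inj_on \<epsilon> E\<^sub>1" "inj_on \<epsilon> E\<^sub>2"
      "joined V E V\<^sub>1 E\<^sub>1 V\<^sub>2 E\<^sub>2 F" "A = A\<^sub>1 \<union> A\<^sub>2 \<union> (if card F = 1 then F else {})"
      "card A = card A\<^sub>1 + card A\<^sub>2 + (if card F = 1 then 1 else 0)" "finite A\<^sub>1" "finite A\<^sub>2"
      "card F = 1 \<or> A\<^sub>1 \<noteq> {} \<and> A\<^sub>2 \<noteq> {}"
  using b
proof (cases rule: built.cases)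
  case single
  then show ?thesis using A by simp
next
  case (join V\<^sub>1 E\<^sub>1 A\<^sub>1 V\<^sub>2 E\<^sub>2 A\<^sub>2 F)
  note D = joinedD[OF join(4)]
  have inj': "inj_on \<epsilon> E\<^sub>1" "inj_on \<epsilon> E\<^sub>2" using inj D(3,4) inj_on_subset by blast+
  \<comment> \<open>The sides are named afresh because either of them may be the one without
    singular edges.\<close>
  have one: thesis if asm: "card F \<noteq> 1" "A' = {}" "A = A''" "joined V E V' E' V'' E'' F"
    "built V' E' A''" "built V'' E'' A'" "inj_on \<epsilon> E'" "inj_on \<epsilon> E''" for V' E' A'' V'' E'' A'
  proof -
    obtain v where v: "V'' = {v}" "E'' = {}" using built_no_singular[of V'' E''] asm(2,6,8) by blast
    then obtain e r f s where "attached V E V' E' v e r f s"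
      using joined_attached[of V E V' E' v F] asm(1,4) inj by blast
    then show thesis using attach asm(3,5,7) joined_card[OF asm(5,6,4)] v by simp
  qed
  show ?thesis
  proof (cases "card F = 1 \<or> A\<^sub>1 \<noteq> {} \<and> A\<^sub>2 \<noteq> {}")
    case True
    have sub: "A\<^sub>1 \<subseteq> E\<^sub>1" "A\<^sub>2 \<subseteq> E\<^sub>2"
      using built_basic(4)[OF join(2)] built_basic(4)[OF join(3)] by blast+
    then have fin: "finite A\<^sub>1" "finite A\<^sub>2"
      using built_basic(3)[OF join(2)] built_basic(3)[OF join(3)] finite_subset by blast+
    have "A\<^sub>1 \<inter> A\<^sub>2 = {}" "(A\<^sub>1 \<union> A\<^sub>2) \<inter> F = {}" using sub D(9-11) by blast+
    then have "card A = card A\<^sub>1 + card A\<^sub>2 + (if card F = 1 then 1 else 0)"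
      using join(1) fin D(12) by (simp add: card_Un_disjoint)
    then show ?thesis using merge[OF join(2,3) inj' join(4,1) _ fin True] by blast
  next
    case False
    then consider "A\<^sub>1 = {}" | "A\<^sub>2 = {}" by blast
    then show ?thesis
    proof cases
      case 1
      then show ?thesis using one[OF _ 1 _ joined_sym[OF join(4)] join(3,2) inj'(2,1)] join(1) False by auto
    next
      case 2
      then show ?thesis using one[OF _ 2 _ join(4) join(2,3) inj'] join(1) False by auto
    qed
  qed
qed

section \<open>Moving terminals off an attached vertex\<close>

definition terminal :: "'v set \<Rightarrow> 'v set \<Rightarrow> bool" where
  "terminal V X \<longleftrightarrow> (\<exists>p \<in> V. \<exists>q \<in> V. X = {p, q})"

lemma terminalE:
  assumes "terminal V X" "v \<in> X"
  obtains q where "X = {v, q}" "v \<in> V" "q \<in> V"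
  using assms unfolding terminal_def by (auto simp: insert_commute)

lemma terminal_basic:
  assumes "terminal V X"
  shows "X \<subseteq> V" "X \<noteq> {}" "card X \<le> 2"
  using assms unfolding terminal_def by (auto simp: card_insert_if)

lemma terminal_subset: "terminal V X \<Longrightarrow> X \<subseteq> V' \<Longrightarrow> terminal V' X"
  unfolding terminal_def by auto

lemma terminal_singleton: "v \<in> V \<Longrightarrow> terminal V {v}"
  unfolding terminal_def by auto

lemma attached_linked:
  assumes a: "attached V E V\<^sub>1 E\<^sub>1 v e r f s" and g: "g \<in> {e, f}" "\<epsilon> g = {y, v}" and P: "linked V\<^sub>1 E\<^sub>1 y x P"
  shows "linked V E v x (insert g P)" "card (insert g P) = Suc (card P)"
proof -
  note l = joined_linked[OF attachedD(1)[OF a] g linked_sym[OF P], of v "{}"]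
  show "linked V E v x (insert g P)" "card (insert g P) = Suc (card P)"
    using l linked_refl[of v "{v}"] linked_sym by auto
qed

text \<open>A terminal containing a deleted vertex \<open>v\<close> is moved along one or both of the edges of \<open>v\<close>.\<close>

lemma attached_terminal:
  assumes a: "attached V E V\<^sub>1 E\<^sub>1 v e r f s" and X: "terminal V X" and v: "v \<in> X"
  obtains X' where "terminal V\<^sub>1 X'" "card X' = 2"
    "\<And>b Y Z. fork V\<^sub>1 E\<^sub>1 b X' Y Z \<Longrightarrow> fork V E (Suc b) X Y Z"
    "\<And>b Y Z. fork V\<^sub>1 E\<^sub>1 b Y X' Z \<Longrightarrow> fork V E (Suc b) Y X Z"
proof -
  note D = attachedD[OF a]
  note sub = joinedD(1,3)[OF D(1)]
  have one: "fork V E (Suc b) Y X Z"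
    if "fork V\<^sub>1 E\<^sub>1 b Y {r'} Z" "g \<in> {e, f}" "\<epsilon> g = {r', v}" for b Y Z r' g
    using joined_fork[OF D(1) that(2,3,1) linked_refl v] by simp
  obtain q where q: "X = {v, q}" "q \<in> V" using terminalE[OF X v] by blast
  show thesis
  proof (cases "q = v")
    \<comment> \<open>Here \<open>X = {v}\<close>, and the pair of both neighbours replaces it. As a
      root, its two branches are extended by different edges at \<open>v\<close>; of these two edges
      one is paid by \<open>Suc b\<close>, the other by the drop of the cardinality from two to
      one.\<close>
    case True
    show thesis
    proof (rule that)
      show "terminal V\<^sub>1 {r, s}" unfolding terminal_def using D by blast
      show "card {r, s} = 2" using D by simp
    next
      fix b Y Z assume "fork V\<^sub>1 E\<^sub>1 b {r, s} Y Z"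
      then obtain y y' x z P Q where *: "{r, s} = {y, y'}" "x \<in> Y" "z \<in> Z" "linked V\<^sub>1 E\<^sub>1 y x P"
        "linked V\<^sub>1 E\<^sub>1 y' z Q" "P \<inter> Q = {}" "card P + card Q + card {r, s} \<le> b" by (rule forkE)
      obtain g h where g: "g \<in> {e, f}" "h \<in> {e, f}" "g \<noteq> h" "\<epsilon> g = {y, v}" "\<epsilon> h = {y', v}"
      proof -
        have "y = r \<and> y' = s \<or> y = s \<and> y' = r" using *(1) by (auto simp: doubleton_eq_iff)
        then show ?thesis
        proof
          assume "y = r \<and> y' = s"
          then show ?thesis using D(2-4) by (intro that[of e f]) auto
        next
          assume "y = s \<and> y' = r"
          then show ?thesis using D(2-4) by (intro that[of f e]) auto
        qed
      qed
      have "insert g P \<inter> insert h Q = {}"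
        using g(1-3) *(6) D(11,12) linked_in(2)[OF *(4)] linked_in(2)[OF *(5)] by blast
      then show "fork V E (Suc b) X Y Z"
        using *(2,3,7) q True D(5) attached_linked[OF a g(1,4) *(4)] attached_linked[OF a g(2,5) *(5)]
        by (intro forkI[of _ v v x _ z _ _ _ "insert g P" "insert h Q"]) auto
    next
      fix b Y Z assume "fork V\<^sub>1 E\<^sub>1 b Y {r, s} Z"
      then obtain x where "x \<in> {r, s}" "fork V\<^sub>1 E\<^sub>1 b Y {x} Z" by (rule fork_pick)
      then show "fork V E (Suc b) Y X Z" using one[of b Y x Z] D(3,4) by blast
    qed
  next
    case False
    then have qV: "q \<in> V\<^sub>1" using q D by auto
    \<comment> \<open>Only \<open>v\<close> moves, and to a neighbour other than \<open>q\<close>,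
      so that the new terminal is again a pair; one of the two neighbours qualifies.\<close>
    obtain r' g where g: "g \<in> {e, f}" "\<epsilon> g = {r', v}" "r' \<noteq> q" "r' \<in> V\<^sub>1"
      using D(3-7) by (cases "r = q") auto
    show thesis
    proof (rule that)
      show "terminal V\<^sub>1 {r', q}" unfolding terminal_def using g qV by blast
      show "card {r', q} = 2" using g by simp
    next
      fix b Y Z assume "fork V\<^sub>1 E\<^sub>1 b {r', q} Y Z"
      then obtain y y' x z P Q where *: "{r', q} = {y, y'}" "x \<in> Y" "z \<in> Z" "linked V\<^sub>1 E\<^sub>1 y x P"
        "linked V\<^sub>1 E\<^sub>1 y' z Q" "P \<inter> Q = {}" "card P + card Q + card {r', q} \<le> b" by (rule forkE)
      have mono: "linked V E y x P" "linked V E y' z Q"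
        using linked_mono[OF *(4) sub] linked_mono[OF *(5) sub] .
      have disj: "insert g P \<inter> Q = {}" "P \<inter> insert g Q = {}"
        using g(1) *(6) D(11,12) linked_in(2)[OF *(4)] linked_in(2)[OF *(5)] by blast+
      consider "y = r'" "y' = q" | "y = q" "y' = r'" using *(1) by (auto simp: doubleton_eq_iff)
      then show "fork V E (Suc b) X Y Z"
      proof cases
        case 1
        then show ?thesis
          using *(2,3,7) q False g(3) mono disj attached_linked[OF a g(1) _ *(4)] g(2)
          by (intro forkI[of _ v q x _ z _ _ _ "insert g P" Q]) auto
      next
        case 2
        then show ?thesis
          using *(2,3,7) q False g(3) mono disj attached_linked[OF a g(1) _ *(5)] g(2)
          by (intro forkI[of _ q v x _ z _ _ _ P "insert g Q"]) auto
      qed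
    next
      fix b Y Z assume "fork V\<^sub>1 E\<^sub>1 b Y {r', q} Z"
      then consider "fork V\<^sub>1 E\<^sub>1 b Y {r'} Z" | "fork V\<^sub>1 E\<^sub>1 b Y {q} Z" by (auto elim: fork_pick)
      then show "fork V E (Suc b) Y X Z"
      proof cases
        case 1 then show ?thesis using one g(1,2) by blast
      next
        case 2 then show ?thesis by (rule fork_mono[OF _ sub]) (use q in auto)
      qed
    qed
  qed
qed

text \<open>A common vertex of root and target makes one branch empty, so the other may be any path,
  with at most \<open>card V - 1\<close> edges.\<close>

lemma fork_trivial:
  assumes b: "built V E A" and Y: "terminal V Y" and v: "v \<in> Y" "v \<in> X" and z: "z \<in> Z" "z \<in> V"
    and n: "card V + card Y \<le> Suc b"
  shows "fork V E b Y X Z"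
proof -
  obtain q where q: "Y = {v, q}" "v \<in> V" "q \<in> V" by (rule terminalE[OF Y v(1)])
  obtain Q where "linked V E q z Q" "Suc (card Q) \<le> card V" by (rule built_linkedE[OF b q(3) z(2)])
  then show ?thesis using q v z n linked_refl[OF q(2), of E] by (intro forkI[of _ v q v _ z _ _ _ "{}" Q]) auto
qed

text \<open>The inequality asks for \<open>card V\<close> with distinct targets and for one more
  with equal targets. The exception is unavoidable: if \<open>a\<close> joins \<open>y\<close> and
  \<open>t\<close>, a rainbow path between them without \<open>a\<close> would close a rainbow
  cycle, so both branches would use \<open>a\<close>.\<close>

lemma fork_one_singular:
  assumes "built V E {a}" "inj_on \<epsilon> E" "terminal V Y" "s \<in> V" "t \<in> V"
    "\<not> (\<exists>y. Y = {y} \<and> s = t \<and> \<epsilon> a = {y, t})" "card V + 2 \<le> b + card {s, t}"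
  shows "fork V E b Y {s} {t}"
  using assms
proof (induction "card V" arbitrary: V E Y s t b rule: less_induct)
  case less
  note Y = terminal_basic[OF less(4)]
  have common: "fork V E b Y {s} {t}" if "s \<in> Y \<or> t \<in> Y" "card Y = 1 \<or> s = t"
  proof -
    have "card {s, t} \<le> 2" by (simp add: card_insert_if)
    moreover have "card {s, t} = 1" if "s = t" using that by simp
    ultimately have "card V + card Y \<le> Suc b" using that(2) Y(3) less.prems(7) by linarith
    moreover have "s \<in> V" "t \<in> V" using less.prems by auto
    ultimately show ?thesis
      using that(1) fork_trivial[OF less.prems(1,3), of s "{s}" t "{t}" b]
        fork_swap[OF fork_trivial[OF less.prems(1,3), of t "{t}" s "{s}" b]] by blast
  qed
  from less.prems(1,2) insert_not_empty[of a "{}"] show ?case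
  proof (cases rule: built_decomp)
    case (attach V\<^sub>1 E\<^sub>1 v e r f s')
    note D = attachedD[OF attach(3)]
    note sub = joinedD(1,3)[OF D(1)]
    have IH: "fork V\<^sub>1 E\<^sub>1 b' Y' {s\<^sub>0} {t\<^sub>0}"
      if "terminal V\<^sub>1 Y'" "s\<^sub>0 \<in> V\<^sub>1" "t\<^sub>0 \<in> V\<^sub>1" "\<not> (\<exists>y. Y' = {y} \<and> s\<^sub>0 = t\<^sub>0 \<and> \<epsilon> a = {y, t\<^sub>0})"
        "card V\<^sub>1 + 2 \<le> b' + card {s\<^sub>0, t\<^sub>0}" for Y' s\<^sub>0 t\<^sub>0 b'
      using less.hyps[OF _ attach(1,2) that] attach(4) by simp
    have out: "fork V E b Y {v} {t\<^sub>0}" if "v \<notin> Y" "t\<^sub>0 \<in> V\<^sub>1" "card V \<le> b" for t\<^sub>0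
    proof -
      have Y\<^sub>1: "terminal V\<^sub>1 Y" using terminal_subset[OF less.prems(3)] Y(1) that(1) D(9) by blast
      \<comment> \<open>A neighbour other than \<open>t\<^sub>0\<close> keeps the targets distinct,
        which avoids both the exception and the larger bound for equal targets.\<close>
      obtain r' g where g: "g \<in> {e, f}" "\<epsilon> g = {r', v}" "r' \<noteq> t\<^sub>0" "r' \<in> V\<^sub>1"
        using D(3-7) by (cases "r = t\<^sub>0") auto
      have "fork V\<^sub>1 E\<^sub>1 (card V\<^sub>1) Y {r'} {t\<^sub>0}" using IH[OF Y\<^sub>1 g(4) that(2)] g(3) by simp
      from joined_fork[OF D(1) g(1,2) this linked_refl, of "{v}"] show ?thesis
        using that(3) attach(4) by (auto intro: fork_mono)
    qed
    have both: "fork V E b Y {v} {t\<^sub>0}" if h: "v \<in> Y" "card Y \<noteq> 1" "t\<^sub>0 \<in> V\<^sub>1" "card V \<le> b" for t\<^sub>0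
    proof -
      obtain q where q: "Y = {v, q}" "q \<in> V" by (rule terminalE[OF less.prems(3) h(1)])
      then have "q \<in> V\<^sub>1" using h(2) D(9) by auto
      then obtain Q where Q: "linked V\<^sub>1 E\<^sub>1 q t\<^sub>0 Q" "Suc (card Q) \<le> card V\<^sub>1"
        using built_linkedE[OF attach(1) _ h(3)] by blast
      \<comment> \<open>The branch at \<open>v\<close> is empty. The other one stays inside
        \<open>V\<^sub>1\<close> and has at most \<open>card V - 2\<close> edges, which leaves room
        for \<open>card Y = 2\<close>.\<close>
      show ?thesis
        using q linked_refl[of v V E] linked_mono[OF Q(1) sub] Q(2) Y(3) attach(4) h(4) D(9)
        by (intro forkI[of _ v q v _ t\<^sub>0 _ _ _ "{}" Q]) auto
    qed
    consider "v \<notin> Y" "s \<noteq> v" "t \<noteq> v" | "v \<in> Y" "s \<noteq> v" "t \<noteq> v" | "s = v" "t = v" "v \<notin> Y"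
      | "s = v" "t \<noteq> v" "v \<notin> Y \<or> card Y \<noteq> 1" | "t = v" "s \<noteq> v" "v \<notin> Y \<or> card Y \<noteq> 1"
      | "s \<in> Y \<or> t \<in> Y" "card Y = 1 \<or> s = t"
      by blast
    then show ?thesis
    proof cases
      case 1
      then have "fork V\<^sub>1 E\<^sub>1 b Y {s} {t}"
        using terminal_subset[OF less.prems(3)] Y(1) D(9) less.prems(4-7) attach(4) by (intro IH) auto
      then show ?thesis by (rule fork_mono[OF _ sub]) auto
    next
      case 2
      obtain Y' where Y': "terminal V\<^sub>1 Y'" "card Y' = 2"
        "\<And>b X Z. fork V\<^sub>1 E\<^sub>1 b Y' X Z \<Longrightarrow> fork V E (Suc b) Y X Z"
        by (rule attached_terminal[OF attach(3) less.prems(3) 2(1)]) blast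
      have "card {s, t} \<le> 2" by (simp add: card_insert_if)
      then have "Suc (b - 1) = b" "card V\<^sub>1 + 2 \<le> b - 1 + card {s, t}"
        using less.prems(7) attach(4) by linarith+
      moreover have "\<not> (\<exists>y. Y' = {y} \<and> s = t \<and> \<epsilon> a = {y, t})" using Y'(2) by auto
      ultimately show ?thesis using Y'(3)[OF IH[OF Y'(1), of s t "b - 1"]] 2 less.prems(4,5) D(9) by auto
    next
      \<comment> \<open>Two targets at \<open>v\<close> become its two distinct neighbours. The two
        added edges raise \<open>card V\<^sub>1\<close> to \<open>card V + 1\<close>, exactly the
        bound for equal targets.\<close>
      case 3
      then have Y\<^sub>1: "terminal V\<^sub>1 Y" using terminal_subset[OF less.prems(3)] Y(1) D(9) by blast
      have "fork V\<^sub>1 E\<^sub>1 (card V\<^sub>1) Y {r} {s'}" using IH[OF Y\<^sub>1 D(6,7)] D(5) by simp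
      from joined_fork2[OF D(1) _ D(3) _ D(4,2) this linked_refl linked_refl, of "{v}" "{v}"]
      show ?thesis using 3 less.prems(7) attach(4) by (auto intro: fork_mono)
    next
      case 4
      then have "card V \<le> b" "t \<in> V\<^sub>1" using less.prems(5,7) D(9) by auto
      then show ?thesis using 4 out both by blast
    next
      case 5
      then have "card V \<le> b" "s \<in> V\<^sub>1" using less.prems(4,7) D(9) by auto
      then show ?thesis using 5 out both fork_swap by blast
    next
      case 6
      then show ?thesis by (rule common)
    qed
  next
    case (merge V\<^sub>1 E\<^sub>1 A\<^sub>1 V\<^sub>2 E\<^sub>2 A\<^sub>2 F)
    \<comment> \<open>The cut must consist of \<open>a\<close> alone and the sides have no singular
      edges, so this is the base case: two vertices joined by \<open>a\<close>.\<close>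
    have "card A\<^sub>1 + card A\<^sub>2 + (if card F = 1 then 1 else 0) = 1" using merge(7) by simp
    then have e: "A\<^sub>1 = {}" "A\<^sub>2 = {}" "card F = 1"
      using merge(8-10) by (auto split: if_splits simp: card_eq_0_iff add_is_1)
    then have F: "F = {a}" using merge(6) by simp
    obtain v where v: "V\<^sub>1 = {v}" using built_no_singular[of V\<^sub>1 E\<^sub>1] merge(1,3) e(1) by blast
    obtain w where w: "V\<^sub>2 = {w}" using built_no_singular[of V\<^sub>2 E\<^sub>2] merge(2,4) e(2) by blast
    have V: "V = {v, w}" "\<epsilon> a = {v, w}" "v \<noteq> w"
      using joinedD(6,7)[OF merge(5)] joined_crossE[OF merge(5), of a] F v w by auto
    show ?thesis
    proof (cases "(s \<in> Y \<or> t \<in> Y) \<and> (card Y = 1 \<or> s = t)")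
      case True
      then show ?thesis using common by blast
    next
      case False
      have "Y = {v} \<or> Y = {w} \<or> Y = {v, w}" using less.prems(3) V(1) unfolding terminal_def by auto
      moreover have "s = v \<or> s = w" "t = v \<or> t = w" using less.prems(4,5) V(1) by auto
      ultimately have eq: "Y = {s, t}" "s \<noteq> t" using False less.prems(6) V(2,3) by auto
      then show ?thesis
        using linked_refl[OF less.prems(4), of E] linked_refl[OF less.prems(5), of E] less.prems(7) V
        by (intro forkI[of _ s t s _ t _ _ _ "{}" "{}"]) auto
    qed
  qed
qed

section \<open>Two singular edges\<close>

text \<open>Neither branch crosses the cut, so they are edge-disjoint. Each side saves one edge
  against its number of vertices, which pays for \<open>card X = 2\<close>.\<close>

lemma fork_straddling:
  assumes b: "built V\<^sub>1 E\<^sub>1 A\<^sub>1" "built V\<^sub>2 E\<^sub>2 A\<^sub>2" and j: "joined V E V\<^sub>1 E\<^sub>1 V\<^sub>2 E\<^sub>2 F"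
    and X: "terminal V X" "p \<in> X" "p \<in> V\<^sub>1" "q \<in> X" "q \<in> V\<^sub>2"
    and y: "y \<in> Y" "y \<in> V\<^sub>1" and z: "z \<in> Z" "z \<in> V\<^sub>2" and n: "card V \<le> n"
  shows "fork V E n X Y Z"
proof -
  note D = joinedD[OF j]
  have "p \<noteq> q" using X(3,5) D(6) by auto
  then have "X = {p, q}" using X(1,2,4) unfolding terminal_def by auto
  moreover obtain P where P: "linked V\<^sub>1 E\<^sub>1 p y P" "Suc (card P) \<le> card V\<^sub>1"
    by (rule built_linkedE[OF b(1) X(3) y(2)])
  moreover obtain Q where Q: "linked V\<^sub>2 E\<^sub>2 q z Q" "Suc (card Q) \<le> card V\<^sub>2"
    by (rule built_linkedE[OF b(2) X(5) z(2)])
  moreover have "P \<inter> Q = {}" using linked_in(2)[OF P(1)] linked_in(2)[OF Q(1)] D(9) by blast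
  moreover have "card P + card Q + card X \<le> n"
    using P(2) Q(2) n terminal_basic(3)[OF X(1)] joined_card[OF b j] by simp
  ultimately show ?thesis
    using linked_mono[OF P(1) D(1,3)] linked_mono[OF Q(1) D(2,4)] y z by (intro forkI[of X p q y _ z]) auto
qed

lemma fork_straddling_cases:
  assumes b: "built V\<^sub>1 E\<^sub>1 A\<^sub>1" "built V\<^sub>2 E\<^sub>2 A\<^sub>2" and j: "joined V E V\<^sub>1 E\<^sub>1 V\<^sub>2 E\<^sub>2 F"
    and X: "terminal V X" "p \<in> X" "p \<in> V\<^sub>1" "q \<in> X" "q \<in> V\<^sub>2"
    and Y: "terminal V Y" and Z: "terminal V Z" and n: "card V \<le> n"
  obtains "fork V E n X Y Z" | "Y \<subseteq> V\<^sub>1" "Z \<subseteq> V\<^sub>1" | "Y \<subseteq> V\<^sub>2" "Z \<subseteq> V\<^sub>2"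
proof -
  have V: "V = V\<^sub>1 \<union> V\<^sub>2" by (rule joinedD(7)[OF j])
  note t = terminal_basic(1,2)[OF Y] terminal_basic(1,2)[OF Z]
  consider y z where "y \<in> Y" "y \<in> V\<^sub>1" "z \<in> Z" "z \<in> V\<^sub>2" | y z where "y \<in> Y" "y \<in> V\<^sub>2" "z \<in> Z" "z \<in> V\<^sub>1"
    | "Y \<subseteq> V\<^sub>1" "Z \<subseteq> V\<^sub>1" | "Y \<subseteq> V\<^sub>2" "Z \<subseteq> V\<^sub>2"
    using t unfolding V by blast
  then show thesis
  proof cases
    case 1 then show thesis using that(1) fork_straddling[OF b j X _ _ _ _ n] by blast
  next
    case 2 then show thesis using that(1) fork_swap[OF fork_straddling[OF b j X _ _ _ _ n]] by blast
  qed (use that in blast)+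
qed

text \<open>Distinct targets exclude the exception of \<open>fork_one_singular\<close> and permit
  the bound \<open>card V\<^sub>1\<close>.\<close>

lemma fork_inside:
  assumes b: "built V\<^sub>1 E\<^sub>1 {a}" "inj_on \<epsilon> E\<^sub>1" and s: "V\<^sub>1 \<subseteq> V" "E\<^sub>1 \<subseteq> E"
    and Y: "terminal V\<^sub>1 Y" and x: "x \<in> X" "x \<in> V\<^sub>1" and z: "z \<in> Z" "z \<in> V\<^sub>1" and "x \<noteq> z" "card V\<^sub>1 \<le> n"
  shows "fork V E n Y X Z"
proof -
  have "fork V\<^sub>1 E\<^sub>1 n Y {x} {z}" using assms by (intro fork_one_singular[OF b Y]) auto
  then show ?thesis by (rule fork_mono[OF _ s]) (use x z in auto)
qed

text \<open>The far target is replaced by the near end \<open>u\<close> of a cut edge. As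
  \<open>u\<close> may coincide with \<open>x\<close>, the exception and the bound for equal targets
  come into play; hence \<open>card V < n\<close> instead of \<open>card V \<le> n\<close>.\<close>

lemma fork_across:
  assumes b: "built V\<^sub>1 E\<^sub>1 {a}" "inj_on \<epsilon> E\<^sub>1" "built V\<^sub>2 E\<^sub>2 A\<^sub>2" and j: "joined V E V\<^sub>1 E\<^sub>1 V\<^sub>2 E\<^sub>2 F"
    and Y: "terminal V\<^sub>1 Y" and x: "x \<in> X" "x \<in> V\<^sub>1" and z: "z \<in> Z" "z \<in> V\<^sub>2"
    and e: "e \<in> F" "\<epsilon> e = {u, v}" "u \<in> V\<^sub>1" "v \<in> V\<^sub>2"
    and ex: "\<not> (\<exists>y. Y = {y} \<and> x = u \<and> \<epsilon> a = {y, u})" and n: "card V < n"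
  shows "fork V E n Y X Z"
proof -
  have "card {u, x} \<ge> 1" by (simp add: card_insert_if)
  then have f: "fork V\<^sub>1 E\<^sub>1 (card V\<^sub>1 + 1) Y {u} {x}" using ex by (intro fork_one_singular[OF b(1,2) Y e(3) x(2)]) auto
  obtain Q where Q: "linked V\<^sub>2 E\<^sub>2 v z Q" "Suc (card Q) \<le> card V\<^sub>2" by (rule built_linkedE[OF b(3) e(4) z(2)])
  have "fork V E n Y Z X"
    by (rule fork_mono[OF joined_fork[OF j e(1,2) f Q(1) z(1)]])
       (use Q(2) n joined_card[OF b(1,3) j] x(1) in auto)
  then show ?thesis by (rule fork_swap)
qed

text \<open>The choice of root removes the exception: it blocks root \<open>X\<close> only if the
  target \<open>y\<close> is \<open>u\<close>. With root \<open>Y\<close> the target is then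
  \<open>x \<noteq> u\<close>, and nothing is blocked.\<close>

lemma fork_two_inside:
  assumes b: "built V\<^sub>1 E\<^sub>1 {a}" "inj_on \<epsilon> E\<^sub>1" "built V\<^sub>2 E\<^sub>2 A\<^sub>2" and j: "joined V E V\<^sub>1 E\<^sub>1 V\<^sub>2 E\<^sub>2 F"
    and X: "terminal V X" "X \<subseteq> V\<^sub>1" and Y: "terminal V Y" "Y \<subseteq> V\<^sub>1" and Z: "terminal V Z"
    and disj: "X \<inter> Y = {}" "X \<inter> Z = {}" "Y \<inter> Z = {}" and n: "card V < n"
  shows "fork V E n X Y Z \<or> fork V E n Y X Z"
proof -
  note D = joinedD[OF j]
  have X\<^sub>1: "terminal V\<^sub>1 X" and Y\<^sub>1: "terminal V\<^sub>1 Y" using terminal_subset X Y by blast+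
  obtain x y z where xyz: "x \<in> X" "y \<in> Y" "z \<in> Z"
    using terminal_basic(2)[OF X(1)] terminal_basic(2)[OF Y(1)] terminal_basic(2)[OF Z] by blast
  have V: "x \<in> V\<^sub>1" "y \<in> V\<^sub>1" "z \<in> V\<^sub>1 \<or> z \<in> V\<^sub>2"
    using xyz X(2) Y(2) terminal_basic(1)[OF Z] D(7) by blast+
  show ?thesis
  proof (cases "z \<in> V\<^sub>1")
    case True
    have "card V\<^sub>1 \<le> n" using n joined_card[OF b(1,3) j] by simp
    then show ?thesis
      using fork_inside[OF b(1,2) D(1,3) X\<^sub>1 xyz(2) V(2) xyz(3) True] disj(3) xyz by blast
  next
    case False
    then have z: "z \<in> V\<^sub>2" using V(3) by blast
    obtain e where e: "e \<in> F" using j unfolding joined_def by blast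
    obtain u v where uv: "u \<in> V\<^sub>1" "v \<in> V\<^sub>2" "\<epsilon> e = {u, v}" by (rule joined_crossE[OF j e])
    show ?thesis
    proof (cases "\<exists>x. X = {x} \<and> y = u \<and> \<epsilon> a = {x, u}")
      case True
      then have "x \<noteq> u" using xyz disj(1) by blast
      then show ?thesis
        using fork_across[OF b j Y\<^sub>1 xyz(1) V(1) xyz(3) z e uv(3,1,2) _ n] by blast
    next
      case False
      then show ?thesis
        using fork_across[OF b j X\<^sub>1 xyz(2) V(2) xyz(3) z e uv(3,1,2) _ n] by blast
    qed
  qed
qed

text \<open>If both other terminals lie on one side, \<open>Y\<close> becomes the root and
  \<open>X\<close> serves as a target through its vertex on that side, so the cut is not
  crossed.\<close>

lemma fork_straddling_one_singular:
  assumes b: "built V\<^sub>1 E\<^sub>1 {a}" "inj_on \<epsilon> E\<^sub>1" "built V\<^sub>2 E\<^sub>2 {a'}" "inj_on \<epsilon> E\<^sub>2" and j: "joined V E V\<^sub>1 E\<^sub>1 V\<^sub>2 E\<^sub>2 F"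
    and X: "terminal V X" "\<not> X \<subseteq> V\<^sub>1" "\<not> X \<subseteq> V\<^sub>2" and Y: "terminal V Y" and Z: "terminal V Z"
    and disj: "X \<inter> Y = {}" "X \<inter> Z = {}" "Y \<inter> Z = {}" and n: "card V \<le> n"
  shows "fork V E n X Y Z \<or> fork V E n Y X Z"
proof -
  note D = joinedD[OF j]
  obtain p q where pq: "p \<in> X" "p \<in> V\<^sub>1" "q \<in> X" "q \<in> V\<^sub>2"
    using X terminal_basic(1)[OF X(1)] D(7) by blast
  obtain z where z: "z \<in> Z" using terminal_basic(2)[OF Z] by blast
  have le: "card V\<^sub>1 \<le> n" "card V\<^sub>2 \<le> n" using joined_card[OF b(1,3) j] n by auto
  have ne: "p \<noteq> z" "q \<noteq> z" using z pq disj by auto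
  show ?thesis
  proof (rule fork_straddling_cases[OF b(1,3) j X(1) pq Y Z n])
    assume *: "Y \<subseteq> V\<^sub>1" "Z \<subseteq> V\<^sub>1"
    then show ?thesis
      using fork_inside[OF b(1,2) D(1,3) terminal_subset[OF Y *(1)] pq(1,2) z _ ne(1) le(1)] z by blast
  next
    assume *: "Y \<subseteq> V\<^sub>2" "Z \<subseteq> V\<^sub>2"
    then show ?thesis
      using fork_inside[OF b(3,4) D(2,4) terminal_subset[OF Y *(1)] pq(3,4) z _ ne(2) le(2)] z by blast
  qed blast
qed

text \<open>Root \<open>X\<close> may reach \<open>Y\<close> over either cut edge. Both attempts are
  blocked only if both cut edges end at \<open>z\<close> and \<open>a\<close> joins \<open>z\<close>
  to the single vertex of \<open>X\<close>. By simplicity their far ends then differ, and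
  \<open>Y\<close> becomes the root: both branches cross to \<open>z\<close>, and one continues
  along \<open>a\<close> to \<open>X\<close>.\<close>

lemma fork_double_cross:
  assumes b: "built V\<^sub>1 E\<^sub>1 {a}" "inj_on \<epsilon> E\<^sub>1" "built V\<^sub>2 E\<^sub>2 {a'}" "inj_on \<epsilon> E\<^sub>2"
    and j: "joined V E V\<^sub>1 E\<^sub>1 V\<^sub>2 E\<^sub>2 F" and F: "card F \<noteq> 1" and inj: "inj_on \<epsilon> E"
    and X: "terminal V X" "X \<subseteq> V\<^sub>1" and Y: "terminal V Y" "Y \<subseteq> V\<^sub>2" and Z: "z \<in> Z" "z \<in> V\<^sub>1"
    and n: "card V < n"
  shows "fork V E n X Y Z \<or> fork V E n Y X Z"
proof -
  note D = joinedD[OF j]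
  have X\<^sub>1: "terminal V\<^sub>1 X" and Y\<^sub>2: "terminal V\<^sub>2 Y" using terminal_subset X Y by blast+
  obtain y where y: "y \<in> Y" "y \<in> V\<^sub>2" using terminal_basic(2)[OF Y(1)] Y(2) by blast
  obtain e f where ef: "F = {e, f}" "e \<noteq> f" using D(17) F by (auto simp: card_2_iff)
  obtain u v where uv: "u \<in> V\<^sub>1" "v \<in> V\<^sub>2" "\<epsilon> e = {u, v}" using joined_crossE[OF j, of e] ef by blast
  obtain u' v' where uv': "u' \<in> V\<^sub>1" "v' \<in> V\<^sub>2" "\<epsilon> f = {u', v'}" using joined_crossE[OF j, of f] ef by blast
  consider "\<not> (\<exists>x. X = {x} \<and> z = u \<and> \<epsilon> a = {x, u})" | "\<not> (\<exists>x. X = {x} \<and> z = u' \<and> \<epsilon> a = {x, u'})"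
    | x where "X = {x}" "z = u" "z = u'" "\<epsilon> a = {x, z}" by blast
  then show ?thesis
  proof cases
    case 1
    from fork_across[OF b(1-3) j X\<^sub>1 Z y _ uv(3,1,2) 1 n] show ?thesis using ef fork_swap by blast
  next
    case 2
    from fork_across[OF b(1-3) j X\<^sub>1 Z y _ uv'(3,1,2) 2 n] show ?thesis using ef fork_swap by blast
  next
    case (3 x)
    have a: "a \<in> E\<^sub>1" using built_basic(4)[OF b(1)] by blast
    then have ca: "card (\<epsilon> a) = 2" "\<epsilon> a \<subseteq> V\<^sub>1" using built_basic(5)[OF b(1)] by blast+
    then have V\<^sub>1: "card V\<^sub>1 \<ge> 2" using card_mono[OF built_basic(1)[OF b(1)], of "\<epsilon> a"] by simp
    have "x \<noteq> z" using ca 3(4) by auto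
    have "\<epsilon> e \<noteq> \<epsilon> f" using inj_onD[OF inj, of e f] ef D(5) by blast
    then have "v \<noteq> v'" using uv(3) uv'(3) 3 by auto
    then have f: "fork V\<^sub>2 E\<^sub>2 (card V\<^sub>2) Y {v} {v'}" by (intro fork_one_singular[OF b(3,4) Y\<^sub>2 uv(2) uv'(2)]) auto
    have l: "linked V\<^sub>1 E\<^sub>1 u' x {a}"
      using a ca 3 \<open>x \<noteq> z\<close> uv' by (intro linked_edge) auto
    \<comment> \<open>The two cut edges and \<open>a\<close> give \<open>card V\<^sub>2 + 3\<close>.
      This is within \<open>n\<close>, because \<open>V\<^sub>1\<close> contains the two ends of
      \<open>a\<close>.\<close>
    have "fork V E (Suc (Suc (card V\<^sub>2 + card ({} :: 'e set) + card {a}))) Y Z X"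
      by (rule joined_fork2[OF joined_sym[OF j] _ _ _ _ ef(2) f linked_refl[OF Z(2), of E\<^sub>1] l])
         (use uv uv' 3 ef Z in auto)
    then have "fork V E n Y Z X"
      by (rule fork_mono) (use n V\<^sub>1 joined_card[OF b(1,3) j] in auto)
    then show ?thesis using fork_swap by blast
  qed
qed

lemma fork_double_join:
  assumes b: "built V\<^sub>1 E\<^sub>1 {a}" "inj_on \<epsilon> E\<^sub>1" "built V\<^sub>2 E\<^sub>2 {a'}" "inj_on \<epsilon> E\<^sub>2"
    and j: "joined V E V\<^sub>1 E\<^sub>1 V\<^sub>2 E\<^sub>2 F" and F: "card F \<noteq> 1" and inj: "inj_on \<epsilon> E"
    and t: "terminal V X" "terminal V Y" "terminal V Z"
    and disj: "X \<inter> Y = {}" "X \<inter> Z = {}" "Y \<inter> Z = {}" and n: "card V < n"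
  shows "fork V E n X Y Z \<or> fork V E n Y X Z"
proof -
  note D = joinedD[OF j]
  note j' = joined_sym[OF j]
  have disj': "Y \<inter> X = {}" using disj by blast
  have n': "card V \<le> n" using n by simp
  obtain z where z: "z \<in> Z" "z \<in> V\<^sub>1 \<or> z \<in> V\<^sub>2" using terminal_basic(1,2)[OF t(3)] D(7) by blast
  consider "X \<subseteq> V\<^sub>1" "Y \<subseteq> V\<^sub>1" | "X \<subseteq> V\<^sub>2" "Y \<subseteq> V\<^sub>2" | "\<not> X \<subseteq> V\<^sub>1" "\<not> X \<subseteq> V\<^sub>2" | "\<not> Y \<subseteq> V\<^sub>1" "\<not> Y \<subseteq> V\<^sub>2"
    | "X \<subseteq> V\<^sub>1" "Y \<subseteq> V\<^sub>2" | "X \<subseteq> V\<^sub>2" "Y \<subseteq> V\<^sub>1" by blast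
  then show ?thesis
  proof cases
    case 1 then show ?thesis using fork_two_inside[OF b(1-3) j t(1) _ t(2) _ t(3) disj n] by blast
  next
    case 2 then show ?thesis using fork_two_inside[OF b(3,4,1) j' t(1) _ t(2) _ t(3) disj n] by blast
  next
    case 3 then show ?thesis using fork_straddling_one_singular[OF b j t(1) _ _ t(2,3) disj n'] by blast
  next
    case 4 then show ?thesis
      using fork_straddling_one_singular[OF b j t(2) _ _ t(1,3) disj' disj(3,2) n'] by blast
  next
    case 5 then show ?thesis
      using z fork_double_cross[OF b j F inj t(1) _ t(2) _ z(1) _ n]
        fork_double_cross[OF b(3,4,1,2) j' F inj t(2) _ t(1) _ z(1) _ n] by blast
  next
    case 6 then show ?thesis
      using z fork_double_cross[OF b j F inj t(2) _ t(1) _ z(1) _ n]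
        fork_double_cross[OF b(3,4,1,2) j' F inj t(1) _ t(2) _ z(1) _ n] by blast
  qed
qed

text \<open>The vertex \<open>w\<close> hangs on the singular edge \<open>e\<close>. If it belongs
  to one of the two possible roots, the other one is taken as the root. This is blocked only when
  \<open>a\<close> and \<open>e\<close> form a path with middle vertex \<open>z\<close>, the
  excluded configuration.\<close>

lemma fork_pendant:
  assumes b: "built V\<^sub>1 E\<^sub>1 {a}" "inj_on \<epsilon> E\<^sub>1" "built {w} E\<^sub>2 A\<^sub>2" and j: "joined V E V\<^sub>1 E\<^sub>1 {w} E\<^sub>2 {e}"
    and t: "terminal V X" "terminal V Y" "terminal V Z"
    and disj: "X \<inter> Y = {}" "X \<inter> Z = {}" "Y \<inter> Z = {}" and n: "card V < n"
    and ex: "\<not> (\<exists>x y z. X = {x} \<and> Y = {y} \<and> Z = {z} \<and> {\<epsilon> a, \<epsilon> e} = {{x, z}, {y, z}})"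
  shows "fork V E n X Y Z \<or> fork V E n Y X Z"
proof -
  note D = joinedD[OF j]
  obtain u where u: "u \<in> V\<^sub>1" "\<epsilon> e = {u, w}" using joined_crossE[OF j, of e] by blast
  have V: "V = insert w V\<^sub>1" using D(7) by auto
  have le: "card V\<^sub>1 \<le> n" using n joined_card[OF b(1,3) j] by simp
  have main: "fork V E n Y' X' Z \<or> (\<exists>y. X' = {w} \<and> Y' = {y} \<and> Z = {u} \<and> \<epsilon> a = {y, u})"
    if h: "terminal V X'" "terminal V Y'" "w \<in> X'" "X' \<inter> Y' = {}" "X' \<inter> Z = {}" "Y' \<inter> Z = {}" for X' Y'
  proof -
    have Y': "terminal V\<^sub>1 Y'" using terminal_subset[OF h(2)] terminal_basic(1)[OF h(2)] h(3,4) V by blast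
    \<comment> \<open>Choosing \<open>z\<close> different from \<open>u\<close> whenever possible
      leaves the exception only for \<open>Z = {u}\<close>.\<close>
    obtain z where z: "z \<in> Z" "z \<noteq> u \<or> Z = {u}" using terminal_basic(2)[OF t(3)] by blast
    have zV: "z \<in> V\<^sub>1" using z(1) terminal_basic(1)[OF t(3)] h(3,5) V by blast
    show ?thesis
    proof (cases "X' = {w}")
      case True
      show ?thesis
      proof (cases "\<exists>y. Y' = {y} \<and> z = u \<and> \<epsilon> a = {y, u}")
        case False
        from fork_across[OF b j Y' z(1) zV h(3) _ _ u(2,1) _ this n] show ?thesis
          using fork_swap by blast
      qed (use True z in blast)
    next
      case False
      then obtain q where q: "q \<in> X'" "q \<in> V\<^sub>1" using h(3) terminal_basic(1)[OF h(1)] V by blast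
      then have "q \<noteq> z" using z h(5) by blast
      from fork_inside[OF b(1,2) D(1,3) Y' q z(1) zV this le] show ?thesis by blast
    qed
  qed
  consider "w \<in> X" | "w \<in> Y" | "X \<subseteq> V\<^sub>1" "Y \<subseteq> V\<^sub>1"
    using terminal_basic(1)[OF t(1)] terminal_basic(1)[OF t(2)] V by blast
  then show ?thesis
  proof cases
    case 1
    have "\<not> (\<exists>y. X = {w} \<and> Y = {y} \<and> Z = {u} \<and> \<epsilon> a = {y, u})" using ex u(2) by (auto simp: insert_commute)
    then show ?thesis using main[OF t(1,2) 1 disj] by blast
  next
    case 2
    have "\<not> (\<exists>y. Y = {w} \<and> X = {y} \<and> Z = {u} \<and> \<epsilon> a = {y, u})" using ex u(2) by (auto simp: insert_commute)
    then show ?thesis using main[OF t(2,1) 2 _ disj(3,2)] disj(1) by blast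
  next
    case 3
    then show ?thesis using fork_two_inside[OF b j t(1) _ t(2) _ t(3) disj n] by blast
  qed
qed

lemma fork_common:
  assumes "built V E A" "terminal V X" "terminal V Y" "terminal V Z" "X \<inter> Y \<noteq> {}" "card V < n"
  shows "fork V E n X Y Z"
proof -
  obtain v z where v: "v \<in> X" "v \<in> Y" "z \<in> Z" "z \<in> V"
    using assms(5) terminal_basic(1,2)[OF assms(4)] by blast
  show ?thesis
    using terminal_basic(3)[OF assms(2)] assms(6) by (intro fork_trivial[OF assms(1,2) v]) simp
qed

text \<open>The exception cannot be avoided: the only rainbow path between \<open>x\<close> and
  \<open>y\<close> is then the one through \<open>z\<close> along both singular edges, and it shares
  an edge with the only rainbow path from either end to \<open>z\<close>. Moving a terminal turns it
  into a pair, to which the exception does not apply, so it must be handled only where it arises, at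
  a pendant singular edge.\<close>

lemma fork_two_singular:
  assumes "built V E A" "inj_on \<epsilon> E" "card A = 2" "terminal V X" "terminal V Y" "terminal V Z"
    "\<not> (\<exists>x y z. X = {x} \<and> Y = {y} \<and> Z = {z} \<and> \<epsilon> ` A = {{x, z}, {y, z}})" "card V < n"
  shows "fork V E n X Y Z \<or> fork V E n Y X Z"
  using assms
proof (induction "card V" arbitrary: V E X Y Z n rule: less_induct)
  case less
  note b = less.prems(1) and inj = less.prems(2) and t = less.prems(4-6) and ex = less.prems(7) and n = less.prems(8)
  show ?case
  proof (cases "X \<inter> Y = {} \<and> X \<inter> Z = {} \<and> Y \<inter> Z = {}")
    case False
    then show ?thesis
      using fork_common[OF b t(1,2,3) _ n] fork_swap[OF fork_common[OF b t(1,3,2) _ n]]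
        fork_swap[OF fork_common[OF b t(2,3,1) _ n]] by blast
  next
    case True
    then have disj: "X \<inter> Y = {}" "X \<inter> Z = {}" "Y \<inter> Z = {}" by blast+
    have "A \<noteq> {}" using less.prems(3) by auto
    with b inj show ?thesis
    proof (cases rule: built_decomp)
      case (attach V\<^sub>1 E\<^sub>1 v e r f s)
      note D = attachedD[OF attach(3)]
      note sub = joinedD(1,3)[OF D(1)]
      obtain m where m: "n = Suc m" "card V\<^sub>1 < m" using n attach(4) by (metis Suc_less_eq2)
      have IH: "fork V\<^sub>1 E\<^sub>1 m X' Y' Z' \<or> fork V\<^sub>1 E\<^sub>1 m Y' X' Z'"
        if "terminal V\<^sub>1 X'" "terminal V\<^sub>1 Y'" "terminal V\<^sub>1 Z'"
          "\<not> (\<exists>x y z. X' = {x} \<and> Y' = {y} \<and> Z' = {z} \<and> \<epsilon> ` A = {{x, z}, {y, z}})" for X' Y' Z'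
        using less.hyps[OF _ attach(1,2) less.prems(3) that m(2)] attach(4) by simp
      have t\<^sub>1: "terminal V\<^sub>1 X'" if "terminal V X'" "v \<notin> X'" for X'
        using terminal_subset[OF that(1)] terminal_basic(1)[OF that(1)] that(2) D(9) by blast
      consider "v \<notin> X" "v \<notin> Y" "v \<notin> Z" | "v \<in> X" "v \<notin> Y" "v \<notin> Z" | "v \<in> Y" "v \<notin> X" "v \<notin> Z"
        | "v \<in> Z" "v \<notin> X" "v \<notin> Y" using disj by blast
      then show ?thesis
      proof cases
        case 1
        then have "fork V\<^sub>1 E\<^sub>1 m X Y Z \<or> fork V\<^sub>1 E\<^sub>1 m Y X Z" using IH[OF t\<^sub>1[OF t(1)] t\<^sub>1[OF t(2)] t\<^sub>1[OF t(3)] ex] by blast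
        then show ?thesis using fork_mono[OF _ sub subset_refl subset_refl, of m _ _ _ n] m(1) by auto
      next
        case 2
        obtain X' where X': "terminal V\<^sub>1 X'" "card X' = 2"
          "\<And>b Y Z. fork V\<^sub>1 E\<^sub>1 b X' Y Z \<Longrightarrow> fork V E (Suc b) X Y Z"
          "\<And>b Y Z. fork V\<^sub>1 E\<^sub>1 b Y X' Z \<Longrightarrow> fork V E (Suc b) Y X Z"
          by (rule attached_terminal[OF attach(3) t(1) 2(1)]) blast
        have "\<not> (\<exists>x. X' = {x})" using X'(2) by auto
        then have "fork V\<^sub>1 E\<^sub>1 m X' Y Z \<or> fork V\<^sub>1 E\<^sub>1 m Y X' Z" using IH[OF X'(1) t\<^sub>1[OF t(2) 2(2)] t\<^sub>1[OF t(3) 2(3)]] by blast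
        then show ?thesis using X'(3,4) m(1) by blast
      next
        case 3
        obtain Y' where Y': "terminal V\<^sub>1 Y'" "card Y' = 2"
          "\<And>b X Z. fork V\<^sub>1 E\<^sub>1 b Y' X Z \<Longrightarrow> fork V E (Suc b) Y X Z"
          "\<And>b X Z. fork V\<^sub>1 E\<^sub>1 b X Y' Z \<Longrightarrow> fork V E (Suc b) X Y Z"
          by (rule attached_terminal[OF attach(3) t(2) 3(1)]) blast
        have "\<not> (\<exists>y. Y' = {y})" using Y'(2) by auto
        then have "fork V\<^sub>1 E\<^sub>1 m X Y' Z \<or> fork V\<^sub>1 E\<^sub>1 m Y' X Z" using IH[OF t\<^sub>1[OF t(1) 3(2)] Y'(1) t\<^sub>1[OF t(3) 3(3)]] by blast
        then show ?thesis using Y'(3,4) m(1) by blast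
      next
        case 4
        obtain Z' where Z': "terminal V\<^sub>1 Z'" "card Z' = 2"
          "\<And>b X Y. fork V\<^sub>1 E\<^sub>1 b X Z' Y \<Longrightarrow> fork V E (Suc b) X Z Y"
          by (rule attached_terminal[OF attach(3) t(3) 4(1)]) blast
        have "\<not> (\<exists>z. Z' = {z})" using Z'(2) by auto
        then have "fork V\<^sub>1 E\<^sub>1 m X Y Z' \<or> fork V\<^sub>1 E\<^sub>1 m Y X Z'" using IH[OF t\<^sub>1[OF t(1) 4(2)] t\<^sub>1[OF t(2) 4(3)] Z'(1)] by blast
        then show ?thesis using Z'(3) m(1) fork_swap by blast
      qed
    next
      case (merge V\<^sub>1 E\<^sub>1 A\<^sub>1 V\<^sub>2 E\<^sub>2 A\<^sub>2 F)
      \<comment> \<open>A side without singular edges is a single vertex, so a one-edge cut towards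
        it is a pendant singular edge.\<close>
      have pend: ?thesis if h: "built V' E' A'" "inj_on \<epsilon> E'" "built V'' E'' {}" "inj_on \<epsilon> E''" "joined V E V' E' V'' E'' F"
        "card A' = 1" "card F = 1" "A = A' \<union> F" for V' E' A' V'' E''
      proof -
        obtain w where w: "V'' = {w}" by (rule built_no_singular[OF h(3,4)])
        obtain a where a: "A' = {a}" using h(6) by (rule card_1_singletonE)
        obtain e where e: "F = {e}" using h(7) by (rule card_1_singletonE)
        have "\<epsilon> ` A = {\<epsilon> a, \<epsilon> e}" using h(8) a e by auto
        then show ?thesis
          using fork_pendant[OF h(1)[unfolded a] h(2) h(3)[unfolded w] h(5)[unfolded w e] t disj n] ex by simp
      qed
      have k: "card A\<^sub>1 + card A\<^sub>2 + (if card F = 1 then 1 else 0) = 2" using merge(7) less.prems(3) by simp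
      show ?thesis
      proof (cases "card F = 1")
        case True
        then consider "card A\<^sub>1 = 1" "A\<^sub>2 = {}" | "card A\<^sub>2 = 1" "A\<^sub>1 = {}"
          using k merge(8,9) by (auto simp: add_is_1)
        then show ?thesis
        proof cases
          case 1
          then show ?thesis using pend[OF merge(1,3) _ merge(4,5)] merge(2,6) True by auto
        next
          case 2
          then show ?thesis using pend[OF merge(2,4) _ merge(3) joined_sym[OF merge(5)]] merge(1,6) True by auto
        qed
      next
        case False
        then have "card A\<^sub>1 \<noteq> 0" "card A\<^sub>2 \<noteq> 0" using merge(8-10) by auto
        then have "card A\<^sub>1 = 1" "card A\<^sub>2 = 1" using k False by auto
        then obtain a a' where a: "A\<^sub>1 = {a}" "A\<^sub>2 = {a'}" by (auto simp: card_1_singleton_iff)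
        show ?thesis
          by (rule fork_double_join[OF merge(1)[unfolded a] merge(3) merge(2)[unfolded a] merge(4,5) False inj t disj n])
      qed
    qed
  qed
qed

section \<open>Three singular edges\<close>

text \<open>Since \<open>fork_swap\<close> exchanges the targets, only the choice of the root
  counts, and the three disjuncts make a notion symmetric in the terminals.\<close>

definition forked :: "'v set \<Rightarrow> 'e set \<Rightarrow> nat \<Rightarrow> 'v set \<Rightarrow> 'v set \<Rightarrow> 'v set \<Rightarrow> bool" where
  "forked V E n X Y Z \<longleftrightarrow> fork V E n X Y Z \<or> fork V E n Y X Z \<or> fork V E n Z X Y"

lemma fork_commute: "fork V E n Y X Z \<longleftrightarrow> fork V E n Y Z X"
  using fork_swap by (intro iffI)

lemma forked_iff:
  "forked V E n X Y Z \<longleftrightarrow> fork V E n X Y Z \<or> fork V E n X Z Y \<or> fork V E n Y X Z \<or>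
     fork V E n Y Z X \<or> fork V E n Z X Y \<or> fork V E n Z Y X"
  unfolding forked_def using fork_commute[of V E n X Y Z] fork_commute[of V E n Y X Z]
    fork_commute[of V E n Z X Y] by blast

text \<open>A transposition and a 3-cycle, enough to bring any terminal into a distinguished
  position.\<close>

lemma forked_perm:
  assumes "forked V E n X Y Z"
  shows "forked V E n Y X Z" "forked V E n Y Z X"
  using assms unfolding forked_iff by blast+

lemma forked_mono:
  assumes "forked V E n X Y Z" "V \<subseteq> V'" "E \<subseteq> E'" "n \<le> n'"
  shows "forked V' E' n' X Y Z"
  using assms(1) fork_mono[OF _ assms(2,3) subset_refl subset_refl assms(4)] unfolding forked_def by blast

text \<open>A path from \<open>u\<close> to the centre \<open>p\<close> of a path \<open>y p z\<close> of singular edges is cut off at its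
  first vertex on that path.\<close>

lemma linked_singular_pair:
  assumes b: "built V E A" and u: "u \<in> V" and f: "f \<in> A" "\<epsilon> f = {p, y}" and g: "g \<in> A" "\<epsilon> g = {p, z}"
    and ne: "y \<noteq> z" "p \<noteq> y" "p \<noteq> z"
  obtains t t' P Q where "t = y \<and> t' = z \<or> t = z \<and> t' = y" "linked V E u t P" "linked V E p t' Q"
    "P \<inter> Q = {}" "card P + card Q < card V"
proof -
  note B = built_basic[OF b]
  have E: "f \<in> E" "g \<in> E" using f(1) g(1) B(4) by blast+
  then have V: "p \<in> V" "y \<in> V" "z \<in> V" using B(5)[of f] B(5)[of g] f(2) g(2) by auto
  have edges: "linked V E p y {f}" "linked V E p z {g}"
    using E V f g ne by (auto intro: linked_edge)
  obtain P\<^sub>0 W\<^sub>0 where W\<^sub>0: "W\<^sub>0 \<subseteq> V" "rainbow_path u p P\<^sub>0 W\<^sub>0" "P\<^sub>0 \<subseteq> E"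
    using built_linked[OF b u V(1)] unfolding linked_def by blast
  let ?H = "{p, y, z}"
  have "W\<^sub>0 \<inter> ?H \<noteq> {}" using rainbow_path_basic(4)[OF W\<^sub>0(2)] by blast
  then obtain h P W where W: "rainbow_path u h P W" "W \<inter> ?H = {h}" "P \<subseteq> P\<^sub>0" "W \<subseteq> W\<^sub>0"
    by (rule rainbow_path_first_hit[OF W\<^sub>0(2)])
  have WV: "W \<subseteq> V" and PE: "P \<subseteq> E" using W(3,4) W\<^sub>0(1,3) by blast+
  have l: "linked V E u h P" unfolding linked_def using W(1) WV PE by blast
  have "\<not> {p, y} \<subseteq> W" "\<not> {p, z} \<subseteq> W" using W(2) ne by auto
  then have notin: "f \<notin> P" "g \<notin> P"
    using rainbow_path_basic(7)[OF W(1), of f] rainbow_path_basic(7)[OF W(1), of g] f(2) g(2) by auto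
  \<comment> \<open>The shortened path misses two of the three vertices in \<open>?H\<close>. It
    therefore has at most \<open>card V - 3\<close> edges, which leaves room for both singular
    edges.\<close>
  have "card W + card (?H - {h}) \<le> card V"
    using WV V W(2) B(1) rainbow_path_basic(2)[OF W(1)]
    by (subst card_Un_disjoint[symmetric]) (auto intro!: card_mono)
  moreover have "h \<in> ?H" using W(2) by blast
  then have "card (?H - {h}) = 2" using ne by auto
  ultimately have len: "card P + 3 \<le> card V" using rainbow_path_basic(5)[OF W(1)] by simp
  consider "h = y" | "h = z" | "h = p" using \<open>h \<in> ?H\<close> by blast
  then show thesis
  proof cases
    case 1
    then show thesis using that[of y z P "{g}"] l edges(2) notin len by simp
  next
    case 2
    then show thesis using that[of z y P "{f}"] l edges(1) notin len by simp
  next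
    \<comment> \<open>The path reaches \<open>p\<close> first and is prolonged by \<open>f\<close>,
      whose colour occurs on no other edge; \<open>g\<close> remains for the second path.\<close>
    case 3
    have "f \<noteq> g" using f(2) g(2) ne by (auto simp: doubleton_eq_iff)
    have "\<forall>f' \<in> E. c f' = c f \<longrightarrow> f' = f" using f(1) B(4) by blast
    then have "c f \<notin> c ` P" using PE notin(1) by (metis imageE subsetD)
    moreover have "W \<inter> {y} = {}" using W(2) 3 ne by auto
    ultimately have "rainbow_path u y (insert f (P \<union> {})) (W \<union> {y})"
      using W(1) 3 f(2) by (intro rainbow_path_trans[OF _ rainbow_path.nil]) auto
    then have "linked V E u y (insert f P)" unfolding linked_def
      using WV V(2) PE E(1) by (intro exI[of _ "W \<union> {y}"]) auto
    then show thesis using that[of y z "insert f P" "{g}"] edges(2) notin \<open>f \<noteq> g\<close> len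
      rainbow_path_basic(1)[OF W(1)] by simp
  qed
qed

text \<open>A path formed by the two singular edges cannot have both \<open>z\<close> and
  \<open>y\<close> as its middle, so exchanging these terminals removes the exception.\<close>

lemma forked_two_singular:
  assumes b: "built V E A" "inj_on \<epsilon> E" "card A = 2" and t: "terminal V X" "terminal V Y" "terminal V Z"
    and disj: "X \<inter> Y = {}" "X \<inter> Z = {}" "Y \<inter> Z = {}" and n: "card V < n"
  shows "forked V E n X Y Z"
proof (cases "\<exists>x y z. X = {x} \<and> Y = {y} \<and> Z = {z} \<and> \<epsilon> ` A = {{x, z}, {y, z}}")
  case False
  then show ?thesis using fork_two_singular[OF b t False n] unfolding forked_def by blast
next
  case True
  then obtain x y z where *: "X = {x}" "Y = {y}" "Z = {z}" "\<epsilon> ` A = {{x, z}, {y, z}}" by blast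
  have "{x, z} \<noteq> {x, y}" "{x, z} \<noteq> {z, y}" using disj * by (auto simp: doubleton_eq_iff)
  then have "{x, z} \<notin> {{x, y}, {z, y}}" by simp
  moreover have "{x, z} \<in> \<epsilon> ` A" unfolding *(4) by simp
  ultimately have "\<epsilon> ` A \<noteq> {{x, y}, {z, y}}" by metis
  then have "\<not> (\<exists>x z y. X = {x} \<and> Z = {z} \<and> Y = {y} \<and> \<epsilon> ` A = {{x, y}, {z, y}})"
    unfolding *(1-3) by simp
  then have "fork V E n X Z Y \<or> fork V E n Z X Y" by (rule fork_two_singular[OF b t(1,3,2) _ n])
  then show ?thesis unfolding forked_iff by blast
qed

text \<open>With \<open>{p}\<close> in place of \<open>X\<close>, the case of two singular edges
  fails only for a path of singular edges with middle \<open>p\<close>. Then \<open>X\<close> is the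
  root: \<open>q\<close> crosses the cut to \<open>u\<close>, and
  \<open>linked_singular_pair\<close> supplies disjoint continuations from \<open>u\<close> and
  \<open>p\<close> to the two ends.\<close>

lemma forked_straddling_inside:
  assumes b: "built V\<^sub>1 E\<^sub>1 A\<^sub>1" "inj_on \<epsilon> E\<^sub>1" "card A\<^sub>1 = 2" "built V\<^sub>2 E\<^sub>2 A\<^sub>2" and j: "joined V E V\<^sub>1 E\<^sub>1 V\<^sub>2 E\<^sub>2 F"
    and X: "terminal V X" "p \<in> X" "p \<in> V\<^sub>1" "q \<in> X" "q \<in> V\<^sub>2"
    and Y: "terminal V\<^sub>1 Y" and Z: "terminal V\<^sub>1 Z"
    and disj: "X \<inter> Y = {}" "X \<inter> Z = {}" "Y \<inter> Z = {}" and n: "card V < n"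
  shows "forked V E n X Y Z"
proof -
  note D = joinedD[OF j]
  have card: "card V = card V\<^sub>1 + card V\<^sub>2" by (rule joined_card[OF b(1,4) j])
  show ?thesis
  proof (cases "\<exists>y z p'. Y = {y} \<and> Z = {z} \<and> {p} = {p'} \<and> \<epsilon> ` A\<^sub>1 = {{y, p'}, {z, p'}}")
    case False
    have n\<^sub>1: "card V\<^sub>1 < n" using n card by simp
    have "fork V\<^sub>1 E\<^sub>1 n Y Z {p} \<or> fork V\<^sub>1 E\<^sub>1 n Z Y {p}"
      by (rule fork_two_singular[OF b(1-3) Y Z terminal_singleton[OF X(3)] False n\<^sub>1])
    then have "fork V E n Y Z X \<or> fork V E n Z Y X"
      using fork_mono[OF _ D(1,3) subset_refl, of n _ _ "{p}" X n] X(2) by blast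
    then show ?thesis unfolding forked_iff by blast
  next
    case True
    then obtain y z where yz: "Y = {y}" "Z = {z}" "\<epsilon> ` A\<^sub>1 = {{y, p}, {z, p}}" by blast
    then obtain f g where fg: "f \<in> A\<^sub>1" "\<epsilon> f = {p, y}" "g \<in> A\<^sub>1" "\<epsilon> g = {p, z}"
      by (metis imageE insertCI insert_commute)
    have ne: "y \<noteq> z" "p \<noteq> y" "p \<noteq> z" using disj yz X(2) by auto
    obtain e where e: "e \<in> F" using j unfolding joined_def by blast
    obtain u v where uv: "u \<in> V\<^sub>1" "v \<in> V\<^sub>2" "\<epsilon> e = {u, v}" by (rule joined_crossE[OF j e])
    obtain t t' P Q where P: "t = y \<and> t' = z \<or> t = z \<and> t' = y" "linked V\<^sub>1 E\<^sub>1 u t P" "linked V\<^sub>1 E\<^sub>1 p t' Q"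
      "P \<inter> Q = {}" "card P + card Q < card V\<^sub>1" by (rule linked_singular_pair[OF b(1) uv(1) fg ne])
    obtain R where R: "linked V\<^sub>2 E\<^sub>2 q v R" "Suc (card R) \<le> card V\<^sub>2" by (rule built_linkedE[OF b(4) X(5) uv(2)])
    have e': "\<epsilon> e = {v, u}" using uv(3) by auto
    note L = joined_linked[OF joined_sym[OF j] e e' R(1) P(2)]
    have "q \<noteq> p" using X(3,5) D(6) by auto
    then have Xeq: "X = {q, p}" using X(1,2,4) unfolding terminal_def by auto
    have "insert e (R \<union> P) \<inter> Q = {}"
      using P(4) D(9-11) e linked_in(2)[OF P(3)] linked_in(2)[OF R(1)] by blast
    moreover have "card X \<le> 2" by (rule terminal_basic(3)[OF X(1)])
    ultimately have "fork V E n X {t} {t'}"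
      using L linked_mono[OF P(3) D(1,3)] P(5) R(2) card n
      by (intro forkI[OF Xeq, of t _ t' _ V E "insert e (R \<union> P)" Q]) auto
    then show ?thesis using P(1) yz unfolding forked_iff by auto
  qed
qed

text \<open>The near end \<open>u\<close> of a cut edge stands for \<open>Z\<close>. The roots
  provided by \<open>fork_two_singular\<close> are \<open>X\<close> and \<open>Y\<close>, so
  \<open>u\<close> is always a target and its branch can be continued across
  \<open>e\<close>.\<close>

lemma forked_two_inside_two_singular:
  assumes b: "built V\<^sub>1 E\<^sub>1 A\<^sub>1" "inj_on \<epsilon> E\<^sub>1" "card A\<^sub>1 = 2" "built V\<^sub>2 E\<^sub>2 A\<^sub>2" and j: "joined V E V\<^sub>1 E\<^sub>1 V\<^sub>2 E\<^sub>2 F"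
    and X: "terminal V\<^sub>1 X" and Y: "terminal V\<^sub>1 Y" and Z: "z \<in> Z" "z \<in> V\<^sub>2"
    and e: "e \<in> F" "\<epsilon> e = {u, v}" "u \<in> V\<^sub>1" "v \<in> V\<^sub>2"
    and ex: "\<not> (\<exists>x y. X = {x} \<and> Y = {y} \<and> \<epsilon> ` A\<^sub>1 = {{x, u}, {y, u}})" and n: "card V < n"
  shows "forked V E n X Y Z"
proof -
  have lift: "fork V E n X' Z Y'" if "fork V\<^sub>1 E\<^sub>1 (card V\<^sub>1 + 1) X' Y' {u}" for X' Y'
  proof -
    obtain Q where Q: "linked V\<^sub>2 E\<^sub>2 v z Q" "Suc (card Q) \<le> card V\<^sub>2" by (rule built_linkedE[OF b(4) e(4) Z(2)])
    show ?thesis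
      by (rule fork_mono[OF joined_fork[OF j e(1,2) fork_swap[OF that] Q(1) Z(1)]])
         (use Q(2) n joined_card[OF b(1,4) j] in auto)
  qed
  have "\<not> (\<exists>x y z. X = {x} \<and> Y = {y} \<and> {u} = {z} \<and> \<epsilon> ` A\<^sub>1 = {{x, z}, {y, z}})" using ex by auto
  then have "fork V\<^sub>1 E\<^sub>1 (card V\<^sub>1 + 1) X Y {u} \<or> fork V\<^sub>1 E\<^sub>1 (card V\<^sub>1 + 1) Y X {u}"
    using fork_two_singular[OF b(1-3) X Y terminal_singleton[OF e(3)], of "card V\<^sub>1 + 1"] by simp
  then show ?thesis using lift[of X Y] lift[of Y X] unfolding forked_iff by blast
qed

text \<open>If both cut edges are blocked, they have the same near end \<open>u\<close>, which
  singular edges \<open>g\<close> and \<open>h\<close> join to \<open>x\<close> and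
  \<open>y\<close>. The far ends differ by simplicity, so \<open>Z\<close> can be the root: its
  branches cross both cut edges, meet at \<open>u\<close> and leave it along \<open>g\<close> and
  \<open>h\<close>.\<close>

lemma forked_double_two_inside:
  assumes b: "built V\<^sub>1 E\<^sub>1 A\<^sub>1" "inj_on \<epsilon> E\<^sub>1" "card A\<^sub>1 = 2" "built V\<^sub>2 E\<^sub>2 {a}" "inj_on \<epsilon> E\<^sub>2"
    and j: "joined V E V\<^sub>1 E\<^sub>1 V\<^sub>2 E\<^sub>2 F" and F: "card F \<noteq> 1" and inj: "inj_on \<epsilon> E"
    and X: "terminal V\<^sub>1 X" and Y: "terminal V\<^sub>1 Y" and Z: "terminal V\<^sub>2 Z"
    and disj: "X \<inter> Y = {}" and n: "card V < n"
  shows "forked V E n X Y Z"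
proof -
  note D = joinedD[OF j]
  obtain z where z: "z \<in> Z" "z \<in> V\<^sub>2" using terminal_basic(1,2)[OF Z] by blast
  obtain e f where ef: "F = {e, f}" "e \<noteq> f" using D(17) F by (auto simp: card_2_iff)
  obtain u v where uv: "u \<in> V\<^sub>1" "v \<in> V\<^sub>2" "\<epsilon> e = {u, v}" using joined_crossE[OF j, of e] ef by blast
  obtain u' v' where uv': "u' \<in> V\<^sub>1" "v' \<in> V\<^sub>2" "\<epsilon> f = {u', v'}" using joined_crossE[OF j, of f] ef by blast
  consider "\<not> (\<exists>x y. X = {x} \<and> Y = {y} \<and> \<epsilon> ` A\<^sub>1 = {{x, u}, {y, u}})"
    | "\<not> (\<exists>x y. X = {x} \<and> Y = {y} \<and> \<epsilon> ` A\<^sub>1 = {{x, u'}, {y, u'}})"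
    | x y where "X = {x}" "Y = {y}" "\<epsilon> ` A\<^sub>1 = {{x, u}, {y, u}}" "\<epsilon> ` A\<^sub>1 = {{x, u'}, {y, u'}}" by blast
  then show ?thesis
  proof cases
    case 1
    then show ?thesis using forked_two_inside_two_singular[OF b(1-4) j X Y z _ uv(3,1,2) 1 n] ef by blast
  next
    case 2
    then show ?thesis using forked_two_inside_two_singular[OF b(1-4) j X Y z _ uv'(3,1,2) 2 n] ef by blast
  next
    case (3 x y)
    obtain g where g: "g \<in> A\<^sub>1" "\<epsilon> g = {x, u}" using 3(3) by (metis imageE insertCI)
    obtain h where h: "h \<in> A\<^sub>1" "\<epsilon> h = {y, u}" using 3(3) by (metis imageE insertCI)
    have gh: "g \<in> E\<^sub>1" "h \<in> E\<^sub>1" using g(1) h(1) built_basic(4)[OF b(1)] by blast+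
    have c2: "card {x, u} = 2" "card {y, u} = 2" "{x, u} \<subseteq> V\<^sub>1" "{y, u} \<subseteq> V\<^sub>1"
      using built_basic(5)[OF b(1) gh(1)] built_basic(5)[OF b(1) gh(2)] g(2) h(2) by auto
    then have ne: "x \<noteq> u" "y \<noteq> u" "x \<noteq> y" using disj 3(1,2) by auto
    have "{x, u} \<in> {{x, u'}, {y, u'}}" using 3(3) unfolding 3(4) by simp
    then have "{x, u} = {x, u'} \<or> {x, u} = {y, u'}" by simp
    then have "u' = u" using ne by (auto simp: doubleton_eq_iff)
    moreover have "\<epsilon> e \<noteq> \<epsilon> f" using inj_onD[OF inj, of e f] ef D(5) by blast
    ultimately have "v \<noteq> v'" using uv(3) uv'(3) by auto
    then have fk: "fork V\<^sub>2 E\<^sub>2 (card V\<^sub>2) Z {v} {v'}" by (intro fork_one_singular[OF b(4,5) Z uv(2) uv'(2)]) auto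
    have l: "linked V\<^sub>1 E\<^sub>1 u x {g}" "linked V\<^sub>1 E\<^sub>1 u' y {h}"
      using gh g(2) h(2) c2 ne \<open>u' = u\<close> by (auto intro!: linked_edge)
    have gh': "{g} \<inter> {h} = {}" using g(2) h(2) ne by (auto simp: doubleton_eq_iff)
    have e': "\<epsilon> e = {v, u}" "\<epsilon> f = {v', u'}" "e \<in> F" "f \<in> F" using uv(3) uv'(3) ef by auto
    have fk': "fork V E (Suc (Suc (card V\<^sub>2 + card {g} + card {h}))) Z X Y"
      by (rule joined_fork2[OF joined_sym[OF j] e'(3,1,4,2) ef(2) fk l gh']) (use 3 in auto)
    \<comment> \<open>The branches use two cut edges as well as \<open>g\<close> and
      \<open>h\<close>; three vertices in \<open>V\<^sub>1\<close> make
      \<open>card V\<^sub>2 + 4\<close> fit below the bound.\<close>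
    have "card {x, y, u} = 3" using ne by simp
    moreover have "{x, y, u} \<subseteq> V\<^sub>1" using c2 by auto
    ultimately have "3 \<le> card V\<^sub>1" using card_mono[OF built_basic(1)[OF b(1)], of "{x, y, u}"] by simp
    then have "fork V E n Z X Y" using n joined_card[OF b(1,4) j] by (intro fork_mono[OF fk']) auto
    then show ?thesis unfolding forked_iff by blast
  qed
qed

text \<open>Two terminals in \<open>V\<^sub>2\<close>, the side with one singular edge, are settled
  by \<open>fork_two_inside\<close> wherever the third lies. Three terminals in
  \<open>V\<^sub>1\<close> are settled without the cut.\<close>

lemma forked_double_join:
  assumes b: "built V\<^sub>1 E\<^sub>1 A\<^sub>1" "inj_on \<epsilon> E\<^sub>1" "card A\<^sub>1 = 2" "built V\<^sub>2 E\<^sub>2 {a}" "inj_on \<epsilon> E\<^sub>2"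
    and j: "joined V E V\<^sub>1 E\<^sub>1 V\<^sub>2 E\<^sub>2 F" and F: "card F \<noteq> 1" and inj: "inj_on \<epsilon> E"
    and t: "terminal V X" "terminal V Y" "terminal V Z"
    and disj: "X \<inter> Y = {}" "X \<inter> Z = {}" "Y \<inter> Z = {}" and n: "card V < n"
  shows "forked V E n X Y Z"
proof -
  note D = joinedD[OF j]
  have n': "card V \<le> n" "card V\<^sub>1 < n" "card V\<^sub>2 \<le> n" using n joined_card[OF b(1,4) j] by auto
  have straddle: "forked V E n X' Y' Z'"
    if h: "terminal V X'" "terminal V Y'" "terminal V Z'" "X' \<inter> Y' = {}" "X' \<inter> Z' = {}" "Y' \<inter> Z' = {}"
      "\<not> X' \<subseteq> V\<^sub>1" "\<not> X' \<subseteq> V\<^sub>2" for X' Y' Z'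
  proof -
    obtain p q where pq: "p \<in> X'" "p \<in> V\<^sub>1" "q \<in> X'" "q \<in> V\<^sub>2"
      using h(7,8) terminal_basic(1)[OF h(1)] D(7) by blast
    show ?thesis
    proof (rule fork_straddling_cases[OF b(1,4) j h(1) pq h(2,3) n'(1)])
      assume "fork V E n X' Y' Z'" then show ?thesis unfolding forked_iff by blast
    next
      assume "Y' \<subseteq> V\<^sub>1" "Z' \<subseteq> V\<^sub>1"
      then show ?thesis
        using forked_straddling_inside[OF b(1-4) j h(1) pq terminal_subset[OF h(2)] terminal_subset[OF h(3)] h(4-6) n]
        by blast
    next
      assume *: "Y' \<subseteq> V\<^sub>2" "Z' \<subseteq> V\<^sub>2"
      obtain z where z: "z \<in> Z'" "z \<in> V\<^sub>2" using terminal_basic(2)[OF h(3)] *(2) by blast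
      then have "q \<noteq> z" using pq(3) h(5) by blast
      from fork_inside[OF b(4,5) D(2,4) terminal_subset[OF h(2) *(1)] pq(3,4) z this n'(3)]
      show ?thesis unfolding forked_iff by blast
    qed
  qed
  have inside2: "forked V E n X' Y' Z'"
    if h: "terminal V X'" "terminal V Y'" "terminal V Z'" "X' \<inter> Y' = {}" "X' \<inter> Z' = {}" "Y' \<inter> Z' = {}"
      "X' \<subseteq> V\<^sub>2" "Y' \<subseteq> V\<^sub>2" for X' Y' Z'
    using fork_two_inside[OF b(4,5,1) joined_sym[OF j] h(1,7,2,8,3,4-6) n] unfolding forked_iff by blast
  have inside1: "forked V E n X' Y' Z'"
    if h: "terminal V X'" "terminal V Y'" "terminal V Z'" "X' \<inter> Y' = {}" "X' \<subseteq> V\<^sub>1" "Y' \<subseteq> V\<^sub>1" "Z' \<subseteq> V\<^sub>2" for X' Y' Z'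
    by (rule forked_double_two_inside[OF b j F inj terminal_subset[OF h(1,5)] terminal_subset[OF h(2,6)]
          terminal_subset[OF h(3,7)] h(4) n])
  have disj': "Y \<inter> X = {}" "Z \<inter> X = {}" "Z \<inter> Y = {}" using disj by blast+
  consider "\<not> X \<subseteq> V\<^sub>1" "\<not> X \<subseteq> V\<^sub>2" | "\<not> Y \<subseteq> V\<^sub>1" "\<not> Y \<subseteq> V\<^sub>2" | "\<not> Z \<subseteq> V\<^sub>1" "\<not> Z \<subseteq> V\<^sub>2"
    | "X \<subseteq> V\<^sub>2" "Y \<subseteq> V\<^sub>2" | "X \<subseteq> V\<^sub>2" "Z \<subseteq> V\<^sub>2" | "Y \<subseteq> V\<^sub>2" "Z \<subseteq> V\<^sub>2"
    | "X \<subseteq> V\<^sub>1" "Y \<subseteq> V\<^sub>1" "Z \<subseteq> V\<^sub>2" | "X \<subseteq> V\<^sub>1" "Y \<subseteq> V\<^sub>2" "Z \<subseteq> V\<^sub>1" | "X \<subseteq> V\<^sub>2" "Y \<subseteq> V\<^sub>1" "Z \<subseteq> V\<^sub>1"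
    | "X \<subseteq> V\<^sub>1" "Y \<subseteq> V\<^sub>1" "Z \<subseteq> V\<^sub>1" by blast
  then show ?thesis
  proof cases
    case 1 then show ?thesis by (rule straddle[OF t disj])
  next
    case 2 then show ?thesis by (rule forked_perm(1)[OF straddle[OF t(2,1,3) disj'(1) disj(3,2)]])
  next
    case 3 then show ?thesis by (rule forked_perm(2)[OF straddle[OF t(3,1,2) disj'(2,3) disj(1)]])
  next
    case 4 then show ?thesis by (rule inside2[OF t disj])
  next
    case 5 then show ?thesis
      using forked_perm(2)[OF inside2[OF t(3,1,2) disj'(2,3) disj(1)]] by blast
  next
    case 6 then show ?thesis
      using forked_perm(2)[OF forked_perm(2)[OF inside2[OF t(2,3,1) disj(3) disj'(1,2)]]] by blast
  next
    case 7 then show ?thesis by (rule inside1[OF t disj(1)])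
  next
    case 8 then show ?thesis
      using forked_perm(2)[OF inside1[OF t(3,1,2) disj'(2)]] by blast
  next
    case 9 then show ?thesis
      using forked_perm(2)[OF forked_perm(2)[OF inside1[OF t(2,3,1) disj(3)]]] by blast
  next
    case 10
    from forked_two_singular[OF b(1-3) terminal_subset[OF t(1) 10(1)] terminal_subset[OF t(2) 10(2)]
        terminal_subset[OF t(3) 10(3)] disj n'(2)]
    show ?thesis by (rule forked_mono[OF _ D(1,3)]) simp
  qed
qed

text \<open>If no terminal meets both sides, two of the three lie on the same side, and
  \<open>fork_two_inside\<close> applies to these.\<close>

lemma forked_single_join:
  assumes b: "built V\<^sub>1 E\<^sub>1 {a}" "inj_on \<epsilon> E\<^sub>1" "built V\<^sub>2 E\<^sub>2 {a'}" "inj_on \<epsilon> E\<^sub>2" and j: "joined V E V\<^sub>1 E\<^sub>1 V\<^sub>2 E\<^sub>2 F"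
    and t: "terminal V X" "terminal V Y" "terminal V Z"
    and disj: "X \<inter> Y = {}" "X \<inter> Z = {}" "Y \<inter> Z = {}" and n: "card V < n"
  shows "forked V E n X Y Z"
proof -
  have n': "card V \<le> n" using n by simp
  have straddle: "forked V E n X' Y' Z'"
    if h: "terminal V X'" "terminal V Y'" "terminal V Z'" "X' \<inter> Y' = {}" "X' \<inter> Z' = {}" "Y' \<inter> Z' = {}"
      "\<not> X' \<subseteq> V\<^sub>1" "\<not> X' \<subseteq> V\<^sub>2" for X' Y' Z'
    using fork_straddling_one_singular[OF b j h(1,7,8,2-6) n'] unfolding forked_iff by blast
  have inside: "forked V E n X' Y' Z'"
    if h: "terminal V X'" "terminal V Y'" "terminal V Z'" "X' \<inter> Y' = {}" "X' \<inter> Z' = {}" "Y' \<inter> Z' = {}"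
      "X' \<subseteq> V\<^sub>1 \<and> Y' \<subseteq> V\<^sub>1 \<or> X' \<subseteq> V\<^sub>2 \<and> Y' \<subseteq> V\<^sub>2" for X' Y' Z'
    using fork_two_inside[OF b(1-3) j h(1) _ h(2) _ h(3-6) n]
      fork_two_inside[OF b(3,4,1) joined_sym[OF j] h(1) _ h(2) _ h(3-6) n] h(7) unfolding forked_iff by blast
  have disj': "Y \<inter> X = {}" "Z \<inter> X = {}" "Z \<inter> Y = {}" using disj by blast+
  consider "\<not> X \<subseteq> V\<^sub>1" "\<not> X \<subseteq> V\<^sub>2" | "\<not> Y \<subseteq> V\<^sub>1" "\<not> Y \<subseteq> V\<^sub>2" | "\<not> Z \<subseteq> V\<^sub>1" "\<not> Z \<subseteq> V\<^sub>2"
    | "X \<subseteq> V\<^sub>1 \<and> Y \<subseteq> V\<^sub>1 \<or> X \<subseteq> V\<^sub>2 \<and> Y \<subseteq> V\<^sub>2" | "Z \<subseteq> V\<^sub>1 \<and> X \<subseteq> V\<^sub>1 \<or> Z \<subseteq> V\<^sub>2 \<and> X \<subseteq> V\<^sub>2"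
    | "Y \<subseteq> V\<^sub>1 \<and> Z \<subseteq> V\<^sub>1 \<or> Y \<subseteq> V\<^sub>2 \<and> Z \<subseteq> V\<^sub>2" by blast
  then show ?thesis
  proof cases
    case 1 then show ?thesis by (rule straddle[OF t disj])
  next
    case 2 then show ?thesis by (rule forked_perm(1)[OF straddle[OF t(2,1,3) disj'(1) disj(3,2)]])
  next
    case 3 then show ?thesis by (rule forked_perm(2)[OF straddle[OF t(3,1,2) disj'(2,3) disj(1)]])
  next
    case 4 then show ?thesis by (rule inside[OF t disj])
  next
    case 5 then show ?thesis by (rule forked_perm(2)[OF inside[OF t(3,1,2) disj'(2,3) disj(1)]])
  next
    case 6 then show ?thesis
      by (rule forked_perm(2)[OF forked_perm(2)[OF inside[OF t(2,3,1) disj(3) disj'(1,2)]]])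
  qed
qed

text \<open>If a terminal is \<open>{w}\<close>, failure means that the singular edges in
  \<open>V\<^sub>1\<close> join \<open>u\<close> to the other two terminals; together with
  \<open>e\<close> they form the excluded star at \<open>u\<close>. A pair containing
  \<open>w\<close> meets both sides of the cut.\<close>

lemma forked_pendant:
  assumes b: "built V\<^sub>1 E\<^sub>1 A\<^sub>1" "inj_on \<epsilon> E\<^sub>1" "card A\<^sub>1 = 2" "built {w} E\<^sub>2 A\<^sub>2" and j: "joined V E V\<^sub>1 E\<^sub>1 {w} E\<^sub>2 {e}"
    and t: "terminal V X" "terminal V Y" "terminal V Z"
    and disj: "X \<inter> Y = {}" "X \<inter> Z = {}" "Y \<inter> Z = {}" and n: "card V < n"
    and ex: "\<not> (\<exists>x y z u. X = {x} \<and> Y = {y} \<and> Z = {z} \<and> \<epsilon> ` insert e A\<^sub>1 = {{u, x}, {u, y}, {u, z}})"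
  shows "forked V E n X Y Z"
proof -
  note D = joinedD[OF j]
  obtain u where u: "u \<in> V\<^sub>1" "\<epsilon> e = {u, w}" using joined_crossE[OF j, of e] by blast
  have V: "V = insert w V\<^sub>1" using D(7) by auto
  have t\<^sub>1: "terminal V\<^sub>1 X'" if "terminal V X'" "w \<notin> X'" for X'
    using terminal_subset[OF that(1)] terminal_basic(1)[OF that(1)] that(2) V by blast
  have main: "forked V E n X' Y' Z'"
    if h: "terminal V X'" "terminal V Y'" "terminal V Z'" "X' \<inter> Y' = {}" "X' \<inter> Z' = {}" "Y' \<inter> Z' = {}" "w \<in> X'"
      and ex': "\<not> (\<exists>x y z u. X' = {x} \<and> Y' = {y} \<and> Z' = {z} \<and> \<epsilon> ` insert e A\<^sub>1 = {{u, x}, {u, y}, {u, z}})"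
    for X' Y' Z'
  proof -
    have Y': "terminal V\<^sub>1 Y'" and Z': "terminal V\<^sub>1 Z'" using t\<^sub>1 h by blast+
    show ?thesis
    proof (cases "X' = {w}")
      case True
      have "\<not> (\<exists>y z. Y' = {y} \<and> Z' = {z} \<and> \<epsilon> ` A\<^sub>1 = {{y, u}, {z, u}})"
        using ex' True u(2) by (auto simp: insert_commute)
      then have "forked V E n Y' Z' X'"
        by (intro forked_two_inside_two_singular[OF b j Y' Z' h(7) _ _ u(2,1) _ _ n]) simp_all
      then show ?thesis by (rule forked_perm(2)[OF forked_perm(2)])
    next
      case False
      then obtain p where p: "p \<in> X'" "p \<in> V\<^sub>1" using h(7) terminal_basic(1)[OF h(1)] V by blast
      show ?thesis by (rule forked_straddling_inside[OF b j h(1) p h(7) _ Y' Z' h(4-6) n]) simp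
    qed
  qed
  have disj': "Y \<inter> X = {}" "Z \<inter> X = {}" "Z \<inter> Y = {}" using disj by blast+
  consider "w \<in> X" | "w \<in> Y" | "w \<in> Z" | "w \<notin> X" "w \<notin> Y" "w \<notin> Z" by blast
  then show ?thesis
  proof cases
    case 1 then show ?thesis using main[OF t disj] ex by blast
  next
    case 2
    have "\<not> (\<exists>x y z u. Y = {x} \<and> X = {y} \<and> Z = {z} \<and> \<epsilon> ` insert e A\<^sub>1 = {{u, x}, {u, y}, {u, z}})"
      using ex by (metis insert_commute)
    then show ?thesis by (rule forked_perm(1)[OF main[OF t(2,1,3) disj'(1) disj(3,2) 2]])
  next
    case 3
    have "\<not> (\<exists>x y z u. Z = {x} \<and> X = {y} \<and> Y = {z} \<and> \<epsilon> ` insert e A\<^sub>1 = {{u, x}, {u, y}, {u, z}})"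
      using ex by (metis insert_commute)
    then show ?thesis by (rule forked_perm(2)[OF main[OF t(3,1,2) disj'(2,3) disj(1) 3]])
  next
    case 4
    have "card V\<^sub>1 < n" using n joined_card[OF b(1,4) j] by simp
    from forked_two_singular[OF b(1-3) t\<^sub>1[OF t(1) 4(1)] t\<^sub>1[OF t(2) 4(2)] t\<^sub>1[OF t(3) 4(3)] disj this]
    show ?thesis by (rule forked_mono[OF _ D(1,3)]) simp
  qed
qed

text \<open>The star is a genuine obstruction: a rainbow path between two of its leaves other than
  the one through \<open>u\<close> would yield a rainbow cycle, so two branches from a leaf always
  share its edge to \<open>u\<close>. As for two singular edges, the exception never applies to a
  pair.\<close>

lemma forked_three_singular:
  assumes "built V E A" "inj_on \<epsilon> E" "card A = 3" "terminal V X" "terminal V Y" "terminal V Z"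
    "\<not> (\<exists>x y z u. X = {x} \<and> Y = {y} \<and> Z = {z} \<and> \<epsilon> ` A = {{u, x}, {u, y}, {u, z}})" "card V < n"
  shows "forked V E n X Y Z"
  using assms
proof (induction "card V" arbitrary: V E X Y Z n rule: less_induct)
  case less
  note b = less.prems(1) and inj = less.prems(2) and t = less.prems(4-6) and ex = less.prems(7) and n = less.prems(8)
  show ?case
  proof (cases "X \<inter> Y = {} \<and> X \<inter> Z = {} \<and> Y \<inter> Z = {}")
    case False
    then show ?thesis
      using fork_common[OF b t(1,2,3) _ n] fork_swap[OF fork_common[OF b t(1,3,2) _ n]]
        fork_swap[OF fork_common[OF b t(2,3,1) _ n]] unfolding forked_iff by blast
  next
    case True
    then have disj: "X \<inter> Y = {}" "X \<inter> Z = {}" "Y \<inter> Z = {}" by blast+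
    have "A \<noteq> {}" using less.prems(3) by auto
    with b inj show ?thesis
    proof (cases rule: built_decomp)
      case (attach V\<^sub>1 E\<^sub>1 v e r f s)
      note D = attachedD[OF attach(3)]
      note sub = joinedD(1,3)[OF D(1)]
      obtain m where m: "n = Suc m" "card V\<^sub>1 < m" using n attach(4) by (metis Suc_less_eq2)
      have IH: "forked V\<^sub>1 E\<^sub>1 m X' Y' Z'"
        if "terminal V\<^sub>1 X'" "terminal V\<^sub>1 Y'" "terminal V\<^sub>1 Z'"
          "\<not> (\<exists>x y z u. X' = {x} \<and> Y' = {y} \<and> Z' = {z} \<and> \<epsilon> ` A = {{u, x}, {u, y}, {u, z}})" for X' Y' Z'
        using less.hyps[OF _ attach(1,2) less.prems(3) that m(2)] attach(4) by simp
      have t\<^sub>1: "terminal V\<^sub>1 X'" if "terminal V X'" "v \<notin> X'" for X'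
        using terminal_subset[OF that(1)] terminal_basic(1)[OF that(1)] that(2) D(9) by blast
      have main: "forked V E n X' Y' Z'"
        if h: "terminal V X'" "terminal V Y'" "terminal V Z'" "v \<in> X'" "v \<notin> Y'" "v \<notin> Z'" for X' Y' Z'
      proof -
        obtain X'' where X'': "terminal V\<^sub>1 X''" "card X'' = 2"
          "\<And>b Y Z. fork V\<^sub>1 E\<^sub>1 b X'' Y Z \<Longrightarrow> fork V E (Suc b) X' Y Z"
          "\<And>b Y Z. fork V\<^sub>1 E\<^sub>1 b Y X'' Z \<Longrightarrow> fork V E (Suc b) Y X' Z"
          by (rule attached_terminal[OF attach(3) h(1,4)]) blast
        have "\<not> (\<exists>x. X'' = {x})" using X''(2) by auto
        then have "forked V\<^sub>1 E\<^sub>1 m X'' Y' Z'" using IH[OF X''(1) t\<^sub>1[OF h(2,5)] t\<^sub>1[OF h(3,6)]] by blast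
        then show ?thesis using X''(3,4) m(1) unfolding forked_def by blast
      qed
      consider "v \<notin> X" "v \<notin> Y" "v \<notin> Z" | "v \<in> X" "v \<notin> Y" "v \<notin> Z" | "v \<in> Y" "v \<notin> X" "v \<notin> Z"
        | "v \<in> Z" "v \<notin> X" "v \<notin> Y" using disj by blast
      then show ?thesis
      proof cases
        case 1
        then have "forked V\<^sub>1 E\<^sub>1 m X Y Z" using IH[OF t\<^sub>1[OF t(1)] t\<^sub>1[OF t(2)] t\<^sub>1[OF t(3)] ex] by blast
        then show ?thesis by (rule forked_mono[OF _ sub]) (simp add: m(1))
      next
        case 2 then show ?thesis by (rule main[OF t])
      next
        case 3 then show ?thesis by (rule forked_perm(1)[OF main[OF t(2,1,3)]])
      next
        case 4 then show ?thesis by (rule forked_perm(2)[OF main[OF t(3,1,2)]])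
      qed
    next
      case (merge V\<^sub>1 E\<^sub>1 A\<^sub>1 V\<^sub>2 E\<^sub>2 A\<^sub>2 F)
      have pend: ?thesis if h: "built V' E' A'" "inj_on \<epsilon> E'" "built V'' E'' {}" "inj_on \<epsilon> E''" "joined V E V' E' V'' E'' F"
        "card A' = 2" "card F = 1" "A = A' \<union> F" for V' E' A' V'' E''
      proof -
        obtain w where w: "V'' = {w}" by (rule built_no_singular[OF h(3,4)])
        obtain e where e: "F = {e}" using h(7) by (rule card_1_singletonE)
        have "A = insert e A'" using h(8) e by auto
        then show ?thesis
          using forked_pendant[OF h(1,2,6) h(3)[unfolded w] h(5)[unfolded w e] t disj n] ex by simp
      qed
      have k: "card A\<^sub>1 + card A\<^sub>2 + (if card F = 1 then 1 else 0) = 3" using merge(7) less.prems(3) by simp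
      show ?thesis
      proof (cases "card F = 1")
        case True
        then have "card A\<^sub>1 + card A\<^sub>2 = 2" using k by simp
        then consider "card A\<^sub>1 = 2" "card A\<^sub>2 = 0" | "card A\<^sub>2 = 2" "card A\<^sub>1 = 0" | "card A\<^sub>1 = 1" "card A\<^sub>2 = 1"
          by linarith
        then show ?thesis
        proof cases
          case 1
          then have "A\<^sub>2 = {}" using merge(9) by simp
          then show ?thesis using pend[OF merge(1,3) _ merge(4,5) 1(1) True] merge(2,6) True by auto
        next
          case 2
          then have "A\<^sub>1 = {}" using merge(8) by simp
          then show ?thesis using pend[OF merge(2,4) _ merge(3) joined_sym[OF merge(5)] 2(1) True] merge(1,6) True by auto
        next
          case 3
          then obtain a a' where a: "A\<^sub>1 = {a}" "A\<^sub>2 = {a'}" by (auto simp: card_1_singleton_iff)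
          show ?thesis
            by (rule forked_single_join[OF merge(1)[unfolded a] merge(3) merge(2)[unfolded a] merge(4,5) t disj n])
        qed
      next
        case False
        then have "card A\<^sub>1 \<noteq> 0" "card A\<^sub>2 \<noteq> 0" "card A\<^sub>1 + card A\<^sub>2 = 3" using merge(8-10) k by auto
        then consider "card A\<^sub>1 = 2" "card A\<^sub>2 = 1" | "card A\<^sub>2 = 2" "card A\<^sub>1 = 1" by linarith
        then show ?thesis
        proof cases
          case 1
          obtain a where a: "A\<^sub>2 = {a}" using 1(2) by (rule card_1_singletonE)
          show ?thesis
            by (rule forked_double_join[OF merge(1,3) 1(1) merge(2)[unfolded a] merge(4,5) False inj t disj n])
        next
          case 2
          obtain a where a: "A\<^sub>1 = {a}" using 2(2) by (rule card_1_singletonE)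
          show ?thesis
            by (rule forked_double_join[OF merge(2,4) 2(1) merge(1)[unfolded a] merge(3) joined_sym[OF merge(5)] False inj t disj n])
        qed
      qed
    qed
  qed
qed

section \<open>Colourings without rainbow cycles\<close>

text \<open>Acyclicity is stated by vertices of degree one, a form that passes to contractions.\<close>

definition rainbow_acyclic :: "'e set \<Rightarrow> bool" where
  "rainbow_acyclic E \<longleftrightarrow> (\<forall>D \<subseteq> E. D \<noteq> {} \<longrightarrow> inj_on c D \<longrightarrow> (\<exists>w. card {e \<in> D. w \<in> \<epsilon> e} = 1))"

lemma rainbow_acyclic_subset: "rainbow_acyclic E \<Longrightarrow> E' \<subseteq> E \<Longrightarrow> rainbow_acyclic E'"
  unfolding rainbow_acyclic_def by blast

text \<open>A longest path in a set of edges without vertices of degree one closes up to a cycle.\<close>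

lemma rainbow_acyclicI:
  assumes fin: "finite E" and two: "\<And>e. e \<in> E \<Longrightarrow> card (\<epsilon> e) = 2"
    and no_cycle: "\<And>s t P W e. \<lbrakk>rainbow_path s t P W; P \<subseteq> E; e \<in> E; \<epsilon> e = {t, s}; c e \<notin> c ` P\<rbrakk> \<Longrightarrow> False"
  shows "rainbow_acyclic E"
proof (rule ccontr)
  assume "\<not> ?thesis"
  then obtain D where D: "D \<subseteq> E" "D \<noteq> {}" "inj_on c D" "\<And>w. card {e \<in> D. w \<in> \<epsilon> e} \<noteq> 1"
    unfolding rainbow_acyclic_def by blast
  have finD: "finite D" using D(1) fin finite_subset by blast
  define path where "path P \<longleftrightarrow> P \<subseteq> D \<and> (\<exists>s t W. rainbow_path s t P W)" for P
  obtain e\<^sub>0 where e\<^sub>0: "e\<^sub>0 \<in> D" using D(2) by blast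
  then have "card (\<epsilon> e\<^sub>0) = 2" using two D(1) by blast
  then obtain a b where ab: "\<epsilon> e\<^sub>0 = {a, b}" "a \<noteq> b" by (auto simp: card_2_iff)
  have "rainbow_path a b {e\<^sub>0} {a, b}" using rainbow_path.cons[OF rainbow_path.nil[of b], of e\<^sub>0 a] ab by simp
  then have path\<^sub>0: "path {e\<^sub>0}" unfolding path_def using e\<^sub>0 by blast
  have "\<forall>P. path P \<longrightarrow> card P < Suc (card D)"
    unfolding path_def using card_mono[OF finD] by (simp add: less_Suc_eq_le)
  then obtain P where P: "path P" and max: "\<And>P'. path P' \<Longrightarrow> card P' \<le> card P"
    using ex_has_greatest_nat[of path "{e\<^sub>0}" card "Suc (card D)"] path\<^sub>0 by blast
  obtain s t W where path: "rainbow_path s t P W" and PD: "P \<subseteq> D" using P unfolding path_def by blast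
  have "card P \<ge> 1" using max[OF path\<^sub>0] by simp
  then have "P \<noteq> {}" by auto
  obtain s' P' W' e where e: "P = insert e P'" "W = insert s W'" "rainbow_path s' t P' W'"
    "\<epsilon> e = {s, s'}" "s \<notin> W'"
    using path
  proof cases
    case nil
    then show ?thesis using \<open>P \<noteq> {}\<close> by simp
  next
    case (cons s' P' W' e)
    show ?thesis by (rule that[OF cons(1-3,4,5)])
  qed
  have "e \<in> {f \<in> D. s \<in> \<epsilon> f}" using e PD by auto
  moreover have "{f \<in> D. s \<in> \<epsilon> f} \<noteq> {e}" using D(4)[of s] by (metis One_nat_def card_1_singleton_iff)
  ultimately obtain f where f: "f \<in> D" "s \<in> \<epsilon> f" "f \<noteq> e" by blast
  have "card (\<epsilon> f) = 2" using two f(1) D(1) by blast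
  then obtain a' b' where "\<epsilon> f = {a', b'}" "a' \<noteq> b'" by (auto simp: card_2_iff)
  then obtain r where r: "\<epsilon> f = {r, s}" "r \<noteq> s" using f(2) that[of a'] that[of b'] by auto
  have "f \<notin> P'" using rainbow_path_basic(7)[OF e(3), of f] f(2) e(5) by blast
  then have fP: "f \<notin> P" using e(1) f(3) by blast
  then have cf: "c f \<notin> c ` P" using D(3) PD f(1) by (metis (no_types, lifting) imageE inj_onD subsetD)
  show False
  proof (cases "r \<in> W")
    case True
    then have "W \<inter> {r} \<noteq> {}" by simp
    then obtain h P\<^sub>0 W\<^sub>0 where h: "rainbow_path s h P\<^sub>0 W\<^sub>0" "W\<^sub>0 \<inter> {r} = {h}" "P\<^sub>0 \<subseteq> P" "W\<^sub>0 \<subseteq> W"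
      by (rule rainbow_path_first_hit[OF path])
    have "h = r" using h(2) by auto
    show False
      by (rule no_cycle[OF h(1), of f]) (use h(3) PD D(1) f(1) r(1) cf \<open>h = r\<close> in auto)
  next
    case False
    have "rainbow_path r t (insert f P) (insert r W)"
      by (rule rainbow_path.cons[OF path r(1) False cf])
    then have "path (insert f P)" unfolding path_def using PD f(1) by blast
    from max[OF this] show False using fP finite_subset[OF PD finD] by simp
  qed
qed

text \<open>In the closed path all degrees are even, so none is equal to one.\<close>

lemma rainbow_acyclicD:
  assumes acyc: "rainbow_acyclic E" and path: "rainbow_path s t P W" and e: "P \<subseteq> E" "e \<in> E" "\<epsilon> e = {t, s}" "s \<noteq> t"
    "c e \<notin> c ` P"
  shows False
proof -
  have "e \<notin> P" using e(5) by blast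
  have "inj_on c (insert e P)" using rainbow_path_basic(6)[OF path] e(5) by auto
  then obtain w where w: "card {f \<in> insert e P. w \<in> \<epsilon> f} = 1"
    using acyc e(1,2) unfolding rainbow_acyclic_def by (metis insert_not_empty insert_subset)
  have eq: "{f \<in> insert e P. w \<in> \<epsilon> f} =
      (if w \<in> \<epsilon> e then insert e {f \<in> P. w \<in> \<epsilon> f} else {f \<in> P. w \<in> \<epsilon> f})" by auto
  have "even (card {f \<in> insert e P. w \<in> \<epsilon> f})"
    unfolding eq using rainbow_path_degree_parity[OF path, of w] rainbow_path_basic(1)[OF path] \<open>e \<notin> P\<close> e(3,4)
    by auto
  then show False using w by simp
qed

lemma rainbow_acyclic_card:
  assumes "finite D" "inj_on c D" "rainbow_acyclic D" "finite V" "V \<noteq> {}"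
    "\<And>e. e \<in> D \<Longrightarrow> \<epsilon> e \<subseteq> V \<and> card (\<epsilon> e) = 2"
  shows "card D < card V"
  using assms
proof (induction "card D" arbitrary: D V)
  case 0
  then show ?case by (simp add: card_gt_0_iff)
next
  case (Suc n)
  then have "D \<noteq> {}" by auto
  then obtain w where "card {e \<in> D. w \<in> \<epsilon> e} = 1" using Suc.prems unfolding rainbow_acyclic_def by blast
  then obtain e where e: "{e \<in> D. w \<in> \<epsilon> e} = {e}" by (rule card_1_singletonE)
  then have eD: "e \<in> D" "w \<in> \<epsilon> e" by blast+
  then have wV: "w \<in> V" "V - {w} \<noteq> {}" using Suc.prems(6)[OF eD(1)] by (auto simp: card_2_iff)
  have "card (D - {e}) < card (V - {w})"
  proof (rule Suc.hyps(1))
    show "n = card (D - {e})" using Suc.hyps(2) eD Suc.prems(1) by simp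
    show "rainbow_acyclic (D - {e})" by (rule rainbow_acyclic_subset[OF Suc.prems(3)]) blast
    show "inj_on c (D - {e})" using Suc.prems(2) by (rule inj_on_diff)
    show "\<epsilon> f \<subseteq> V - {w} \<and> card (\<epsilon> f) = 2" if "f \<in> D - {e}" for f using Suc.prems(6)[of f] that e by blast
  qed (use Suc.prems wV in auto)
  then show ?case using Suc.prems(1,4) eD(1) wV(1) by (simp add: card_Diff_singleton_if split: if_splits)
qed

text \<open>Choosing one edge of each colour gives a rainbow set, hence a forest.\<close>

lemma rainbow_acyclic_card_colours:
  assumes "finite E" "rainbow_acyclic E" "finite V" "V \<noteq> {}" "\<And>e. e \<in> E \<Longrightarrow> \<epsilon> e \<subseteq> V \<and> card (\<epsilon> e) = 2"
  shows "card (c ` E) < card V"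
proof -
  obtain D where D: "D \<subseteq> E" "inj_on c D" "c ` E = c ` D" using subset_image_inj[of "c ` E" c E] by blast
  have "card D < card V"
    by (rule rainbow_acyclic_card) (use assms D rainbow_acyclic_subset finite_subset in \<open>auto | blast\<close>)+
  then show ?thesis unfolding D(3) by (simp add: card_image[OF D(2)])
qed

text \<open>Both \<open>D\<close> and \<open>D\<close> with \<open>e\<^sub>0\<close> have a vertex
  of degree one. Outside \<open>{u, v}\<close> contraction does not change degrees. Otherwise
  \<open>w\<^sub>1\<close> meets only \<open>e\<^sub>0\<close>, so all edges of \<open>D\<close> at
  the merged vertex come from \<open>w\<^sub>2\<close>, the other end of
  \<open>e\<^sub>0\<close>.\<close>

lemma contract_acyclic:
  assumes acyc: "rainbow_acyclic E" and e\<^sub>0: "e\<^sub>0 \<in> E" "\<epsilon> e\<^sub>0 = {u, v}" "u \<noteq> v"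
    and E': "E' \<subseteq> E" "c e\<^sub>0 \<notin> c ` E'"
  shows "edge_coloured.rainbow_acyclic (\<lambda>e. (\<lambda>x. if x = v then u else x) ` \<epsilon> e) c E'"
  unfolding edge_coloured.rainbow_acyclic_def
proof (intro allI impI)
  fix D assume D: "D \<subseteq> E'" "D \<noteq> {}" "inj_on c D"
  let ?\<epsilon> = "\<lambda>e. (\<lambda>x. if x = v then u else x) ` \<epsilon> e"
  have other: "w \<in> ?\<epsilon> e \<longleftrightarrow> w \<in> \<epsilon> e" if "w \<noteq> u" "w \<noteq> v" for w e using that by auto
  have at_u: "u \<in> ?\<epsilon> e \<longleftrightarrow> u \<in> \<epsilon> e \<or> v \<in> \<epsilon> e" for e using e\<^sub>0(3) by force
  have "e\<^sub>0 \<notin> D" using D(1) E'(2) by blast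
  have "inj_on c (insert e\<^sub>0 D)" using D(1,3) E'(2) by auto
  moreover have "insert e\<^sub>0 D \<subseteq> E" using D(1) E'(1) e\<^sub>0(1) by blast
  ultimately obtain w\<^sub>1 where w\<^sub>1: "card {e \<in> insert e\<^sub>0 D. w\<^sub>1 \<in> \<epsilon> e} = 1"
    using acyc unfolding rainbow_acyclic_def by (metis insert_not_empty)
  have "D \<subseteq> E" using D(1) E'(1) by blast
  then obtain w\<^sub>2 where w\<^sub>2: "card {e \<in> D. w\<^sub>2 \<in> \<epsilon> e} = 1"
    using acyc D(2,3) unfolding rainbow_acyclic_def by blast
  consider "w\<^sub>1 \<noteq> u" "w\<^sub>1 \<noteq> v" | "w\<^sub>2 \<noteq> u" "w\<^sub>2 \<noteq> v" | "w\<^sub>1 \<in> {u, v}" "w\<^sub>2 \<in> {u, v}" by blast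
  then show "\<exists>w. card {e \<in> D. w \<in> ?\<epsilon> e} = 1"
  proof cases
    case 1
    have "{e \<in> insert e\<^sub>0 D. w\<^sub>1 \<in> \<epsilon> e} = {e \<in> D. w\<^sub>1 \<in> ?\<epsilon> e}" unfolding other[OF 1] using 1 e\<^sub>0(2) by auto
    then show ?thesis using w\<^sub>1 by (intro exI[of _ w\<^sub>1]) simp
  next
    case 2
    have "{e \<in> D. w\<^sub>2 \<in> \<epsilon> e} = {e \<in> D. w\<^sub>2 \<in> ?\<epsilon> e}" unfolding other[OF 2] ..
    then show ?thesis using w\<^sub>2 by (intro exI[of _ w\<^sub>2]) simp
  next
    case 3
    obtain g where g: "{e \<in> insert e\<^sub>0 D. w\<^sub>1 \<in> \<epsilon> e} = {g}" using w\<^sub>1 by (rule card_1_singletonE)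
    have "e\<^sub>0 \<in> {e \<in> insert e\<^sub>0 D. w\<^sub>1 \<in> \<epsilon> e}" using 3(1) e\<^sub>0(2) by blast
    then have "g = e\<^sub>0" unfolding g by simp
    then have none: "w\<^sub>1 \<notin> \<epsilon> e" if "e \<in> D" for e using g that \<open>e\<^sub>0 \<notin> D\<close> by auto
    then have "{e \<in> D. w\<^sub>1 \<in> \<epsilon> e} = {}" by blast
    then have "w\<^sub>1 \<noteq> w\<^sub>2" using w\<^sub>2 by (metis card.empty zero_neq_one)
    then have "{e \<in> D. w\<^sub>2 \<in> \<epsilon> e} = {e \<in> D. u \<in> ?\<epsilon> e}" unfolding at_u using 3 none by auto
    then show ?thesis using w\<^sub>2 by (intro exI[of _ u]) simp
  qed
qed

text \<open>The conclusion has two halves because at most one side of a split contains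
  \<open>u\<close>. That side receives \<open>v\<close> and \<open>F\<close>, while the other keeps
  its structure. At the leaf \<open>{u}\<close> a new split with cut \<open>F\<close> separates
  \<open>u\<close> from \<open>v\<close>.\<close>

lemma built_uncontract:
  assumes "edge_coloured.built (\<lambda>e. (\<lambda>x. if x = v then u else x) ` \<epsilon> e) c V E A"
    and "\<And>e. e \<in> E \<Longrightarrow> card (\<epsilon> e) = 2" "v \<notin> V" "c ` F \<inter> c ` E = {}"
    and uv: "u \<noteq> v" and F: "F \<noteq> {}" "finite F" "card F \<le> 2" "\<And>e. e \<in> F \<Longrightarrow> \<epsilon> e = {u, v} \<and> c e = i"
  shows "(u \<notin> V \<longrightarrow> built V E A) \<and>
    (u \<in> V \<longrightarrow> built (insert v V) (E \<union> F) (A \<union> (if card F = 1 then F else {})))"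
  using assms(1-4)
proof (induction rule: edge_coloured.built.induct[consumes 1, case_names single join])
  case (single w)
  have "joined {v, u} F {u} {} {v} {} F" if "u = w"
    unfolding joined_def using F uv by auto
  from built.join[OF built.single built.single this] show ?case using built.single by auto
next
  case (join V\<^sub>1 E\<^sub>1 A\<^sub>1 V\<^sub>2 E\<^sub>2 A\<^sub>2 V E H)
  let ?r = "\<lambda>x. if x = v then u else x"
  let ?A = "if card F = 1 then F else {}" and ?H = "if card H = 1 then H else {}"
  interpret q: edge_coloured "\<lambda>e. ?r ` \<epsilon> e" c .
  note D = q.joinedD[OF join.hyps(3)]
  have v: "v \<notin> V\<^sub>1" "v \<notin> V\<^sub>2" using join.prems(2) D(1,2) by blast+
  have cF: "c ` F \<inter> c ` E\<^sub>1 = {}" "c ` F \<inter> c ` E\<^sub>2 = {}" "c ` F \<inter> c ` H = {}"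
    using join.prems(3) D(3-5) by blast+
  have IH1: "(u \<notin> V\<^sub>1 \<longrightarrow> built V\<^sub>1 E\<^sub>1 A\<^sub>1) \<and> (u \<in> V\<^sub>1 \<longrightarrow> built (insert v V\<^sub>1) (E\<^sub>1 \<union> F) (A\<^sub>1 \<union> ?A))"
    using join.IH(1) join.prems(1) D(3) v(1) cF(1) by blast
  have IH2: "(u \<notin> V\<^sub>2 \<longrightarrow> built V\<^sub>2 E\<^sub>2 A\<^sub>2) \<and> (u \<in> V\<^sub>2 \<longrightarrow> built (insert v V\<^sub>2) (E\<^sub>2 \<union> F) (A\<^sub>2 \<union> ?A))"
    using join.IH(2) join.prems(1) D(4) v(2) cF(2) by blast
  have H: "H \<noteq> {}" "finite H" "card H \<le> 2" "\<exists>j. (\<forall>e \<in> H. c e = j) \<and> j \<notin> c ` E\<^sub>1 \<union> c ` E\<^sub>2"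
    using join.hyps(3) unfolding q.joined_def by blast+
  have cross: "\<exists>a b. \<epsilon> e = {a, b} \<and> ?r a \<in> V\<^sub>1 \<and> ?r b \<in> V\<^sub>2" if e: "e \<in> H" for e
  proof -
    obtain a b where ab: "a \<in> V\<^sub>1" "b \<in> V\<^sub>2" "?r ` \<epsilon> e = {a, b}" by (rule q.joined_crossE[OF join.hyps(3) e])
    obtain s t where st: "\<epsilon> e = {s, t}" using join.prems(1)[of e] e D(5) by (auto simp: card_2_iff)
    have "{?r s, ?r t} = {a, b}" using ab(3) unfolding st by (simp only: image_insert image_empty)
    then have "?r s = a \<and> ?r t = b \<or> ?r s = b \<and> ?r t = a" by (simp only: doubleton_eq_iff)
    then show ?thesis
    proof
      assume "?r s = a \<and> ?r t = b"
      then show ?thesis using st ab(1,2) by (intro exI[of _ s] exI[of _ t]) (simp only: simp_thms)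
    next
      assume "?r s = b \<and> ?r t = a"
      then show ?thesis using st ab(1,2) by (intro exI[of _ t] exI[of _ s]) (simp only: simp_thms insert_commute)
    qed
  qed
  have build: "built V' E' A'"
    if "built V\<^sub>1' E\<^sub>1' A\<^sub>1'" "built V\<^sub>2' E\<^sub>2' A\<^sub>2'" "joined V' E' V\<^sub>1' E\<^sub>1' V\<^sub>2' E\<^sub>2' H" "A' = A\<^sub>1' \<union> A\<^sub>2' \<union> ?H"
    for V' E' A' V\<^sub>1' E\<^sub>1' A\<^sub>1' V\<^sub>2' E\<^sub>2' A\<^sub>2'
    using built.join[OF that(1-3)] that(4) by simp
  consider "u \<in> V\<^sub>1" "u \<notin> V\<^sub>2" | "u \<in> V\<^sub>2" "u \<notin> V\<^sub>1" | "u \<notin> V\<^sub>1" "u \<notin> V\<^sub>2" using D(6) by blast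
  then show ?case
  proof cases
    case 1
    have "\<forall>e \<in> H. \<exists>a \<in> insert v V\<^sub>1. \<exists>b \<in> V\<^sub>2. \<epsilon> e = {a, b}"
    proof
      fix e assume "e \<in> H"
      then obtain a b where ab: "\<epsilon> e = {a, b}" "?r a \<in> V\<^sub>1" "?r b \<in> V\<^sub>2" using cross by blast
      then have "a \<in> insert v V\<^sub>1" "b \<in> V\<^sub>2" using 1 by (auto split: if_splits)
      then show "\<exists>a \<in> insert v V\<^sub>1. \<exists>b \<in> V\<^sub>2. \<epsilon> e = {a, b}" using ab(1) by blast
    qed
    moreover have "c ` (E\<^sub>1 \<union> F) \<inter> c ` E\<^sub>2 = {}" using D(13) cF by blast
    moreover have "\<exists>j. (\<forall>e \<in> H. c e = j) \<and> j \<notin> c ` (E\<^sub>1 \<union> F) \<union> c ` E\<^sub>2" using H(1,4) cF(3) by fast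
    ultimately have J: "joined (insert v V) (E \<union> F) (insert v V\<^sub>1) (E\<^sub>1 \<union> F) V\<^sub>2 E\<^sub>2 H"
      unfolding joined_def using D(6-8) v H(1-3) by auto
    have B: "built (insert v V\<^sub>1) (E\<^sub>1 \<union> F) (A\<^sub>1 \<union> ?A)" "built V\<^sub>2 E\<^sub>2 A\<^sub>2" using IH1 IH2 1 by blast+
    have "built (insert v V) (E \<union> F) (A\<^sub>1 \<union> A\<^sub>2 \<union> ?H \<union> ?A)"
      by (rule build[OF B J]) (simp only: Un_ac)
    then show ?thesis using 1 D(7) by blast
  next
    case 2
    have "\<forall>e \<in> H. \<exists>a \<in> V\<^sub>1. \<exists>b \<in> insert v V\<^sub>2. \<epsilon> e = {a, b}"
    proof
      fix e assume "e \<in> H"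
      then obtain a b where ab: "\<epsilon> e = {a, b}" "?r a \<in> V\<^sub>1" "?r b \<in> V\<^sub>2" using cross by blast
      then have "a \<in> V\<^sub>1" "b \<in> insert v V\<^sub>2" using 2 by (auto split: if_splits)
      then show "\<exists>a \<in> V\<^sub>1. \<exists>b \<in> insert v V\<^sub>2. \<epsilon> e = {a, b}" using ab(1) by blast
    qed
    moreover have "c ` E\<^sub>1 \<inter> c ` (E\<^sub>2 \<union> F) = {}" using D(13) cF by blast
    moreover have "\<exists>j. (\<forall>e \<in> H. c e = j) \<and> j \<notin> c ` E\<^sub>1 \<union> c ` (E\<^sub>2 \<union> F)" using H(1,4) cF(3) by fast
    ultimately have J: "joined (insert v V) (E \<union> F) V\<^sub>1 E\<^sub>1 (insert v V\<^sub>2) (E\<^sub>2 \<union> F) H"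
      unfolding joined_def using D(6-8) v H(1-3) by auto
    have B: "built V\<^sub>1 E\<^sub>1 A\<^sub>1" "built (insert v V\<^sub>2) (E\<^sub>2 \<union> F) (A\<^sub>2 \<union> ?A)" using IH1 IH2 2 by blast+
    have "built (insert v V) (E \<union> F) (A\<^sub>1 \<union> A\<^sub>2 \<union> ?H \<union> ?A)"
      by (rule build[OF B J]) (simp only: Un_ac)
    then show ?thesis using 2 D(7) by blast
  next
    case 3
    have "\<forall>e \<in> H. \<exists>a \<in> V\<^sub>1. \<exists>b \<in> V\<^sub>2. \<epsilon> e = {a, b}"
    proof
      fix e assume "e \<in> H"
      then obtain a b where ab: "\<epsilon> e = {a, b}" "?r a \<in> V\<^sub>1" "?r b \<in> V\<^sub>2" using cross by blast
      then have "a \<in> V\<^sub>1" "b \<in> V\<^sub>2" using 3 by (auto split: if_splits)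
      then show "\<exists>a \<in> V\<^sub>1. \<exists>b \<in> V\<^sub>2. \<epsilon> e = {a, b}" using ab(1) by blast
    qed
    then have J: "joined V E V\<^sub>1 E\<^sub>1 V\<^sub>2 E\<^sub>2 H" unfolding joined_def using D(6-8,13) H by simp
    have B: "built V\<^sub>1 E\<^sub>1 A\<^sub>1" "built V\<^sub>2 E\<^sub>2 A\<^sub>2" using IH1 IH2 3 by blast+
    have "built V E (A\<^sub>1 \<union> A\<^sub>2 \<union> ?H)" by (rule build[OF B J refl])
    then show ?thesis using 3 D(7) by blast
  qed
qed

text \<open>
  Such a graph has fewer than \<open>2 * card V\<close> edges, hence a vertex of degree at most three.  Some
  colour disappears with it, so both its edges meet there; a third edge at the vertex would close
  a rainbow cycle with one of the two paths of a fork.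
\<close>

lemma no_simple_doubled:
  assumes V: "finite V" "card V \<ge> 2" and E: "finite E" "\<And>e. e \<in> E \<Longrightarrow> \<epsilon> e \<subseteq> V \<and> card (\<epsilon> e) = 2"
    and acyc: "rainbow_acyclic E" and colours: "card (c ` E) + 1 = card V"
    and two: "\<And>i. i \<in> c ` E \<Longrightarrow> card {e \<in> E. c e = i} = 2" and inj: "inj_on \<epsilon> E"
    and smaller: "\<And>v E'. v \<in> V \<Longrightarrow> E' = {e \<in> E. v \<notin> \<epsilon> e} \<Longrightarrow> card (c ` E') + 1 = card (V - {v}) \<Longrightarrow>
      \<exists>A. built (V - {v}) E' A"
  shows False
proof -
  have "card E = (\<Sum>i \<in> c ` E. card {e \<in> E. c e = i})"
    using sum.image_gen[OF E(1), of "\<lambda>_. 1 :: nat" c] by simp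
  also have "\<dots> = 2 * card (c ` E)" using two by simp
  finally have cardE: "card E = 2 * card (c ` E)" .
  have "(\<Sum>v \<in> V. card {e \<in> E. v \<in> \<epsilon> e}) = (\<Sum>v \<in> V. \<Sum>e \<in> E. if v \<in> \<epsilon> e then 1 else 0)"
    using E(1) by (simp add: sum.If_cases Int_def)
  also have "\<dots> = (\<Sum>e \<in> E. \<Sum>v \<in> V. if v \<in> \<epsilon> e then 1 else 0)" by (rule sum.swap)
  also have "\<dots> = (\<Sum>e \<in> E. 2)"
  proof (rule sum.cong[OF refl])
    fix e assume "e \<in> E"
    then have "V \<inter> {v. v \<in> \<epsilon> e} = \<epsilon> e" "card (\<epsilon> e) = 2" using E(2) by auto
    then show "(\<Sum>v \<in> V. if v \<in> \<epsilon> e then 1 else 0) = (2 :: nat)" using V(1) by (simp add: sum.If_cases)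
  qed
  finally have deg: "(\<Sum>v \<in> V. card {e \<in> E. v \<in> \<epsilon> e}) = 2 * card E" by simp
  \<comment> \<open>Minimum degree four would give
    \<open>4 * card V \<le> 2 * card E = 4 * (card V - 1)\<close>.\<close>
  have "\<exists>v \<in> V. card {e \<in> E. v \<in> \<epsilon> e} \<le> 3"
  proof (rule ccontr)
    assume "\<not> ?thesis"
    then have "(\<Sum>v \<in> V. 4) \<le> (\<Sum>v \<in> V. card {e \<in> E. v \<in> \<epsilon> e})" by (intro sum_mono) (auto simp: not_le)
    then show False using deg cardE colours by simp
  qed
  then obtain v where v: "v \<in> V" "card {e \<in> E. v \<in> \<epsilon> e} \<le> 3" by blast
  let ?D = "{e \<in> E. v \<in> \<epsilon> e}"
  define E' where "E' = {e \<in> E. v \<notin> \<epsilon> e}"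
  have finD: "finite ?D" using E(1) by simp
  have cardV: "card (V - {v}) + 1 = card V" using card_Suc_Diff1[OF V(1) v(1)] by simp
  have ne: "V - {v} \<noteq> {}"
  proof
    assume "V - {v} = {}"
    then have "card (V - {v}) = 0" by (simp only: card.empty)
    then show False using cardV V(2) by simp
  qed
  have ends: "\<exists>r \<in> V - {v}. \<epsilon> e = {r, v}" if "e \<in> ?D" for e
  proof -
    have "card (\<epsilon> e) = 2" "\<epsilon> e \<subseteq> V" "v \<in> \<epsilon> e" using E(2)[of e] that by auto
    then obtain a b where ab: "\<epsilon> e = {a, b}" "a \<noteq> b" by (auto simp: card_2_iff)
    then consider "v = a" | "v = b" using \<open>v \<in> \<epsilon> e\<close> by blast
    then show ?thesis
    proof cases
      case 1 then show ?thesis using ab \<open>\<epsilon> e \<subseteq> V\<close> by (intro bexI[of _ b]) auto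
    next
      case 2 then show ?thesis using ab \<open>\<epsilon> e \<subseteq> V\<close> by (intro bexI[of _ a]) auto
    qed
  qed
  have acyc': "rainbow_acyclic E'" by (rule rainbow_acyclic_subset[OF acyc]) (auto simp: E'_def)
  \<comment> \<open>By the forest bound on \<open>V - {v}\<close>, at most \<open>card V - 2\<close>
    colours remain in \<open>E'\<close>, one fewer than in \<open>E\<close>.\<close>
  have "card (c ` E') < card (V - {v})"
  proof (rule rainbow_acyclic_card_colours[OF _ acyc' _ ne])
    show "\<epsilon> e \<subseteq> V - {v} \<and> card (\<epsilon> e) = 2" if "e \<in> E'" for e using E(2)[of e] that unfolding E'_def by blast
  qed (use E(1) V(1) in \<open>auto simp: E'_def\<close>)
  then have "card (c ` E') \<noteq> card (c ` E)" using colours cardV by linarith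
  then have "c ` E' \<noteq> c ` E" by metis
  moreover have "c ` E' \<subseteq> c ` E" unfolding E'_def by blast
  ultimately obtain i where i: "i \<in> c ` E" "i \<notin> c ` E'" by blast
  obtain e\<^sub>1 e\<^sub>2 where e: "{e \<in> E. c e = i} = {e\<^sub>1, e\<^sub>2}" "e\<^sub>1 \<noteq> e\<^sub>2"
    using two[OF i(1)] unfolding card_2_iff by blast
  have colour_i: "g \<in> E \<and> c g = i \<longleftrightarrow> g = e\<^sub>1 \<or> g = e\<^sub>2" for g
    using arg_cong[OF e(1), of "\<lambda>S. g \<in> S"] by simp
  then have eE: "e\<^sub>1 \<in> E" "e\<^sub>2 \<in> E" "c e\<^sub>1 = i" "c e\<^sub>2 = i" by auto
  have "g \<notin> E'" if "c g = i" for g using i(2) that by auto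
  from this[OF eE(3)] this[OF eE(4)] have eD: "e\<^sub>1 \<in> ?D" "e\<^sub>2 \<in> ?D" using eE unfolding E'_def by simp_all
  obtain p where p: "p \<in> V - {v}" "\<epsilon> e\<^sub>1 = {p, v}" using ends[OF eD(1)] by blast
  obtain q where q: "q \<in> V - {v}" "\<epsilon> e\<^sub>2 = {q, v}" using ends[OF eD(2)] by blast
  have pq: "p \<noteq> q" using inj_onD[OF inj, of e\<^sub>1 e\<^sub>2] eE(1,2) e(2) p(2) q(2) by auto
  have "card (?D - {e\<^sub>1, e\<^sub>2}) \<le> 1"
    using v(2) eD e(2) finD card_Diff_subset[of "{e\<^sub>1, e\<^sub>2}" ?D] by simp
  then have le1: "\<forall>f \<in> ?D - {e\<^sub>1, e\<^sub>2}. \<forall>g \<in> ?D - {e\<^sub>1, e\<^sub>2}. f = g"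
    using card_le_Suc0_iff_eq[OF finite_Diff[OF finD]] by (simp only: One_nat_def)
  have third: "f = g" if "f \<in> ?D - {e\<^sub>1, e\<^sub>2}" "g \<in> ?D - {e\<^sub>1, e\<^sub>2}" for f g
    by (rule bspec[OF bspec[OF le1 that(1)] that(2)])
  have twin: "\<exists>f' \<in> E. f' \<noteq> f \<and> (\<forall>g. g \<in> E \<and> c g = c f \<longleftrightarrow> g = f \<or> g = f')" if "f \<in> E" for f
  proof -
    have "card {g \<in> E. c g = c f} = 2" using two that by blast
    then obtain a b where ab: "{g \<in> E. c g = c f} = {a, b}" "a \<noteq> b" unfolding card_2_iff by blast
    have ab': "g \<in> E \<and> c g = c f \<longleftrightarrow> g = a \<or> g = b" for g
      using arg_cong[OF ab(1), of "\<lambda>S. g \<in> S"] by simp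
    then have "f = a \<or> f = b" "a \<in> E" "b \<in> E" using that by auto
    then show ?thesis using ab(2) ab' by metis
  qed
  have colour_in: "f \<in> {e\<^sub>1, e\<^sub>2}" if "f \<in> E" "c f = i" for f using colour_i[of f] that by blast
  \<comment> \<open>Another colour could vanish only if both its edges met \<open>v\<close>, but at
    most one edge at \<open>v\<close> has a colour other than \<open>i\<close>.\<close>
  have "c ` E' = c ` E - {i}"
  proof
    show "c ` E' \<subseteq> c ` E - {i}" using i(2) unfolding E'_def by blast
    show "c ` E - {i} \<subseteq> c ` E'"
    proof
      fix j assume "j \<in> c ` E - {i}"
      then obtain f where f: "f \<in> E" "c f = j" "j \<noteq> i" by blast
      obtain f' where f': "f' \<in> E" "f' \<noteq> f" "\<And>g. g \<in> E \<and> c g = c f \<longleftrightarrow> g = f \<or> g = f'" using twin[OF f(1)] by blast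
      have cf': "c f' = j" using f(2) f'(3)[of f'] by simp
      have "f \<notin> {e\<^sub>1, e\<^sub>2}" "f' \<notin> {e\<^sub>1, e\<^sub>2}" using eE f cf' by auto
      then have "f \<notin> ?D \<or> f' \<notin> ?D" using third[of f f'] f'(2) by blast
      then have "f \<in> E' \<or> f' \<in> E'" unfolding E'_def using f(1) f'(1) by simp
      then show "j \<in> c ` E'" using f(2) cf' by (metis image_eqI)
    qed
  qed
  then have "card (c ` E') + 1 = card (V - {v})"
    using card_Suc_Diff1[OF finite_imageI[OF E(1)] i(1)] colours cardV by simp
  from smaller[OF v(1) E'_def this] obtain A where A: "built (V - {v}) E' A" by blast
  have inj': "inj_on \<epsilon> E'" by (rule inj_on_subset[OF inj]) (auto simp: E'_def)
  have A_def: "A = {f \<in> E'. \<forall>g \<in> E'. c g = c f \<longrightarrow> g = f}" by (rule built_basic(4)[OF A])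
  have ci: "c g \<noteq> i" if "g \<in> E'" for g using i(2) that by auto
  show False
  proof (cases "?D - {e\<^sub>1, e\<^sub>2} = {}")
    case True
    \<comment> \<open>Without a third edge at \<open>v\<close>, every colour class other than that
      of \<open>i\<close> survives with both edges.\<close>
    have "A = {}"
    proof (rule ccontr)
      assume "A \<noteq> {}"
      then obtain f where f: "f \<in> E'" "\<forall>g \<in> E'. c g = c f \<longrightarrow> g = f" unfolding A_def by blast
      then have "f \<in> E" unfolding E'_def by simp
      then obtain f' where f': "f' \<in> E" "f' \<noteq> f" "\<And>g. g \<in> E \<and> c g = c f \<longleftrightarrow> g = f \<or> g = f'" using twin by blast
      have cf': "c f' = c f" using f'(3)[of f'] by simp
      have "f' \<notin> {e\<^sub>1, e\<^sub>2}" using cf' ci[OF f(1)] eE by auto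
      then have "f' \<notin> ?D" using True by blast
      then have "f' \<in> E'" using f'(1) unfolding E'_def by simp
      then show False using f(2) f'(2) cf' by blast
    qed
    then have "built (V - {v}) E' {}" using A by simp
    then obtain w where "V - {v} = {w}" by (rule built_no_singular[OF _ inj'])
    then show False using p(1) q(1) pq by auto
  next
    case False
    then obtain e\<^sub>3 where e3: "e\<^sub>3 \<in> ?D - {e\<^sub>1, e\<^sub>2}" by blast
    then have e3': "e\<^sub>3 \<in> E" "e\<^sub>3 \<in> ?D" by simp_all
    obtain r where r: "r \<in> V - {v}" "\<epsilon> e\<^sub>3 = {r, v}" using ends[OF e3'(2)] by blast
    have c3: "c e\<^sub>3 \<noteq> i" using colour_in[OF e3'(1)] e3 by auto
    obtain f where f: "f \<in> E" "f \<noteq> e\<^sub>3" "\<And>g. g \<in> E \<and> c g = c e\<^sub>3 \<longleftrightarrow> g = e\<^sub>3 \<or> g = f" using twin[OF e3'(1)] by blast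
    have cf: "c f = c e\<^sub>3" using f(3)[of f] by simp
    have fE': "f \<in> E'"
    proof (rule ccontr)
      assume "f \<notin> E'"
      then have "f \<in> ?D" using f(1) unfolding E'_def by simp
      moreover have "f \<notin> {e\<^sub>1, e\<^sub>2}" using eE cf c3 by auto
      ultimately show False using third[OF _ e3, of f] f(2) by blast
    qed
    have only_f: "g = f" if "g \<in> E'" "c g = c e\<^sub>3" for g
    proof -
      have "g = e\<^sub>3 \<or> g = f" using f(3)[of g] that unfolding E'_def by auto
      moreover have "g \<noteq> e\<^sub>3" using that(1) e3'(2) unfolding E'_def by auto
      ultimately show ?thesis by blast
    qed
    have "A = {f}"
    proof
      have "\<forall>g \<in> E'. c g = c f \<longrightarrow> g = f" using only_f unfolding cf by blast
      then show "{f} \<subseteq> A" unfolding A_def using fE' by blast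
      show "A \<subseteq> {f}"
      proof
        fix g assume "g \<in> A"
        then have g: "g \<in> E'" "\<forall>h \<in> E'. c h = c g \<longrightarrow> h = g" unfolding A_def by simp_all
        then have "g \<in> E" unfolding E'_def by simp
        then obtain g' where g': "g' \<in> E" "g' \<noteq> g" "\<And>h. h \<in> E \<and> c h = c g \<longleftrightarrow> h = g \<or> h = g'" using twin by blast
        have cg': "c g' = c g" using g'(3)[of g'] by simp
        have "g' \<notin> E'" using g(2) g'(2) cg' by blast
        then have "g' \<in> ?D" using g'(1) unfolding E'_def by simp
        moreover have "g' \<notin> {e\<^sub>1, e\<^sub>2}" using ci[OF g(1)] cg' eE by auto
        ultimately have "g' = e\<^sub>3" using third[OF _ e3, of g'] by blast
        then show "g \<in> {f}" using only_f[OF g(1)] cg' by simp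
      qed
    qed
    \<comment> \<open>The only edge of \<open>E'\<close> with the colour of \<open>e\<^sub>3\<close>
      is \<open>f\<close>, and at most one branch contains it. The other branch closes a rainbow
      cycle through \<open>v\<close> with \<open>e\<^sub>3\<close> and \<open>e\<^sub>1\<close> or
      \<open>e\<^sub>2\<close>.\<close>
    then have "fork (V - {v}) E' (card (V - {v})) {r} {p} {q}"
      using A pq by (intro fork_one_singular[OF _ inj' terminal_singleton[OF r(1)] p(1) q(1)]) auto
    then obtain y y' p' q' P Q where PQ: "{r} = {y, y'}" "p' \<in> {p}" "q' \<in> {q}"
      "linked (V - {v}) E' y p' P" "linked (V - {v}) E' y' q' Q" "P \<inter> Q = {}"
      "card P + card Q + card {r} \<le> card (V - {v})"
      by (rule forkE)
    have close: False if P: "linked (V - {v}) E' r t P" "f \<notin> P" and g: "g \<in> E" "c g = i" "\<epsilon> g = {t, v}" and t: "t \<in> V - {v}" for t P g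
    proof -
      obtain W where W: "W \<subseteq> V - {v}" "rainbow_path r t P W" "P \<subseteq> E'" using P(1) by (auto simp: linked_def)
      have "c e\<^sub>3 \<notin> c ` P"
      proof
        assume "c e\<^sub>3 \<in> c ` P"
        then obtain h where h: "h \<in> P" "c h = c e\<^sub>3" by (metis imageE)
        then have "h = f" using only_f W(3) by blast
        then show False using h(1) P(2) by blast
      qed
      then have path: "rainbow_path v t (insert e\<^sub>3 P) (insert v W)"
        using W(1) r(2) by (intro rainbow_path.cons[OF W(2)]) auto
      have "insert e\<^sub>3 P \<subseteq> E" using W(3) e3'(1) unfolding E'_def by auto
      moreover have "i \<notin> c ` P" using i(2) W(3) by blast
      then have "c g \<notin> c ` insert e\<^sub>3 P" using g(2) c3 by simp
      moreover have "v \<noteq> t" using t by blast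
      ultimately show False by (intro rainbow_acyclicD[OF acyc path _ g(1,3)])
    qed
    have y: "y = r" "y' = r" "p' = p" "q' = q" using PQ(1-3) by auto
    consider "f \<notin> P" | "f \<notin> Q" using PQ(6) by blast
    then show False
    proof cases
      case 1 then show False using close[OF PQ(4)[unfolded y] _ eE(1,3) p(2,1)] by simp
    next
      case 2 then show False using close[OF PQ(5)[unfolded y] _ eE(2,4) q(2,1)] by simp
    qed
  qed
qed

end

text \<open>The induction varies \<open>\<epsilon>\<close>, hence the statement outside the locale.
  A one-edge class also counts as a class of parallel edges, so if no class can be contracted, each
  consists of two edges with different ends.\<close>

lemma built_if_rainbow_acyclic:
  fixes \<epsilon> :: "'e \<Rightarrow> 'v set" and c :: "'e \<Rightarrow> 'c"
  assumes "finite V" "V \<noteq> {}" "finite E" "\<And>e. e \<in> E \<Longrightarrow> \<epsilon> e \<subseteq> V \<and> card (\<epsilon> e) = 2"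
    "edge_coloured.rainbow_acyclic \<epsilon> c E" "card (c ` E) + 1 = card V" "\<And>i. card {e \<in> E. c e = i} \<le> 2"
  shows "\<exists>A. edge_coloured.built \<epsilon> c V E A"
  using assms
proof (induction "card V" arbitrary: \<epsilon> V E rule: less_induct)
  case less
  interpret edge_coloured \<epsilon> c .
  note fin = less.prems(1,3) and ends = less.prems(4) and acyc = less.prems(5)
    and colours = less.prems(6) and le2 = less.prems(7)
  \<comment> \<open>Such a pair would be a rainbow cycle of length two.\<close>
  have parallel: False if ef: "e \<in> E" "f \<in> E" "c e \<noteq> c f" "\<epsilon> e = \<epsilon> f" for e f
  proof -
    obtain u v where uv: "\<epsilon> f = {u, v}" "u \<noteq> v" using ends[OF ef(2)] by (auto simp: card_2_iff)
    have "rainbow_path u v {f} {u, v}" using rainbow_path.cons[OF rainbow_path.nil[of v], of f u] uv by simp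
    from rainbow_acyclicD[OF acyc this, of e] show False using ef uv by auto
  qed
  consider "card V = 1" | "card V \<ge> 2" using less.prems(1,2) by (metis One_nat_def card_0_eq less_2_cases_iff not_le)
  then show ?case
  proof cases
    case 1
    then obtain v where v: "V = {v}" by (rule card_1_singletonE)
    have "E = {}"
    proof (rule ccontr)
      assume "E \<noteq> {}"
      then obtain e where "e \<in> E" by blast
      from ends[OF this] show False using v card_mono[of "{v}" "\<epsilon> e"] by simp
    qed
    then show ?thesis using built.single[of v] v by blast
  next
    case 2
    show ?thesis
    proof (cases "\<exists>i \<in> c ` E. \<exists>u v. u \<noteq> v \<and> (\<forall>e \<in> E. c e = i \<longrightarrow> \<epsilon> e = {u, v})")
      case True
      then obtain i u v where i: "i \<in> c ` E" "u \<noteq> v" "\<And>e. e \<in> E \<Longrightarrow> c e = i \<Longrightarrow> \<epsilon> e = {u, v}" by blast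
      obtain e\<^sub>0 where e\<^sub>0: "e\<^sub>0 \<in> E" "c e\<^sub>0 = i" using i(1) by blast
      define F where "F = {e \<in> E. c e = i}"
      define E' where "E' = {e \<in> E. c e \<noteq> i}"
      let ?\<epsilon> = "\<lambda>e. (\<lambda>x. if x = v then u else x) ` \<epsilon> e"
      have uvV: "u \<in> V" "v \<in> V" using ends[OF e\<^sub>0(1)] i(3)[OF e\<^sub>0] by auto
      have EF: "E = E' \<union> F" unfolding F_def E'_def by blast
      have cardV: "card (V - {v}) + 1 = card V" using fin(1) uvV(2) card_Suc_Diff1 by fastforce
      have cE': "c ` E' = c ` E - {i}" unfolding E'_def by blast
      have "\<exists>A. edge_coloured.built ?\<epsilon> c (V - {v}) E' A"
      proof (rule less.hyps)
        show "card (V - {v}) < card V" using cardV by simp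
        show "finite (V - {v})" "finite E'" using fin unfolding E'_def by auto
        show "V - {v} \<noteq> {}" using uvV(1) i(2) by blast
        show "edge_coloured.rainbow_acyclic ?\<epsilon> c E'"
          by (rule contract_acyclic[OF acyc e\<^sub>0(1) i(3)[OF e\<^sub>0] i(2)]) (auto simp: E'_def e\<^sub>0(2))
        show "card (c ` E') + 1 = card (V - {v})"
          unfolding cE' using card_Suc_Diff1[OF finite_imageI[OF fin(2)] i(1)] colours cardV by simp
        show "card {e \<in> E'. c e = j} \<le> 2" for j
          using card_mono[of "{e \<in> E. c e = j}" "{e \<in> E'. c e = j}"] le2[of j] fin(2) unfolding E'_def by fastforce
        show "?\<epsilon> e \<subseteq> V - {v} \<and> card (?\<epsilon> e) = 2" if "e \<in> E'" for e
        proof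
          have e: "e \<in> E" "c e \<noteq> i" using that unfolding E'_def by auto
          show "?\<epsilon> e \<subseteq> V - {v}" using ends[OF e(1)] uvV(1) i(2) by auto
          \<comment> \<open>No edge of another colour joins \<open>u\<close> and \<open>v\<close>,
            so contraction creates no loop.\<close>
          have "\<epsilon> e \<noteq> {u, v}" using parallel[OF e(1) e\<^sub>0(1)] e(2) e\<^sub>0 i(3) by auto
          then have "\<not> {u, v} \<subseteq> \<epsilon> e" using ends[OF e(1)] i(2) by (auto simp: card_2_iff)
          then have "inj_on (\<lambda>x. if x = v then u else x) (\<epsilon> e)" by (auto simp: inj_on_def)
          from card_image[OF this] show "card (?\<epsilon> e) = 2" using ends[OF e(1)] by metis
        qed
      qed
      then obtain A where A: "edge_coloured.built ?\<epsilon> c (V - {v}) E' A" by blast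
      have "built (insert v (V - {v})) (E' \<union> F) (A \<union> (if card F = 1 then F else {}))"
      proof -
        have F: "F \<noteq> {}" "finite F" "card F \<le> 2" "\<And>e. e \<in> F \<Longrightarrow> \<epsilon> e = {u, v} \<and> c e = i"
          using e\<^sub>0 fin(2) le2[of i] i(3) unfolding F_def by auto
        have "c ` F \<inter> c ` E' = {}" unfolding F_def E'_def by auto
        from built_uncontract[OF A _ _ this i(2) F] show ?thesis
          using ends uvV(1) i(2) unfolding E'_def by blast
      qed
      moreover have "insert v (V - {v}) = V" using uvV(2) by blast
      ultimately show ?thesis unfolding EF by auto
    next
      case False
      have two: "card {e \<in> E. c e = i} = 2" and distinct: "\<And>e f. \<lbrakk>e \<in> E; f \<in> E; c e = i; c f = i; e \<noteq> f\<rbrakk> \<Longrightarrow> \<epsilon> e \<noteq> \<epsilon> f"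
        if i: "i \<in> c ` E" for i
      proof -
        obtain e where e: "e \<in> E" "c e = i" using i by blast
        obtain u v where uv: "\<epsilon> e = {u, v}" "u \<noteq> v" using ends[OF e(1)] by (auto simp: card_2_iff)
        then obtain f where f: "f \<in> E" "c f = i" "\<epsilon> f \<noteq> \<epsilon> e" using False i by blast
        have "e \<noteq> f" using f(3) by blast
        then have "card {e, f} = 2" by simp
        have "{e, f} = {e \<in> E. c e = i}"
          by (rule card_seteq) (use e f fin(2) le2[of i] \<open>card {e, f} = 2\<close> in auto)
        then have eq: "{e \<in> E. c e = i} = {e, f}" by (rule sym)
        then show "card {e \<in> E. c e = i} = 2" using \<open>card {e, f} = 2\<close> by simp
        show "\<epsilon> g \<noteq> \<epsilon> h" if "g \<in> E" "h \<in> E" "c g = i" "c h = i" "g \<noteq> h" for g h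
        proof -
          have "g \<in> {e, f}" "h \<in> {e, f}" using eq that by blast+
          then show ?thesis using that(5) f(3) by auto
        qed
      qed
      have inj: "inj_on \<epsilon> E"
      proof (rule inj_onI)
        fix e f assume ef: "e \<in> E" "f \<in> E" "\<epsilon> e = \<epsilon> f"
        show "e = f"
        proof (rule ccontr)
          assume "e \<noteq> f"
          then show False using parallel[OF ef(1,2) _ ef(3)] distinct[of "c e" e f] ef by fastforce
        qed
      qed
      have "\<exists>A. built (V - {v}) E' A"
        if "v \<in> V" "E' = {e \<in> E. v \<notin> \<epsilon> e}" "card (c ` E') + 1 = card (V - {v})" for v E'
      proof (rule less.hyps)
        show "card (V - {v}) < card V" by (rule card_Diff1_less[OF fin(1) that(1)])
        show "finite (V - {v})" "finite E'" using fin that(2) by auto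
        show "V - {v} \<noteq> {}" using that(3) by (metis Suc_eq_plus1 card.empty nat.distinct(1))
        show "rainbow_acyclic E'" by (rule rainbow_acyclic_subset[OF acyc]) (use that(2) in blast)
        show "card {e \<in> E'. c e = j} \<le> 2" for j
          using card_mono[of "{e \<in> E. c e = j}" "{e \<in> E'. c e = j}"] le2[of j] fin(2) that(2) by fastforce
        show "\<epsilon> e \<subseteq> V - {v} \<and> card (\<epsilon> e) = 2" if "e \<in> E'" for e
          using ends[of e] that \<open>E' = {e \<in> E. v \<notin> \<epsilon> e}\<close> by blast
      qed (rule that(3))
      from no_simple_doubled[OF fin(1) 2 fin(2) ends acyc colours two inj this] show ?thesis by blast
    qed
  qed
qed

section \<open>Rainbow cycles through the triangle\<close>

lemma graph_isomorphic_complete_4: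
  assumes W: "card W = 4" and inj: "inj_on (ends G) S" and im: "ends G ` S = {e. e \<subseteq> W \<and> card e = 2}"
  shows "graph_isomorphic (edge_induced G S) (complete_graph 4)"
proof -
  have finW: "finite W" using W by (metis card.infinite zero_neq_numeral)
  obtain \<phi> where \<phi>: "bij_betw \<phi> W {..<4 :: nat}"
    using ex_bij_betw_finite_nat[OF finW] W by (auto simp: atLeast0LessThan)
  have injW: "inj_on \<phi> W" using \<phi> by (rule bij_betw_imp_inj_on)
  have "(\<Union>e \<in> S. ends G e) = \<Union> {e. e \<subseteq> W \<and> card e = 2}" using im by auto
  also have "\<dots> = W"
  proof
    show "W \<subseteq> \<Union> {e. e \<subseteq> W \<and> card e = 2}"
    proof
      fix w assume w: "w \<in> W"
      have "card (W - {w}) = 3" using W finW w by simp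
      then have "W - {w} \<noteq> {}" by (metis card.empty zero_neq_numeral)
      then obtain w' where "w' \<in> W" "w' \<noteq> w" by blast
      then have "{w, w'} \<subseteq> W" "card {w, w'} = 2" using w by auto
      then show "w \<in> \<Union> {e. e \<subseteq> W \<and> card e = 2}" by blast
    qed
  qed blast
  finally have verts: "(\<Union>e \<in> S. ends G e) = W" .
  have "bij_betw (\<lambda>e. \<phi> ` ends G e) S {e. e \<subseteq> {..<4} \<and> card e = 2}"
  proof (rule bij_betw_imageI)
    show "inj_on (\<lambda>e. \<phi> ` ends G e) S"
    proof (rule inj_onI)
      fix e f assume ef: "e \<in> S" "f \<in> S" "\<phi> ` ends G e = \<phi> ` ends G f"
      have "ends G e \<subseteq> W" "ends G f \<subseteq> W" using imageI[OF ef(1), of "ends G"] imageI[OF ef(2), of "ends G"] im by simp_all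
      then have "ends G e = ends G f" using ef(3) inj_on_image_eq_iff[OF injW] by simp
      then show "e = f" by (rule inj_onD[OF inj _ ef(1,2)])
    qed
    show "(\<lambda>e. \<phi> ` ends G e) ` S = {e. e \<subseteq> {..<4} \<and> card e = 2}"
    proof
      show "(\<lambda>e. \<phi> ` ends G e) ` S \<subseteq> {e. e \<subseteq> {..<4} \<and> card e = 2}"
      proof
        fix d assume "d \<in> (\<lambda>e. \<phi> ` ends G e) ` S"
        then obtain e where e: "e \<in> S" "d = \<phi> ` ends G e" by blast
        then have "ends G e \<subseteq> W" "card (ends G e) = 2" using imageI[OF e(1), of "ends G"] im by simp_all
        then show "d \<in> {e. e \<subseteq> {..<4} \<and> card e = 2}"
          using e(2) \<phi> inj_on_subset[OF injW] by (auto simp: card_image bij_betw_def)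
      qed
      show "{e. e \<subseteq> {..<4} \<and> card e = 2} \<subseteq> (\<lambda>e. \<phi> ` ends G e) ` S"
      proof
        fix d :: "nat set" assume "d \<in> {e. e \<subseteq> {..<4} \<and> card e = 2}"
        then have d: "d \<subseteq> \<phi> ` W" "card d = 2" using \<phi> by (auto simp: bij_betw_def)
        then obtain e where e: "e \<subseteq> W" "d = \<phi> ` e" by (metis subset_imageE)
        then have "card e = 2" using d(2) inj_on_subset[OF injW] by (simp add: card_image)
        then have "e \<in> ends G ` S" using e(1) im by simp
        then show "d \<in> (\<lambda>e. \<phi> ` ends G e) ` S" using e(2) by blast
      qed
    qed
  qed
  then show ?thesis
    unfolding graph_isomorphic_def edge_induced_def complete_graph_def using \<phi> verts
    by (intro exI[of _ \<phi>] exI[of _ "\<lambda>e. \<phi> ` ends G e"]) simp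
qed

lemma two_subsets_of_four:
  assumes "distinct [x, y, z, u]"
  shows "{e. e \<subseteq> {x, y, z, u} \<and> card e = 2} = {{x, y}, {y, z}, {z, x}, {u, x}, {u, y}, {u, z}}"
proof
  show "{e. e \<subseteq> {x, y, z, u} \<and> card e = 2} \<subseteq> {{x, y}, {y, z}, {z, x}, {u, x}, {u, y}, {u, z}}"
  proof
    fix e assume e: "e \<in> {e. e \<subseteq> {x, y, z, u} \<and> card e = 2}"
    then obtain a b where ab: "e = {a, b}" "a \<noteq> b" by (auto simp: card_2_iff)
    have "a \<in> {x, y, z, u}" "b \<in> {x, y, z, u}" using e ab by auto
    then show "e \<in> {{x, y}, {y, z}, {z, x}, {u, x}, {u, y}, {u, z}}"
      using ab by (elim insertE emptyE) (simp_all add: insert_commute)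
  qed
qed (use assms in auto)

theorem theorem4:
  fixes G G' :: "('v, 'e) graph" and c c' :: "'e \<Rightarrow> nat" and n k :: nat
    and x y z :: 'v and e\<^sub>1 e\<^sub>2 e\<^sub>3 :: 'e and A T :: "'e set"
  assumes "k \<in> {1, 2, 3}"
    and "simple_graph G"
    and "card (verts G) = n"
    and "card (edges G) = 2 * (n - 1) - k"
    and "c \<in> edges G \<rightarrow> {1..n - 1}"
    and "\<forall>i \<in> {1..n - 1}. card {e \<in> edges G. c e = i} \<le> 2"
    and "\<nexists>C. rainbow_cycle G c C"
    and "A = singular_edges G c"
    and "card A = k"
    and "distinct [x, y, z]"
    and "{x, y, z} \<subseteq> verts G"
    and "distinct [e\<^sub>1, e\<^sub>2, e\<^sub>3]"
    and "T = {e\<^sub>1, e\<^sub>2, e\<^sub>3}"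
    and "T \<inter> edges G = {}"
    and "G' = \<lparr>verts = verts G, edges = edges G \<union> T,
               ends = (ends G)(e\<^sub>1 := {x, y}, e\<^sub>2 := {y, z}, e\<^sub>3 := {z, x})\<rparr>"
    and "\<forall>e \<in> edges G. c' e = c e"
    and "\<forall>e \<in> T. c' e = n"
    and "\<not> graph_isomorphic (edge_induced G' (T \<union> A)) (complete_graph 4)"
  shows "\<exists>C\<^sub>1 C\<^sub>2. rainbow_cycle G' c' C\<^sub>1 \<and> rainbow_cycle G' c' C\<^sub>2 \<and> C\<^sub>1 \<inter> C\<^sub>2 = {} \<and>
           card C\<^sub>1 + card C\<^sub>2 \<le> n + 2 \<and> card (C\<^sub>1 \<inter> T) = 1 \<and> card (C\<^sub>2 \<inter> T) = 1"
proof -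
  let ?V = "verts G" and ?E = "edges G"
  interpret edge_coloured "ends G" c .
  have fin: "finite ?V" "finite ?E" and ends: "\<And>e. e \<in> ?E \<Longrightarrow> ends G e \<subseteq> ?V \<and> card (ends G e) = 2"
    and inj: "inj_on (ends G) ?E" using assms(2) unfolding simple_graph_def by auto
  have A_def: "A = {e \<in> ?E. \<forall>f \<in> ?E. c f = c e \<longrightarrow> f = e}" using assms(8) unfolding singular_edges_def .
  have AE: "A \<subseteq> ?E" unfolding A_def by simp
  have A_singular: "f = e" if "e \<in> A" "f \<in> ?E" "c f = c e" for e f using that unfolding A_def by simp
  have col: "c e \<in> {1..n - 1}" if "e \<in> ?E" for e using assms(5) that by auto
  have le2: "card {e \<in> ?E. c e = i} \<le> 2" for i
  proof (cases "i \<in> {1..n - 1}")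
    case False
    then have "{e \<in> ?E. c e = i} = {}" using col by blast
    then show ?thesis by (simp only: card.empty)
  qed (use assms(6) in blast)
  have "rainbow_acyclic ?E"
  proof (rule rainbow_acyclicI[OF fin(2)])
    show "card (ends G e) = 2" if "e \<in> ?E" for e using ends[OF that] by blast
  next
    fix s t P W e
    assume h: "rainbow_path s t P W" "P \<subseteq> ?E" "e \<in> ?E" "ends G e = {t, s}" "c e \<notin> c ` P"
    have "W \<subseteq> ?V"
    proof -
      have "rainbow_path s t P W \<Longrightarrow> P \<subseteq> ?E \<Longrightarrow> t \<in> ?V \<Longrightarrow> W \<subseteq> ?V"
      proof (induction rule: rainbow_path.induct)
        case (cons s' t P W e s)
        then show ?case using ends[of e] by auto
      qed simp
      then show ?thesis using h ends[OF h(3)] by auto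
    qed
    moreover have "e \<notin> P" using h(5) by blast
    ultimately have "cycle G (insert e P)" using h by (intro rainbow_path_cycle[OF h(1,4)]) auto
    moreover have "inj_on c (insert e P)" using rainbow_path_basic(6)[OF h(1)] h(5) by auto
    ultimately show False using assms(7) unfolding rainbow_cycle_def by blast
  qed
  moreover have "card (c ` ?E) + 1 = card ?V"
  proof -
    \<comment> \<open>Every occurring colour has two edges or a single singular one; summation gives
      \<open>card ?E + k\<close> as twice the number of colours.\<close>
    have "card {e \<in> ?E. c e = i} + (if i \<in> c ` A then 1 else 0) = 2" if i: "i \<in> c ` ?E" for i
    proof (cases "i \<in> c ` A")
      case True
      then obtain e where e: "e \<in> A" "c e = i" by blast
      then have "f \<in> ?E \<and> c f = i \<longleftrightarrow> f = e" for f using A_singular[OF e(1)] AE by auto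
      then have "{e \<in> ?E. c e = i} = {e}" by simp
      then show ?thesis using True by simp
    next
      case False
      obtain e where e: "e \<in> ?E" "c e = i" using i by blast
      then have "e \<notin> A" using False by blast
      then have "\<not> (\<forall>f \<in> ?E. c f = i \<longrightarrow> f = e)" using e unfolding A_def by simp
      then obtain f where f: "f \<in> ?E" "c f = i" "f \<noteq> e" by blast
      have "card {e, f} \<le> card {e \<in> ?E. c e = i}" using e f fin(2) by (intro card_mono) auto
      then show ?thesis using le2[of i] f(3) False by simp
    qed
    then have "(\<Sum>i \<in> c ` ?E. card {e \<in> ?E. c e = i} + (if i \<in> c ` A then 1 else 0)) = 2 * card (c ` ?E)" by simp
    moreover have "(\<Sum>i \<in> c ` ?E. card {e \<in> ?E. c e = i}) = card ?E"
      using sum.image_gen[OF fin(2), of "\<lambda>_. 1 :: nat" c] by simp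
    moreover have "(\<Sum>i \<in> c ` ?E. if i \<in> c ` A then 1 else 0) = k"
    proof -
      have "c ` ?E \<inter> c ` A = c ` A" using AE by blast
      moreover have "inj_on c A" using A_singular AE by (intro inj_onI) (metis subsetD)
      then have "card (c ` A) = k" using assms(9) by (simp add: card_image)
      ultimately show ?thesis using fin(2) by (simp add: sum.If_cases Collect_mem_eq)
    qed
    ultimately have m: "card ?E + k = 2 * card (c ` ?E)" by (simp add: sum.distrib)
    \<comment> \<open>This makes the number of edges positive, so the subtraction of natural numbers
      in the edge count is exact and exactly \<open>n - 1\<close> colours occur.\<close>
    have "k \<le> card ?E" using assms(9) card_mono[OF fin(2) AE] by simp
    moreover have "1 \<le> k" using assms(1) by auto
    ultimately have "card (c ` ?E) = n - 1" "n \<ge> 1" using m assms(4) by linarith+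
    then show ?thesis using assms(3) by simp
  qed
  moreover have "?V \<noteq> {}" using assms(11) by auto
  ultimately have "\<exists>A. built ?V ?E A"
    using fin ends le2 by (intro built_if_rainbow_acyclic)
  then obtain A' where A': "built ?V ?E A'" by (rule exE)
  have "A' = A" unfolding A_def by (rule built_basic(4)[OF A'])
  then have b: "built ?V ?E A" using A' by simp
  have V: "x \<in> ?V" "y \<in> ?V" "z \<in> ?V" and ne: "x \<noteq> y" "y \<noteq> z" "z \<noteq> x" using assms(10,11) by auto
  have t: "terminal ?V {x}" "terminal ?V {y}" "terminal ?V {z}" using V terminal_singleton by auto
  have disj: "{x} \<inter> {y} = {}" "{x} \<inter> {z} = {}" "{y} \<inter> {z} = {}" using ne by auto
  have ends': "ends G' e\<^sub>1 = {x, y}" "ends G' e\<^sub>2 = {y, z}" "ends G' e\<^sub>3 = {z, x}"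
    "\<And>e. e \<in> ?E \<Longrightarrow> ends G' e = ends G e" and G': "verts G' = ?V" "edges G' = ?E \<union> T"
    using assms(12-15) by auto
  \<comment> \<open>The centre \<open>u\<close> is a fourth vertex because edges have two ends, and
    the triangle and the star together give all six pairs of the four vertices.\<close>
  have star: False if u: "ends G ` A = {{u, x}, {u, y}, {u, z}}" for u
  proof -
    have two: "card e = 2" if "e \<in> {{u, x}, {u, y}, {u, z}}" for e using that ends AE unfolding u[symmetric] by auto
    have "u \<noteq> x" "u \<noteq> y" "u \<noteq> z" using two[of "{u, x}"] two[of "{u, y}"] two[of "{u, z}"] by auto
    then have dist: "distinct [x, y, z, u]" using ne by auto
    have imA: "ends G' ` A = {{u, x}, {u, y}, {u, z}}" using ends'(4) AE u by (metis (no_types, lifting) image_cong subsetD)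
    have imT: "ends G' ` T = {{x, y}, {y, z}, {z, x}}" using assms(13) ends' by simp
    have "graph_isomorphic (edge_induced G' (T \<union> A)) (complete_graph 4)"
    proof (rule graph_isomorphic_complete_4)
      show "card {x, y, z, u} = 4" using dist by simp
      show "ends G' ` (T \<union> A) = {e. e \<subseteq> {x, y, z, u} \<and> card e = 2}"
        unfolding two_subsets_of_four[OF dist] image_Un imA imT by auto
      have "inj_on (ends G') T" unfolding assms(13) using ends' ne assms(12) by (auto simp: doubleton_eq_iff)
      moreover have "inj_on (ends G') A" using inj AE ends'(4) by (simp add: inj_on_def subset_iff)
      moreover have "ends G' ` T \<inter> ends G' ` A = {}" unfolding imA imT using dist by (auto simp: doubleton_eq_iff)
      ultimately show "inj_on (ends G') (T \<union> A)" unfolding inj_on_Un by blast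
    qed
    then show False using assms(18) by blast
  qed
  \<comment> \<open>A singleton root takes one from \<open>n + 1\<close>, so the two paths have at
    most \<open>n\<close> edges; the two triangle edges raise this to \<open>n + 2\<close>.\<close>
  have "forked ?V ?E (n + 1) {x} {y} {z}"
  proof -
    have n: "card ?V < n + 1" using assms(3) by simp
    consider "card A = 1" | "card A = 2" | "card A = 3" using assms(1,9) by auto
    then show ?thesis
    proof cases
      case 1
      then obtain a where "A = {a}" by (rule card_1_singletonE)
      then have "fork ?V ?E (n + 1) {x} {y} {z}"
        using b ne(2) assms(3) by (intro fork_one_singular[OF _ inj t(1) V(2,3)]) auto
      then show ?thesis unfolding forked_def by blast
    next
      case 2
      then show ?thesis using forked_two_singular[OF b inj _ t disj n] by blast
    next
      case 3
      have "\<not> (\<exists>x' y' z' u. {x} = {x'} \<and> {y} = {y'} \<and> {z} = {z'} \<and> ends G ` A = {{u, x'}, {u, y'}, {u, z'}})"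
        using star by auto
      then show ?thesis using forked_three_singular[OF b inj 3 t _ n] by blast
    qed
  qed
  \<comment> \<open>The triangle edges used are the two at the root \<open>p\<close>. Both have
    colour \<open>n\<close>, but each cycle contains only one of them.\<close>
  moreover have cycles: ?thesis
    if f: "fork ?V ?E (n + 1) {p} {q} {r}" and g: "g \<in> T" "h \<in> T" "g \<noteq> h" "ends G' g = {q, p}" "ends G' h = {r, p}"
      for p q r g h
  proof -
    obtain P Q where PQ: "linked ?V ?E p q P" "linked ?V ?E p r Q" "P \<inter> Q = {}" "card P + card Q \<le> n"
      using f by (elim forkE) auto
    have cyc: "rainbow_cycle G' c' (insert d R) \<and> insert d R \<inter> T = {d} \<and> card (insert d R) = Suc (card R)"
      if R: "linked ?V ?E p s R" and d: "d \<in> T" "ends G' d = {s, p}" for s R d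
    proof -
      obtain W where W: "W \<subseteq> ?V" "rainbow_path p s R W" "R \<subseteq> ?E" using R by (auto simp: linked_def)
      have dR: "d \<notin> R" using d(1) W(3) assms(14) by blast
      have "cycle G' (insert d R)"
        by (rule rainbow_path_cycle[OF W(2) d(2) dR]) (use d W G' ends'(4) in auto)
      moreover have "c' e \<noteq> n" if "e \<in> R" for e
      proof -
        have "e \<in> ?E" using that W(3) by blast
        then have "c' e = c e" "1 \<le> c e" "c e \<le> n - 1" using assms(16) col[of e] by auto
        then show ?thesis by linarith
      qed
      moreover have "inj_on c' R" using rainbow_path_basic(6)[OF W(2)] W(3) assms(16) by (simp add: inj_on_def subset_iff)
      ultimately have "rainbow_cycle G' c' (insert d R)"
        unfolding rainbow_cycle_def using assms(17) d(1) by auto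
      moreover have "insert d R \<inter> T = {d}" using d(1) W(3) assms(14) by blast
      ultimately show ?thesis using dR rainbow_path_basic(1)[OF W(2)] by simp
    qed
    note P = cyc[OF PQ(1) g(1,4)] and Q = cyc[OF PQ(2) g(2,5)]
    have "g \<notin> Q" "h \<notin> P" using g linked_in(2)[OF PQ(1)] linked_in(2)[OF PQ(2)] assms(14) by blast+
    then have "insert g P \<inter> insert h Q = {}" using PQ(3) g(3) by blast
    then show ?thesis using P Q PQ(4) by (intro exI[of _ "insert g P"] exI[of _ "insert h Q"]) auto
  qed
  ultimately show ?thesis
  proof -
    have T: "e\<^sub>1 \<in> T" "e\<^sub>2 \<in> T" "e\<^sub>3 \<in> T" "e\<^sub>1 \<noteq> e\<^sub>3" "e\<^sub>1 \<noteq> e\<^sub>2" "e\<^sub>3 \<noteq> e\<^sub>2" using assms(12,13) by auto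
    have flip: "ends G' e\<^sub>1 = {y, x}" "ends G' e\<^sub>2 = {z, y}" "ends G' e\<^sub>3 = {x, z}" using ends' by auto
    consider "fork ?V ?E (n + 1) {x} {y} {z}" | "fork ?V ?E (n + 1) {y} {x} {z}" | "fork ?V ?E (n + 1) {z} {x} {y}"
      using \<open>forked ?V ?E (n + 1) {x} {y} {z}\<close> unfolding forked_def by blast
    then show ?thesis
    proof cases
      case 1 then show ?thesis by (rule cycles[OF _ T(1,3,4) flip(1) ends'(3)])
    next
      case 2 then show ?thesis by (rule cycles[OF _ T(1,2,5) ends'(1) flip(2)])
    next
      case 3 then show ?thesis by (rule cycles[OF _ T(3,2,6) flip(3) ends'(2)])
    qed
  qed
qed

end
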